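(* Let $M$ be a smooth manifold of dimension $m+n$ and let $\mathcal{D}$ be an $m$-dimensional smooth tangent distribution on $M$. Then $\mathcal{D}$ is completely integrable if and only if it is closed under the Lie bracket, i.e. $[X,Y]\in\mathcal{D}$ for all $X,Y\in\mathcal{D}$.
   Context: An $m$-dimensional tangent distribution $\mathcal{D}$ on $M$ assigns to each $x\in M$ an $m$-dimensional subspace $\mathcal{D}_x\subseteq T_xM$, smoothly: locally $\mathcal{D}$ is spanned by $m$ smooth vector fields. As a standing convention these may be taken globally, so that $\mathcal{D}=\langle X_1,\dots,X_m\rangle$ (i.e. $\mathcal{D}_x=\mathrm{span}_{\mathbb{R}}\{X_1(x),\dots,X_m(x)\}$ for all $x$) and there are smooth $1$-forms $\omega^1,\dots,\omega^n$ on $M$ spanning, at each $x$, the annihilator $\{\alpha\in T_x^*M : \alpha|_{\mathcal{D}_x}=0\}$. For a vector field $X$ on $M$, $X\in\mathcal{D}$ means that $X$ is smooth and $X(x)\in\mathcal{D}_x$ for all $x\in M$. An integral manifold of $\mathcal{D}$ is an injectively immersed submanifold $N\subset M$ with $T_xN\subseteq\mathcal{D}_x$ for all $x\in N$. An integral manifold $N$ is maximal if for each $x\in N$ there is an open neighborhood $U$ of $x$ in $M$ such that no integral manifold $N'$ with $\dim N'>\dim N$ contains $N\cap U$. The distribution $\mathcal{D}$ is completely integrable if every maximal integral manifold $N$ satisfies $\dim N=m$ (equivalently, $T_xN=\mathcal{D}_x$ for all $x\in N$). *)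

theory Defs
  imports "HOL-Analysis.Analysis" "HOL-Library.Function_Algebras"
begin

text \<open>
  Dimensions have to vary inside formulas (submanifolds of all dimensions are quantified over), so
  \<open>\<real>\<^sup>k\<close> is realised as a \<open>k\<close>-dimensional linear subspace \<open>S\<close> of a Euclidean space type \<open>'e\<close>. Every
  \<open>k \<ge> 0\<close> occurs, and all subspaces of \<open>'e\<close> are available as model spaces at the same time.
\<close>

text \<open>
  Here \<open>V\<close> is relatively open in the subspace \<open>S\<close>. The Frechet derivative within \<open>V\<close> is then
  uniquely determined on \<open>S\<close> (and only there), so it is only ever applied to vectors in \<open>S\<close>.
\<close>

primrec Ck_on ::
  "nat \<Rightarrow> 'e::euclidean_space set \<Rightarrow> 'e set \<Rightarrow> ('e \<Rightarrow> 'f::real_normed_vector) \<Rightarrow> bool" where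
  "Ck_on 0 S V f \<longleftrightarrow> continuous_on V f"
| "Ck_on (Suc k) S V f \<longleftrightarrow> f differentiable_on V \<and>
     (\<forall>v\<in>S. Ck_on k S V (\<lambda>x. frechet_derivative f (at x within V) v))"

definition smooth_on :: "'e::euclidean_space set \<Rightarrow> 'e set \<Rightarrow> ('e \<Rightarrow> 'f::real_normed_vector) \<Rightarrow> bool" where
  "smooth_on S V f \<longleftrightarrow> (\<forall>k. Ck_on k S V f)"

type_synonym ('a, 'e) chart = "'a set \<times> ('a \<Rightarrow> 'e)"

record ('a, 'e) mfd =
  mtop :: "'a topology"
  model :: "'e set"
  atlas :: "('a, 'e) chart set"

abbreviation points :: "('a, 'e) mfd \<Rightarrow> 'a set" where
  "points M \<equiv> topspace (mtop M)"

abbreviation chart_inv :: "('a, 'e) chart \<Rightarrow> 'e \<Rightarrow> 'a" where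
  "chart_inv c \<equiv> inv_into (fst c) (snd c)"

definition charts_at :: "('a, 'e) mfd \<Rightarrow> 'a \<Rightarrow> ('a, 'e) chart set" where
  "charts_at M x = {c \<in> atlas M. x \<in> fst c}"

definition is_chart :: "'a topology \<Rightarrow> 'e::euclidean_space set \<Rightarrow> ('a, 'e) chart \<Rightarrow> bool" where
  "is_chart T S c \<longleftrightarrow>
     openin T (fst c) \<and> openin (top_of_set S) (snd c ` fst c) \<and>
     homeomorphic_map (subtopology T (fst c)) (top_of_set (snd c ` fst c)) (snd c)"

definition smooth_manifold :: "('a, 'e::euclidean_space) mfd \<Rightarrow> bool" where
  "smooth_manifold M \<longleftrightarrow>
     Hausdorff_space (mtop M) \<and> second_countable (mtop M) \<and> subspace (model M) \<and>
     (\<forall>c\<in>atlas M. is_chart (mtop M) (model M) c) \<and>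
     (\<Union>c\<in>atlas M. fst c) = points M \<and>
     (\<forall>c\<in>atlas M. \<forall>d\<in>atlas M.
        smooth_on (model M) (snd c ` (fst c \<inter> fst d)) (snd d \<circ> chart_inv c))"

definition mfd_dim :: "('a, 'e::euclidean_space) mfd \<Rightarrow> nat" where
  "mfd_dim M = dim (model M)"

definition rep_dom :: "('a, 'e) chart \<Rightarrow> ('b, 'g) chart \<Rightarrow> ('a \<Rightarrow> 'b) \<Rightarrow> 'e set" where
  "rep_dom c d f = snd c ` {x \<in> fst c. f x \<in> fst d}"

definition rep :: "('a, 'e) chart \<Rightarrow> ('b, 'g) chart \<Rightarrow> ('a \<Rightarrow> 'b) \<Rightarrow> 'e \<Rightarrow> 'g" where
  "rep c d f = snd d \<circ> f \<circ> chart_inv c"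

definition smooth_map ::
  "('a, 'e::euclidean_space) mfd \<Rightarrow> ('b, 'g::euclidean_space) mfd \<Rightarrow> ('a \<Rightarrow> 'b) \<Rightarrow> bool" where
  "smooth_map M N f \<longleftrightarrow> continuous_map (mtop M) (mtop N) f \<and>
     (\<forall>c\<in>atlas M. \<forall>d\<in>atlas N. smooth_on (model M) (rep_dom c d f) (rep c d f))"

text \<open>
  A tangent vector at \<open>x\<close> is the family of its coordinate vectors with respect to all charts around
  \<open>x\<close>, related by the derivatives of the transition maps; at every other argument the family is \<open>0\<close>,
  so that equality of tangent vectors is equality of functions.
\<close>

type_synonym ('a, 'e) tvec = "('a, 'e) chart \<Rightarrow> 'e"

definition tangent_space :: "('a, 'e::euclidean_space) mfd \<Rightarrow> 'a \<Rightarrow> ('a, 'e) tvec set" where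
  "tangent_space M x =
     {v. (\<forall>c\<in>charts_at M x. v c \<in> model M) \<and>
         (\<forall>c\<in>charts_at M x. \<forall>d\<in>charts_at M x.
            v d = frechet_derivative (snd d \<circ> chart_inv c)
                    (at (snd c x) within snd c ` (fst c \<inter> fst d)) (v c)) \<and>
         (\<forall>c. c \<notin> charts_at M x \<longrightarrow> v c = 0)}"

text \<open>Pointwise linear structure; provides \<open>tv.subspace\<close>, \<open>tv.span\<close> and \<open>tv.dim\<close>.\<close>

definition tscale :: "real \<Rightarrow> ('c \<Rightarrow> 'e::real_vector) \<Rightarrow> ('c \<Rightarrow> 'e)" where
  "tscale r v = (\<lambda>c. r *\<^sub>R v c)"

global_interpretation tv: vector_space "tscale :: real \<Rightarrow> ('c \<Rightarrow> 'e::real_vector) \<Rightarrow> ('c \<Rightarrow> 'e)"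
  by unfold_locales (auto simp: tscale_def fun_eq_iff algebra_simps)

text \<open>
  The tangent map is computed in an arbitrary chart around \<open>x\<close>; on tangent vectors of smooth
  manifolds the result does not depend on this choice.
\<close>

definition tangent_map ::
  "('a, 'e::euclidean_space) mfd \<Rightarrow> ('b, 'g::euclidean_space) mfd \<Rightarrow> ('a \<Rightarrow> 'b) \<Rightarrow> 'a \<Rightarrow>
   ('a, 'e) tvec \<Rightarrow> ('b, 'g) tvec" where
  "tangent_map M N f x v =
     (let c = (SOME c. c \<in> charts_at M x)
      in (\<lambda>d. if d \<in> charts_at N (f x)
              then frechet_derivative (rep c d f) (at (snd c x) within rep_dom c d f) (v c)
              else 0))"

type_synonym ('a, 'e) vfield = "'a \<Rightarrow> ('a, 'e) tvec"

definition smooth_vfield_on ::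
  "('a, 'e::euclidean_space) mfd \<Rightarrow> 'a set \<Rightarrow> ('a, 'e) vfield \<Rightarrow> bool" where
  "smooth_vfield_on M W X \<longleftrightarrow>
     (\<forall>x\<in>W. X x \<in> tangent_space M x) \<and>
     (\<forall>c\<in>atlas M. smooth_on (model M) (snd c ` (fst c \<inter> W)) (\<lambda>u. X (chart_inv c u) c))"

text \<open>
  In coordinates \<open>[X, Y]\<^sup>j = X(Y\<^sup>j) - Y(X\<^sup>j)\<close>, i.e. \<open>[X, Y] = DY\<cdot>X - DX\<cdot>Y\<close>.
\<close>

definition lie_bracket ::
  "('a, 'e::euclidean_space) mfd \<Rightarrow> ('a, 'e) vfield \<Rightarrow> ('a, 'e) vfield \<Rightarrow> ('a, 'e) vfield" where
  "lie_bracket M X Y x =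
     (\<lambda>c. if c \<in> charts_at M x
          then frechet_derivative (\<lambda>u. Y (chart_inv c u) c) (at (snd c x) within snd c ` fst c) (X x c)
             - frechet_derivative (\<lambda>u. X (chart_inv c u) c) (at (snd c x) within snd c ` fst c) (Y x c)
          else 0)"

type_synonym ('a, 'e) distribution = "'a \<Rightarrow> ('a, 'e) tvec set"

definition tangent_distribution ::
  "('a, 'e::euclidean_space) mfd \<Rightarrow> nat \<Rightarrow> ('a, 'e) distribution \<Rightarrow> bool" where
  "tangent_distribution M m D \<longleftrightarrow>
     (\<forall>x\<in>points M. tv.subspace (D x) \<and> D x \<subseteq> tangent_space M x \<and> tv.dim (D x) = m) \<and>
     (\<forall>x\<in>points M. \<exists>W X. openin (mtop M) W \<and> x \<in> W \<and>
        (\<forall>i<m. smooth_vfield_on M W (X i)) \<and>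
        (\<forall>y\<in>W. D y = tv.span ((\<lambda>i. X i y) ` {..<m})))"

definition vfield_in ::
  "('a, 'e::euclidean_space) mfd \<Rightarrow> ('a, 'e) distribution \<Rightarrow> ('a, 'e) vfield \<Rightarrow> bool" where
  "vfield_in M D X \<longleftrightarrow> smooth_vfield_on M (points M) X \<and> (\<forall>x\<in>points M. X x \<in> D x)"

definition closed_under_bracket ::
  "('a, 'e::euclidean_space) mfd \<Rightarrow> ('a, 'e) distribution \<Rightarrow> bool" where
  "closed_under_bracket M D \<longleftrightarrow>
     (\<forall>X Y. vfield_in M D X \<longrightarrow> vfield_in M D Y \<longrightarrow> vfield_in M D (lie_bracket M X Y))"

text \<open>
  The manifold \<open>N\<close> carries its own topology (in general finer than the subspace topology) and smooth
  structure; injectivity of the immersion is expressed by taking its points to be points of \<open>M\<close>.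
  It is not required to be connected, but, as usual, it is nonempty, since otherwise the empty set
  would be a maximal integral manifold of every dimension.
\<close>

definition injectively_immersed_submanifold ::
  "('a, 'e::euclidean_space) mfd \<Rightarrow> ('a, 'e) mfd \<Rightarrow> bool" where
  "injectively_immersed_submanifold M N \<longleftrightarrow>
     smooth_manifold N \<and> points N \<noteq> {} \<and> points N \<subseteq> points M \<and>
     smooth_map N M (\<lambda>x. x) \<and>
     (\<forall>x\<in>points N. inj_on (tangent_map N M (\<lambda>x. x) x) (tangent_space N x))"

definition integral_manifold ::
  "('a, 'e::euclidean_space) mfd \<Rightarrow> ('a, 'e) distribution \<Rightarrow> ('a, 'e) mfd \<Rightarrow> bool" where
  "integral_manifold M D N \<longleftrightarrow>
     injectively_immersed_submanifold M N \<and>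
     (\<forall>x\<in>points N. tangent_map N M (\<lambda>x. x) x ` tangent_space N x \<subseteq> D x)"

definition maximal_integral_manifold ::
  "('a, 'e::euclidean_space) mfd \<Rightarrow> ('a, 'e) distribution \<Rightarrow> ('a, 'e) mfd \<Rightarrow> bool" where
  "maximal_integral_manifold M D N \<longleftrightarrow>
     integral_manifold M D N \<and>
     (\<forall>x\<in>points N. \<exists>U. openin (mtop M) U \<and> x \<in> U \<and>
        \<not> (\<exists>N'. integral_manifold M D N' \<and> mfd_dim N' > mfd_dim N \<and> points N \<inter> U \<subseteq> points N'))"

definition completely_integrable ::
  "('a, 'e::euclidean_space) mfd \<Rightarrow> nat \<Rightarrow> ('a, 'e) distribution \<Rightarrow> bool" where
  "completely_integrable M m D \<longleftrightarrow>
     (\<forall>N. maximal_integral_manifold M D N \<longrightarrow> mfd_dim N = m)"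

end

theory Submission
  imports Defs
begin

text \<open>
  The larger \<open>U\<close>, the weaker the condition in the definition of maximality, so \<open>N\<close> is maximal iff no
  integral manifold of larger dimension contains it. Near a point, \<open>D\<close> consists of the vectors
  \<open>a u s\<close> for a smooth family \<open>a\<close> of linear maps with a common linear left inverse \<open>P\<close>, and \<open>D\<close> is closed
  under brackets at \<open>u\<close> iff \<open>Da(u)(a u s) t\<close> is symmetric in \<open>s\<close> and \<open>t\<close>.

  If \<open>D\<close> is completely integrable, then an integral manifold of largest dimension among those through \<open>x\<close>
  (a point is one) is maximal, hence \<open>m\<close>-dimensional, and differentiating its tangency condition shows
  the symmetry at \<open>x\<close>.

  Conversely, bump functions provide enough global fields in \<open>D\<close> to obtain the symmetry everywhere, and Picard
  iteration along rays then solves \<open>DG(x) = a(G(x))\<close>, which gives an \<open>m\<close>-dimensional integral manifold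
  (a plaque) through every point. By uniqueness of solutions, every integral manifold \<open>N\<close> meets a plaque in
  an open subset of \<open>N\<close>, so countably many plaques cover \<open>N\<close>. Their union is an \<open>m\<close>-dimensional integral
  manifold that contains \<open>N\<close>.
\<close>

subsection \<open>Functions of class \<open>C\<^sup>k\<close> on relatively open sets\<close>

text \<open>Why symmetry is the bracket condition: \<open>P (a u s)\<close> does not depend on
  \<open>u\<close>, so \<open>P\<close> annihilates every derivative of \<open>a\<close>. The
  bracket \<open>Da(a s) t - Da(a t) s\<close> of the local fields \<open>a(.) s\<close> and
  \<open>a(.) t\<close> is thus killed by \<open>P\<close>, while \<open>P\<close> is injective on
  the distribution; it is tangent iff it is zero. The obstacle in the converse direction is
  maximality. A competitor must contain the whole of \<open>N\<close>, and \<open>N\<close> may be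
  neither embedded nor connected: it can return to any neighbourhood in infinitely many sheets, so a
  single plaque is not enough. When plaques are glued, overlaps are controlled by uniqueness: a
  plaque is a graph over a fixed model space \<open>L\<close>, \<open>P\<close> recovers its
  parameter, and a map tangent to the distribution that touches the plaque has to follow it. The
  union gets the topology of its plaques, in general finer than the induced one; it is second
  countable because countably many plaques are taken. Derivatives within a relatively open set are
  determined only along its model space. Composition with a linear projection onto that space leads
  to open sets of the ambient type.\<close>

definition relopen :: "'e::euclidean_space set \<Rightarrow> 'e set \<Rightarrow> bool" where
  "relopen S V \<longleftrightarrow> subspace S \<and> openin (top_of_set S) V"

lemma relopen_subset: "relopen S V \<Longrightarrow> V \<subseteq> S"
  unfolding relopen_def by (metis openin_subset topspace_euclidean_subtopology)

lemma relopen_in: "relopen S V \<Longrightarrow> x \<in> V \<Longrightarrow> x \<in> S"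
  using relopen_subset by blast

lemma relopen_Int: "relopen S V \<Longrightarrow> relopen S W \<Longrightarrow> relopen S (V \<inter> W)"
  by (auto simp: relopen_def)

lemma relopen_UNIV: "relopen UNIV V \<longleftrightarrow> open V"
  by (simp add: relopen_def)

lemma relopen_Int_open: "relopen S V \<Longrightarrow> open U \<Longrightarrow> relopen S (V \<inter> U)"
  unfolding relopen_def by (auto simp: openin_open)

lemma relopen_preimage:
  assumes "relopen S V" "continuous_on V f" "openin (top_of_set T) W" "f ` V \<subseteq> T"
  shows "relopen S {x \<in> V. f x \<in> W}"
proof -
  have "openin (top_of_set V) {x \<in> V. f x \<in> W}"
    using assms continuous_openin_preimage[of V f T W] by (simp add: vimage_def Int_def image_subset_iff_funcset)
  then show ?thesis
    using assms unfolding relopen_def by (meson openin_trans)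
qed

lemma at_within_openin_eq:
  assumes "openin (top_of_set S) V" "openin (top_of_set S) W" "x \<in> V" "x \<in> W"
  shows "at x within V = at x within W"
proof -
  obtain A B where A: "open A" "V = S \<inter> A" and B: "open B" "W = S \<inter> B"
    using assms by (auto simp: openin_open)
  show ?thesis
    by (rule at_within_nhd[of x "A \<inter> B"]) (use A B assms in auto)
qed

text \<open>A line through \<open>x\<close> in a direction \<open>v\<close> of \<open>S\<close>
  stays in \<open>V\<close> for small parameters, so both derivatives at \<open>v\<close> are the
  velocity of \<open>f\<close> along it, which is unique in one real variable. Directions outside
  \<open>S\<close> are not reached in this way.\<close>

lemma frechet_within_unique:
  fixes f :: "'e::euclidean_space \<Rightarrow> 'f::real_normed_vector"
  assumes ro: "relopen S V" and x: "x \<in> V" and f: "(f has_derivative f') (at x within V)" and v: "v \<in> S"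
  shows "frechet_derivative f (at x within V) v = f' v"
proof -
  define h where "h = frechet_derivative f (at x within V)"
  have h: "(f has_derivative h) (at x within V)"
    using f unfolding h_def by (metis frechet_derivative_works differentiable_def)
  have S: "subspace S" "openin (top_of_set S) V" using ro by (auto simp: relopen_def)
  obtain e where e: "e > 0" "ball x e \<inter> S \<subseteq> V"
    using S(2) x unfolding openin_contains_ball by blast
  define g where "g = (\<lambda>t::real. x + t *\<^sub>R v)"
  \<comment> \<open>The summand 1 covers the case \<open>v = 0\<close>.\<close>
  define d where "d = e / (norm v + 1)"
  have d: "d > 0" using e by (simp add: d_def add_nonneg_pos)
  have gV: "g t \<in> V" if "t \<in> {-d<..<d}" for t
  proof -
    have "\<bar>t\<bar> * norm v \<le> d * norm v" using that by (intro mult_right_mono) auto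
    also have "\<dots> < d * (norm v + 1)" using d by simp
    also have "\<dots> = e" using norm_ge_zero[of v] by (simp add: d_def add_nonneg_eq_0_iff)
    finally have "g t \<in> ball x e" by (simp add: g_def dist_norm)
    moreover have "g t \<in> S"
      unfolding g_def using S relopen_in[OF ro x] v by (simp add: subspace_add subspace_scale)
    ultimately show ?thesis using e by auto
  qed
  have g: "(g has_derivative (\<lambda>t. t *\<^sub>R v)) (at 0 within {-d<..<d})"
    unfolding g_def by (auto intro!: derivative_eq_intros)
  have "((f \<circ> g) has_derivative (k \<circ> (\<lambda>t. t *\<^sub>R v))) (at 0)"
    if "(f has_derivative k) (at x within V)" for k
  proof -
    have "(f has_derivative k) (at (g 0) within g ` {-d<..<d})"
      by (rule has_derivative_subset[of _ _ _ V]) (use that gV in \<open>auto simp: g_def\<close>)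
    then have "((f \<circ> g) has_derivative (k \<circ> (\<lambda>t. t *\<^sub>R v))) (at 0 within {-d<..<d})"
      by (rule diff_chain_within[OF g])
    then show ?thesis using d by (simp add: at_within_open[of 0 "{-d<..<d}"])
  qed
  from has_derivative_unique[OF this[OF h] this[OF f]] have "h (1 *\<^sub>R v) = f' (1 *\<^sub>R v)"
    by (metis comp_apply)
  then show ?thesis by (simp add: h_def)
qed

lemma has_derivative_cong_within:
  assumes "\<And>y. y \<in> V \<Longrightarrow> f y = g y" "x \<in> V"
  shows "(f has_derivative h) (at x within V) \<longleftrightarrow> (g has_derivative h) (at x within V)"
  using has_derivative_transform[OF assms(2), of g f h] has_derivative_transform[OF assms(2), of f g h] assms(1)
  by metis

lemma frechet_derivative_cong_within:
  assumes "\<And>y. y \<in> V \<Longrightarrow> f y = g y" "x \<in> V"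
  shows "frechet_derivative f (at x within V) = frechet_derivative g (at x within V)"
  using has_derivative_cong_within[OF assms] by (simp add: frechet_derivative_def)

lemma Ck_on_cong:
  "(\<And>x. x \<in> V \<Longrightarrow> f x = g x) \<Longrightarrow> Ck_on k S V f \<longleftrightarrow> Ck_on k S V g"
proof (induction k arbitrary: f g)
  case 0
  then show ?case by (simp cong: continuous_on_cong)
next
  case (Suc k)
  have "f differentiable_on V \<longleftrightarrow> g differentiable_on V"
    unfolding differentiable_on_def differentiable_def
    using has_derivative_cong_within[of V f g] Suc.prems by auto
  moreover have "Ck_on k S V (\<lambda>x. frechet_derivative f (at x within V) v) \<longleftrightarrow>
      Ck_on k S V (\<lambda>x. frechet_derivative g (at x within V) v)" for v
    by (rule Suc.IH, subst frechet_derivative_cong_within[OF Suc.prems]) auto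
  ultimately show ?case by simp
qed

text \<open>\<open>frechet_derivative\<close> is only some derivative, so an explicit formula
  \<open>f'\<close> can differ from it off \<open>S\<close>. The definition of \<open>Ck_on\<close>
  tests vectors of \<open>S\<close> alone, where the two agree; any convenient formula may therefore
  be used.\<close>

lemma Ck_on_SucI:
  fixes f :: "'e::euclidean_space \<Rightarrow> 'f::real_normed_vector"
  assumes ro: "relopen S V" and d: "\<And>x. x \<in> V \<Longrightarrow> (f has_derivative f' x) (at x within V)"
    and c: "\<And>v. v \<in> S \<Longrightarrow> Ck_on k S V (\<lambda>x. f' x v)"
  shows "Ck_on (Suc k) S V f"
proof -
  have "Ck_on k S V (\<lambda>x. frechet_derivative f (at x within V) v)" if "v \<in> S" for v
    using c[OF that] Ck_on_cong[of V "\<lambda>x. f' x v" "\<lambda>x. frechet_derivative f (at x within V) v" k S]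
      frechet_within_unique[OF ro _ d that] by auto
  moreover have "f differentiable_on V"
    unfolding differentiable_on_def differentiable_def using d by blast
  ultimately show ?thesis by simp
qed

lemma Ck_on_SucD:
  assumes "Ck_on (Suc k) S V f"
  shows "x \<in> V \<Longrightarrow> (f has_derivative frechet_derivative f (at x within V)) (at x within V)"
    and "v \<in> S \<Longrightarrow> Ck_on k S V (\<lambda>x. frechet_derivative f (at x within V) v)"
proof -
  have "f differentiable_on V" "\<forall>v\<in>S. Ck_on k S V (\<lambda>x. frechet_derivative f (at x within V) v)"
    using assms by simp_all
  then show "x \<in> V \<Longrightarrow> (f has_derivative frechet_derivative f (at x within V)) (at x within V)"
      "v \<in> S \<Longrightarrow> Ck_on k S V (\<lambda>x. frechet_derivative f (at x within V) v)"
    unfolding differentiable_on_def frechet_derivative_works by blast+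
qed

lemma Ck_on_continuous: "Ck_on k S V f \<Longrightarrow> continuous_on V f"
  by (cases k) (simp_all add: differentiable_imp_continuous_on)

lemma Ck_on_Suc_imp: "Ck_on (Suc k) S V f \<Longrightarrow> Ck_on k S V f"
proof (induction k arbitrary: f)
  case 0
  then show ?case using Ck_on_continuous by (metis Ck_on.simps(1))
next
  case (Suc k)
  then show ?case by (simp only: Ck_on.simps(2)[of "Suc k"] Ck_on.simps(2)[of k S V f]) blast
qed

lemma Ck_on_open_subset:
  assumes "relopen S V" "relopen S W" "W \<subseteq> V"
  shows "Ck_on k S V f \<Longrightarrow> Ck_on k S W f"
proof (induction k arbitrary: f)
  case 0
  then show ?case using assms by (auto intro: continuous_on_subset)
next
  case (Suc k)
  show ?case
  proof (rule Ck_on_SucI[OF assms(2), where f' = "\<lambda>x. frechet_derivative f (at x within V)"])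
    show "(f has_derivative frechet_derivative f (at x within V)) (at x within W)" if "x \<in> W" for x
      using has_derivative_subset[OF Ck_on_SucD(1)[OF Suc.prems] assms(3)] that assms(3) by blast
    show "Ck_on k S W (\<lambda>x. frechet_derivative f (at x within V) v)" if "v \<in> S" for v
      using Suc.IH[OF Ck_on_SucD(2)[OF Suc.prems that]] .
  qed
qed

text \<open>\<open>V\<close> and a relatively open subset \<open>W\<close> have the same filter at
  every point of \<open>W\<close>, hence literally the same chosen derivatives; this lets the
  induction pass to them.\<close>

lemma Ck_on_local:
  assumes ro: "relopen S V"
  shows "(\<And>x. x \<in> V \<Longrightarrow> \<exists>W. relopen S W \<and> x \<in> W \<and> W \<subseteq> V \<and> Ck_on k S W f) \<Longrightarrow> Ck_on k S V f"
proof (induction k arbitrary: f)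
  case 0
  have "continuous (at x within V) f" if x: "x \<in> V" for x
  proof -
    obtain W where W: "relopen S W" "x \<in> W" "Ck_on 0 S W f" using 0[OF x] by blast
    then have "at x within V = at x within W"
      using at_within_openin_eq ro x unfolding relopen_def by metis
    then show ?thesis using W by (simp add: continuous_on_eq_continuous_within)
  qed
  then show ?case by (simp add: continuous_on_eq_continuous_within)
next
  case (Suc k)
  have *: "\<exists>W. relopen S W \<and> x \<in> W \<and> W \<subseteq> V \<and> Ck_on (Suc k) S W f \<and>
      (\<forall>y\<in>W. at y within V = at y within W)" if x: "x \<in> V" for x
  proof -
    obtain W where W: "relopen S W" "x \<in> W" "W \<subseteq> V" "Ck_on (Suc k) S W f" using Suc.prems x by blast
    moreover have "at y within V = at y within W" if "y \<in> W" for y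
      by (rule at_within_openin_eq[of S]) (use W that ro in \<open>auto simp: relopen_def\<close>)
    ultimately show ?thesis by blast
  qed
  show ?case
  proof (rule Ck_on_SucI[OF ro, where f' = "\<lambda>x. frechet_derivative f (at x within V)"])
    fix x assume "x \<in> V"
    then obtain W where W: "x \<in> W" "Ck_on (Suc k) S W f" "\<forall>y\<in>W. at y within V = at y within W"
      using * by blast
    show "(f has_derivative frechet_derivative f (at x within V)) (at x within V)"
      using Ck_on_SucD(1)[OF W(2) W(1)] W by simp
  next
    fix v assume v: "v \<in> S"
    show "Ck_on k S V (\<lambda>x. frechet_derivative f (at x within V) v)"
    proof (rule Suc.IH)
      fix x assume "x \<in> V"
      then obtain W where W: "relopen S W" "x \<in> W" "W \<subseteq> V" "Ck_on (Suc k) S W f"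
          "\<forall>y\<in>W. at y within V = at y within W"
        using * by blast
      have "Ck_on k S W (\<lambda>x. frechet_derivative f (at x within V) v)"
        by (rule Ck_on_cong[THEN iffD1, OF _ Ck_on_SucD(2)[OF W(4) v]]) (use W in simp)
      with W show "\<exists>W. relopen S W \<and> x \<in> W \<and> W \<subseteq> V \<and> Ck_on k S W (\<lambda>x. frechet_derivative f (at x within V) v)"
        by blast
    qed
  qed
qed

lemma Ck_on_const: "relopen S V \<Longrightarrow> Ck_on k S V (\<lambda>x. c)"
proof (induction k arbitrary: c)
  case (Suc k)
  show ?case by (rule Ck_on_SucI[OF Suc.prems, where f' = "\<lambda>x v. 0"]) (use Suc in auto)
qed auto

lemma Ck_on_bounded_linear:
  assumes "relopen S V" "bounded_linear h"
  shows "Ck_on k S V h"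
proof (cases k)
  case 0
  then show ?thesis using assms by (simp add: linear_continuous_on)
next
  case (Suc j)
  show ?thesis unfolding Suc
    by (rule Ck_on_SucI[OF assms(1), where f' = "\<lambda>x. h"])
      (use assms in \<open>auto intro: Ck_on_const bounded_linear_imp_has_derivative\<close>)
qed

lemma Ck_on_bounded_linear_comp:
  assumes "relopen S V" "bounded_linear h"
  shows "Ck_on k S V f \<Longrightarrow> Ck_on k S V (\<lambda>x. h (f x))"
proof (induction k arbitrary: f)
  case 0
  then show ?case using assms by (auto intro: bounded_linear.continuous_on)
next
  case (Suc k)
  show ?case
    by (rule Ck_on_SucI[OF assms(1), where f' = "\<lambda>x v. h (frechet_derivative f (at x within V) v)"])
      (rule bounded_linear.has_derivative[OF assms(2) Ck_on_SucD(1)[OF Suc.prems]]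
         Suc.IH[OF Ck_on_SucD(2)[OF Suc.prems]], assumption)+
qed

lemma Ck_on_add:
  assumes "relopen S V"
  shows "Ck_on k S V f \<Longrightarrow> Ck_on k S V g \<Longrightarrow> Ck_on k S V (\<lambda>x. f x + g x)"
proof (induction k arbitrary: f g)
  case 0
  then show ?case by (auto intro: continuous_on_add)
next
  case (Suc k)
  show ?case
    by (rule Ck_on_SucI[OF assms(1), where f' = "\<lambda>x v. frechet_derivative f (at x within V) v
          + frechet_derivative g (at x within V) v"])
      (rule has_derivative_add[OF Ck_on_SucD(1)[OF Suc.prems(1)] Ck_on_SucD(1)[OF Suc.prems(2)]]
         Suc.IH[OF Ck_on_SucD(2)[OF Suc.prems(1)] Ck_on_SucD(2)[OF Suc.prems(2)]], assumption+)+
qed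

lemma Ck_on_sum:
  assumes "relopen S V"
  shows "(\<And>i. i \<in> I \<Longrightarrow> Ck_on k S V (f i)) \<Longrightarrow> Ck_on k S V (\<lambda>x. \<Sum>i\<in>I. f i x)"
  by (induction I rule: infinite_finite_induct) (simp_all add: Ck_on_const Ck_on_add assms)

lemma Ck_on_bilinear:
  assumes "relopen S V" "bounded_bilinear mul"
  shows "Ck_on k S V f \<Longrightarrow> Ck_on k S V g \<Longrightarrow> Ck_on k S V (\<lambda>x. mul (f x) (g x))"
proof (induction k arbitrary: f g)
  case 0
  then show ?case using assms by (auto intro: bounded_bilinear.continuous_on)
next
  case (Suc k)
  show ?case
  proof (rule Ck_on_SucI[OF assms(1), where f' = "\<lambda>x v. mul (f x) (frechet_derivative g (at x within V) v)
          + mul (frechet_derivative f (at x within V) v) (g x)"])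
    show "((\<lambda>x. mul (f x) (g x)) has_derivative (\<lambda>v. mul (f x) (frechet_derivative g (at x within V) v)
          + mul (frechet_derivative f (at x within V) v) (g x))) (at x within V)" if "x \<in> V" for x
      by (rule bounded_bilinear.FDERIV[OF assms(2) Ck_on_SucD(1)[OF Suc.prems(1) that] Ck_on_SucD(1)[OF Suc.prems(2) that]])
    show "Ck_on k S V (\<lambda>x. mul (f x) (frechet_derivative g (at x within V) v)
          + mul (frechet_derivative f (at x within V) v) (g x))" if "v \<in> S" for v
      by (rule Ck_on_add[OF assms(1) Suc.IH[OF Ck_on_Suc_imp[OF Suc.prems(1)] Ck_on_SucD(2)[OF Suc.prems(2) that]]
        Suc.IH[OF Ck_on_SucD(2)[OF Suc.prems(1) that] Ck_on_Suc_imp[OF Suc.prems(2)]]])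
  qed
qed

section \<open>Projections onto a model space\<close>

lemma subspace_projection:
  fixes S :: "'e::euclidean_space set"
  assumes "subspace S"
  shows "\<exists>p::'e \<Rightarrow> 'e. bounded_linear p \<and> range p \<subseteq> S \<and> (\<forall>x\<in>S. p x = x)"
proof -
  have "linear (\<lambda>x::'e. x)" by (simp add: linear_iff)
  from linear_exists_left_inverse_on[OF this assms] obtain p :: "'e \<Rightarrow> 'e"
    where "range p \<subseteq> S" "linear p" "\<forall>v\<in>S. p v = v" by (auto simp: inj_on_def)
  then show ?thesis by (meson linear_conv_bounded_linear)
qed

text \<open>The device for leaving the relatively open setting: \<open>f o proj S\<close> is defined
  on an open set of the ambient type and agrees with \<open>f\<close> on \<open>S\<close>.\<close>

definition proj :: "'e::euclidean_space set \<Rightarrow> 'e \<Rightarrow> 'e" where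
  "proj S = (SOME p. bounded_linear p \<and> range p \<subseteq> S \<and> (\<forall>x\<in>S. p x = x))"

lemma
  assumes "subspace S"
  shows proj_linear: "bounded_linear (proj S)" and proj_in: "proj S x \<in> S"
    and proj_id: "x \<in> S \<Longrightarrow> proj S x = x"
proof -
  have *: "bounded_linear (proj S) \<and> range (proj S) \<subseteq> S \<and> (\<forall>x\<in>S. proj S x = x)"
    unfolding proj_def by (rule someI_ex[OF subspace_projection[OF assms]])
  show "bounded_linear (proj S)" "proj S x \<in> S" "x \<in> S \<Longrightarrow> proj S x = x" using * by auto
qed

lemma relopen_proj_vimage:
  assumes "relopen S V"
  shows "open (proj S -` V)"
proof -
  have S: "subspace S" using assms by (simp add: relopen_def)
  obtain A where "open A" "V = S \<inter> A" using assms by (auto simp: relopen_def openin_open)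
  moreover have "continuous_on UNIV (proj S)" using proj_linear[OF S] by (simp add: linear_continuous_on)
  moreover have "proj S -` V = proj S -` A" using \<open>V = S \<inter> A\<close> proj_in[OF S] by auto
  ultimately show ?thesis by (simp add: open_vimage)
qed

text \<open>A derivative chosen within \<open>V\<close> may leave \<open>S\<close> on vectors off
  the model space of \<open>V\<close>. Projecting its values changes nothing where it is determined,
  and makes them admissible arguments for the derivative of a function on a relatively open subset
  of \<open>S\<close>.\<close>

lemma has_derivative_proj_left:
  fixes f :: "'e::real_normed_vector \<Rightarrow> 'f::euclidean_space"
  assumes "subspace S" "(f has_derivative f') (at x within V)" "f ` V \<subseteq> S" "x \<in> V"
  shows "(f has_derivative (\<lambda>v. proj S (f' v))) (at x within V)"
proof -
  have "((\<lambda>x. proj S (f x)) has_derivative (\<lambda>v. proj S (f' v))) (at x within V)"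
    by (rule bounded_linear.has_derivative[OF proj_linear assms(2)]) fact
  then show ?thesis
    by (rule has_derivative_transform[rotated 2]) (use assms proj_id[OF assms(1)] in auto)
qed

text \<open>In the chain rule the vector fed to \<open>Dg\<close> varies with \<open>x\<close>,
  whereas the induction hypothesis speaks about \<open>Dg\<close> on fixed vectors. Expanding along
  \<open>Basis\<close> leaves the fixed vectors \<open>proj T b\<close>, with coefficients of class
  \<open>C^k\<close>.\<close>

lemma Ck_on_comp:
  fixes f :: "'e::euclidean_space \<Rightarrow> 'g::euclidean_space" and g :: "'g \<Rightarrow> 'h::real_normed_vector"
  assumes V: "relopen S V" and W: "relopen T W" and fW: "f ` V \<subseteq> W"
  shows "Ck_on k S V f \<Longrightarrow> Ck_on k T W g \<Longrightarrow> Ck_on k S V (\<lambda>x. g (f x))"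
proof (induction k arbitrary: g)
  case 0
  then show ?case using fW by (auto intro: continuous_on_compose2)
next
  case (Suc k)
  have T: "subspace T" using W by (simp add: relopen_def)
  have fT: "f ` V \<subseteq> T" using fW relopen_subset[OF W] by blast
  define Df where "Df = (\<lambda>x. frechet_derivative f (at x within V))"
  define Dg where "Dg = (\<lambda>y. frechet_derivative g (at y within W))"
  have f: "(f has_derivative (\<lambda>v. proj T (Df x v))) (at x within V)" if "x \<in> V" for x
    unfolding Df_def by (rule has_derivative_proj_left[OF T Ck_on_SucD(1)[OF Suc.prems(1) that] fT that])
  have g: "(g has_derivative Dg y) (at y within W)" if "y \<in> W" for y
    unfolding Dg_def by (rule Ck_on_SucD(1)[OF Suc.prems(2) that])
  have expand: "Dg y (proj T w) = (\<Sum>b\<in>Basis. (w \<bullet> b) *\<^sub>R Dg y (proj T b))" if "y \<in> W" for y w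
  proof -
    interpret D: bounded_linear "Dg y" using g[OF that] by (rule has_derivative_bounded_linear)
    interpret P: bounded_linear "proj T" by (rule proj_linear[OF T])
    have "Dg y (proj T w) = Dg y (proj T (\<Sum>b\<in>Basis. (w \<bullet> b) *\<^sub>R b))" by (simp add: euclidean_representation)
    then show ?thesis by (simp add: D.sum D.scaleR P.sum P.scaleR)
  qed
  show ?case
  proof (rule Ck_on_SucI[OF V, where f' = "\<lambda>x v. \<Sum>b\<in>Basis. (Df x v \<bullet> b) *\<^sub>R Dg (f x) (proj T b)"])
    fix x assume x: "x \<in> V"
    have "((g \<circ> f) has_derivative (Dg (f x) \<circ> (\<lambda>v. proj T (Df x v)))) (at x within V)"
      by (rule diff_chain_within[OF f[OF x]], rule has_derivative_subset[OF g fW]) (use x fW in auto)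
    then show "((\<lambda>x. g (f x)) has_derivative (\<lambda>v. \<Sum>b\<in>Basis. (Df x v \<bullet> b) *\<^sub>R Dg (f x) (proj T b))) (at x within V)"
      unfolding o_def by (rule has_derivative_eq_rhs) (use expand x fW in blast)
  next
    fix v assume v: "v \<in> S"
    have "Ck_on k S V (\<lambda>x. Dg (f x) (proj T b))" for b
      by (rule Suc.IH[OF Ck_on_Suc_imp[OF Suc.prems(1)]])
        (use Ck_on_SucD(2)[OF Suc.prems(2) proj_in[OF T]] in \<open>auto simp: Dg_def\<close>)
    moreover have "Ck_on k S V (\<lambda>x. Df x v \<bullet> b)" for b
      unfolding Df_def by (rule Ck_on_bounded_linear_comp[OF V bounded_linear_inner_left Ck_on_SucD(2)[OF Suc.prems(1) v]])
    ultimately show "Ck_on k S V (\<lambda>x. \<Sum>b\<in>Basis. (Df x v \<bullet> b) *\<^sub>R Dg (f x) (proj T b))"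
      by (intro Ck_on_sum[OF V] Ck_on_bilinear[OF V bounded_bilinear_scaleR])
  qed
qed

section \<open>Calculus of smooth functions\<close>

abbreviation fderiv :: "'e::real_normed_vector set \<Rightarrow> ('e \<Rightarrow> 'f::real_normed_vector) \<Rightarrow> 'e \<Rightarrow> 'e \<Rightarrow> 'f" where
  "fderiv V f x \<equiv> frechet_derivative f (at x within V)"

lemma smooth_on_continuous: "smooth_on S V f \<Longrightarrow> continuous_on V f"
  unfolding smooth_on_def using Ck_on_continuous by blast

lemma smooth_on_cong: "(\<And>x. x \<in> V \<Longrightarrow> f x = g x) \<Longrightarrow> smooth_on S V f \<longleftrightarrow> smooth_on S V g"
  unfolding smooth_on_def using Ck_on_cong[of V f g] by blast

lemma smooth_on_has_derivative:
  "smooth_on S V f \<Longrightarrow> x \<in> V \<Longrightarrow> (f has_derivative fderiv V f x) (at x within V)"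
  unfolding smooth_on_def using Ck_on_SucD(1) by blast

lemma smooth_on_fderiv: "smooth_on S V f \<Longrightarrow> v \<in> S \<Longrightarrow> smooth_on S V (\<lambda>x. fderiv V f x v)"
  unfolding smooth_on_def using Ck_on_SucD(2) by blast

lemma smooth_on_open_subset:
  "relopen S V \<Longrightarrow> relopen S W \<Longrightarrow> W \<subseteq> V \<Longrightarrow> smooth_on S V f \<Longrightarrow> smooth_on S W f"
  unfolding smooth_on_def using Ck_on_open_subset by blast

lemma smooth_on_local:
  assumes "relopen S V" "\<And>x. x \<in> V \<Longrightarrow> \<exists>W. relopen S W \<and> x \<in> W \<and> W \<subseteq> V \<and> smooth_on S W f"
  shows "smooth_on S V f"
  unfolding smooth_on_def
proof
  show "Ck_on k S V f" for k
    by (rule Ck_on_local[OF assms(1)]) (use assms(2) in \<open>unfold smooth_on_def, blast\<close>)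
qed

lemma smooth_on_const: "relopen S V \<Longrightarrow> smooth_on S V (\<lambda>x. c)"
  by (simp add: smooth_on_def Ck_on_const)

lemma smooth_on_bounded_linear: "relopen S V \<Longrightarrow> bounded_linear h \<Longrightarrow> smooth_on S V h"
  by (simp add: smooth_on_def Ck_on_bounded_linear)

lemma smooth_on_bounded_linear_comp:
  "relopen S V \<Longrightarrow> bounded_linear h \<Longrightarrow> smooth_on S V f \<Longrightarrow> smooth_on S V (\<lambda>x. h (f x))"
  by (simp add: smooth_on_def Ck_on_bounded_linear_comp)

lemma smooth_on_add:
  "relopen S V \<Longrightarrow> smooth_on S V f \<Longrightarrow> smooth_on S V g \<Longrightarrow> smooth_on S V (\<lambda>x. f x + g x)"
  by (simp add: smooth_on_def Ck_on_add)

lemma smooth_on_sum: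
  "relopen S V \<Longrightarrow> (\<And>i. i \<in> I \<Longrightarrow> smooth_on S V (f i)) \<Longrightarrow> smooth_on S V (\<lambda>x. \<Sum>i\<in>I. f i x)"
  by (simp add: smooth_on_def Ck_on_sum)

lemma smooth_on_bilinear:
  "relopen S V \<Longrightarrow> bounded_bilinear mul \<Longrightarrow> smooth_on S V f \<Longrightarrow> smooth_on S V g \<Longrightarrow>
    smooth_on S V (\<lambda>x. mul (f x) (g x))"
  by (simp add: smooth_on_def Ck_on_bilinear)

lemma smooth_on_minus:
  assumes "relopen S V" "smooth_on S V f" "smooth_on S V g"
  shows "smooth_on S V (\<lambda>x. f x - g x)"
  using smooth_on_add[OF assms(1,2) smooth_on_bounded_linear_comp[OF assms(1) bounded_linear_minus[OF bounded_linear_ident] assms(3)]]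
  by simp

lemma smooth_on_comp:
  fixes f :: "'e::euclidean_space \<Rightarrow> 'g::euclidean_space" and g :: "'g \<Rightarrow> 'h::real_normed_vector"
  shows "relopen S V \<Longrightarrow> relopen T W \<Longrightarrow> f ` V \<subseteq> W \<Longrightarrow> smooth_on S V f \<Longrightarrow> smooth_on T W g \<Longrightarrow>
    smooth_on S V (\<lambda>x. g (f x))"
  by (simp add: smooth_on_def Ck_on_comp)

lemma fderiv_expand:
  assumes V: "relopen S V" and f: "smooth_on S V f" and x: "x \<in> V" and w: "w \<in> S"
  shows "fderiv V f x w = (\<Sum>b\<in>Basis. (w \<bullet> b) *\<^sub>R fderiv V f x (proj S b))"
proof -
  have S: "subspace S" using V by (simp add: relopen_def)
  interpret D: bounded_linear "fderiv V f x"
    using smooth_on_has_derivative[OF f x] by (rule has_derivative_bounded_linear)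
  interpret P: bounded_linear "proj S" by (rule proj_linear[OF S])
  have "w = proj S (\<Sum>b\<in>Basis. (w \<bullet> b) *\<^sub>R b)"
    using w by (simp add: euclidean_representation proj_id[OF S])
  then have "fderiv V f x w = fderiv V f x (proj S (\<Sum>b\<in>Basis. (w \<bullet> b) *\<^sub>R b))" by simp
  then show ?thesis by (simp add: D.sum D.scaleR P.sum P.scaleR)
qed

lemma smooth_on_fderiv_along:
  assumes V: "relopen S V" and f: "smooth_on S V f" and X: "smooth_on S V X" "X ` V \<subseteq> S"
  shows "smooth_on S V (\<lambda>x. fderiv V f x (X x))"
proof -
  have S: "subspace S" using V by (simp add: relopen_def)
  have "smooth_on S V (\<lambda>x. \<Sum>b\<in>Basis. (X x \<bullet> b) *\<^sub>R fderiv V f x (proj S b))"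
    by (intro smooth_on_sum smooth_on_bilinear[OF _ bounded_bilinear_scaleR] V
        smooth_on_bounded_linear_comp[OF _ bounded_linear_inner_left] X smooth_on_fderiv f proj_in S)
  moreover have "fderiv V f x (X x) = (\<Sum>b\<in>Basis. (X x \<bullet> b) *\<^sub>R fderiv V f x (proj S b))" if "x \<in> V" for x
    by (rule fderiv_expand[OF V f that]) (use X(2) that in auto)
  ultimately show ?thesis by (simp cong: smooth_on_cong)
qed

lemma has_derivative_comp_proj:
  fixes S :: "'e::euclidean_space set"
  assumes V: "relopen S V" and u: "proj S u \<in> V" and g: "(g has_derivative g') (at (proj S u) within V)"
  shows "((\<lambda>u. g (proj S u)) has_derivative (\<lambda>v. g' (proj S v))) (at u)"
proof -
  have S: "subspace S" using V by (simp add: relopen_def)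
  have *: "(proj S has_derivative proj S) (at u within proj S -` V)"
    by (rule bounded_linear_imp_has_derivative[OF proj_linear[OF S]])
  have "((g \<circ> proj S) has_derivative (g' \<circ> proj S)) (at u within proj S -` V)"
    by (rule diff_chain_within[OF *], rule has_derivative_subset[OF g]) auto
  then show ?thesis
    using at_within_open[of u "proj S -` V"] relopen_proj_vimage[OF V] u by (simp add: o_def)
qed

text \<open>The derivative is packaged as a continuous map into bounded linear operators on the
  whole ambient type, the form in which the mean value and Picard estimates use it.\<close>

lemma smooth_on_extend:
  fixes f :: "'e::euclidean_space \<Rightarrow> 'f::real_normed_vector"
  assumes V: "relopen S V" and f: "smooth_on S V f"
  obtains f' :: "'e \<Rightarrow> 'e \<Rightarrow>\<^sub>L 'f" where
    "\<And>u. u \<in> proj S -` V \<Longrightarrow> ((\<lambda>u. f (proj S u)) has_derivative blinfun_apply (f' u)) (at u)"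
    "continuous_on (proj S -` V) f'"
    "\<And>u v. u \<in> proj S -` V \<Longrightarrow> blinfun_apply (f' u) v = fderiv V f (proj S u) (proj S v)"
proof -
  have S: "subspace S" using V by (simp add: relopen_def)
  define f' where "f' = (\<lambda>u. Blinfun (\<lambda>v. fderiv V f (proj S u) (proj S v)))"
  have f': "blinfun_apply (f' u) = (\<lambda>v. fderiv V f (proj S u) (proj S v))" if "u \<in> proj S -` V" for u
    unfolding f'_def
    by (intro bounded_linear_Blinfun_apply bounded_linear_compose[OF has_derivative_bounded_linear proj_linear[OF S]])
       (rule smooth_on_has_derivative[OF f], use that in auto)
  show thesis
  proof
    fix u assume u: "u \<in> proj S -` V"
    show "((\<lambda>u. f (proj S u)) has_derivative blinfun_apply (f' u)) (at u)"
      unfolding f'[OF u] by (rule has_derivative_comp_proj[OF V _ smooth_on_has_derivative[OF f]]) (use u in auto)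
    show "blinfun_apply (f' u) v = fderiv V f (proj S u) (proj S v)" for v by (simp add: f'[OF u])
  next
    show "continuous_on (proj S -` V) f'"
    proof (rule continuous_on_blinfun_componentwise)
      fix i :: 'e
      have "continuous_on (proj S -` V) (\<lambda>u. fderiv V f (proj S u) (proj S i))"
        by (rule continuous_on_compose2[OF smooth_on_continuous[OF smooth_on_fderiv[OF f proj_in[OF S, of i]]]
            linear_continuous_on[OF proj_linear[OF S]]]) auto
      then show "continuous_on (proj S -` V) (\<lambda>u. blinfun_apply (f' u) i)"
        by (rule continuous_on_eq) (simp add: f')
    qed
  qed
qed

subsection \<open>Symmetry of second derivatives\<close>

text \<open>Mean value inequality in \<open>s\<close> for the difference of \<open>f\<close> along
  two parallel segments in direction \<open>v\<close>, displaced by \<open>h w\<close>, minus its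
  expected growth. The second-order information enters through the expansion of \<open>D y v\<close>
  at the single point \<open>x\<close>.\<close>

lemma second_difference_estimate:
  fixes f :: "'e::real_normed_vector \<Rightarrow> 'f::real_normed_vector"
  assumes U: "open U" "x \<in> U" and D: "\<And>y. y \<in> U \<Longrightarrow> (f has_derivative D y) (at y)"
    and A: "((\<lambda>y. D y v) has_derivative A) (at x)" and e: "e > 0"
  obtains d where "d > 0" "\<And>h. 0 < h \<Longrightarrow> h < d \<Longrightarrow>
    norm (f (x + h *\<^sub>R v + h *\<^sub>R w) - f (x + h *\<^sub>R v) - f (x + h *\<^sub>R w) + f x - (h * h) *\<^sub>R A w) \<le> e * (h * h)"
proof -
  interpret A: bounded_linear A using A by (rule has_derivative_bounded_linear)
  \<comment> \<open>Every increment from \<open>x\<close> below has norm at most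
    \<open>h * c\<close>; the summand 1 keeps \<open>c\<close> positive.\<close>
  define c where "c = norm v + norm w + 1"
  have c: "c > 0" by (simp add: c_def add_nonneg_pos)
  obtain r where r: "r > 0" "ball x r \<subseteq> U" using U openE by blast
  \<comment> \<open>The expansion at \<open>x\<close> is applied at two increments of norm at most
    \<open>h * c\<close>, so the two errors add up to \<open>e * h\<close>.\<close>
  have "e / (2 * c) > 0" using e c by simp
  then obtain d0 where d0: "d0 > 0" "\<And>y. norm (y - x) < d0 \<Longrightarrow>
      norm (D y v - D x v - A (y - x)) \<le> e / (2 * c) * norm (y - x)"
    using A unfolding has_derivative_within_alt by (metis UNIV_I)
  define d where "d = min r d0 / c"
  show thesis
  proof (rule that[of d])
    show "d > 0" using r d0 c by (simp add: d_def)
    fix h :: real assume h: "0 < h" "h < d"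
    have hc: "h * c < r" "h * c < d0" using h c by (auto simp: d_def field_simps)
    define \<phi> where "\<phi> = (\<lambda>s::real. f (x + (s * h) *\<^sub>R v + h *\<^sub>R w) - f (x + (s * h) *\<^sub>R v) - (s * (h * h)) *\<^sub>R A w)"
    define \<phi>' where "\<phi>' = (\<lambda>(s::real) (t::real). D (x + (s * h) *\<^sub>R v + h *\<^sub>R w) ((t * h) *\<^sub>R v)
         - D (x + (s * h) *\<^sub>R v) ((t * h) *\<^sub>R v) - (t * (h * h)) *\<^sub>R A w)"
    have near: "norm ((s * h) *\<^sub>R v + h *\<^sub>R w) \<le> h * c" "norm ((s * h) *\<^sub>R v) \<le> h * c" if s: "s \<in> {0..1}" for s
    proof -
      have "norm ((s * h) *\<^sub>R v) \<le> h * norm v"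
        using s h by (simp add: mult_left_le_one_le mult_right_mono)
      moreover have "norm (h *\<^sub>R w) = h * norm w" using h by simp
      ultimately have "norm ((s * h) *\<^sub>R v) + norm (h *\<^sub>R w) \<le> h * norm v + h * norm w" by linarith
      also have "\<dots> \<le> h * c" using h by (simp add: c_def algebra_simps)
      finally have *: "norm ((s * h) *\<^sub>R v) + norm (h *\<^sub>R w) \<le> h * c" .
      then show "norm ((s * h) *\<^sub>R v + h *\<^sub>R w) \<le> h * c" using norm_triangle_ineq order_trans by blast
      show "norm ((s * h) *\<^sub>R v) \<le> h * c" using * norm_ge_zero[of "h *\<^sub>R w"] by linarith
    qed
    have dist_self: "dist x (x + k) = norm k" for k by (simp add: dist_norm)
    have inU: "x + (s * h) *\<^sub>R v + h *\<^sub>R w \<in> U" "x + (s * h) *\<^sub>R v \<in> U" if "s \<in> {0..1}" for s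
    proof -
      have "x + (s * h) *\<^sub>R v + h *\<^sub>R w \<in> ball x r" "x + (s * h) *\<^sub>R v \<in> ball x r"
        using near[OF that] hc dist_self by (auto simp: add.assoc)
      then show "x + (s * h) *\<^sub>R v + h *\<^sub>R w \<in> U" "x + (s * h) *\<^sub>R v \<in> U" using r by auto
    qed
    have der: "(\<phi> has_derivative \<phi>' s) (at s within {0..1})" if s: "s \<in> {0..1}" for s
    proof -
      have p: "((\<lambda>s. x + (s * h) *\<^sub>R v + h *\<^sub>R w) has_derivative (\<lambda>t. (t * h) *\<^sub>R v)) (at s within {0..1})"
        "((\<lambda>s. x + (s * h) *\<^sub>R v) has_derivative (\<lambda>t. (t * h) *\<^sub>R v)) (at s within {0..1})"
        by (auto intro!: derivative_eq_intros)
      show ?thesis unfolding \<phi>_def \<phi>'_def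
        by (intro has_derivative_diff has_derivative_compose[OF p(1) D[OF inU(1)[OF s]]]
           has_derivative_compose[OF p(2) D[OF inU(2)[OF s]]])
          (auto intro!: derivative_eq_intros)
    qed
    have bound: "norm (\<phi>' s t) \<le> (e * (h * h)) * norm t" if s: "s \<in> {0..1}" for s t
    proof -
      interpret D1: bounded_linear "D (x + (s * h) *\<^sub>R v + h *\<^sub>R w)"
        using D[OF inU(1)[OF s]] by (rule has_derivative_bounded_linear)
      interpret D2: bounded_linear "D (x + (s * h) *\<^sub>R v)"
        using D[OF inU(2)[OF s]] by (rule has_derivative_bounded_linear)
      let ?k1 = "(s * h) *\<^sub>R v + h *\<^sub>R w" and ?k2 = "(s * h) *\<^sub>R v"
      have n1: "norm (D (x + ?k1) v - D x v - A ?k1) \<le> e / (2 * c) * (h * c)"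
      proof (rule order_trans)
        show "norm (D (x + ?k1) v - D x v - A ?k1) \<le> e / (2 * c) * norm ?k1"
          using d0(2)[of "x + ?k1"] near(1)[OF s] hc by simp
        show "e / (2 * c) * norm ?k1 \<le> e / (2 * c) * (h * c)"
          by (rule mult_left_mono[OF near(1)[OF s]]) (use e c in simp)
      qed
      have n2: "norm (D (x + ?k2) v - D x v - A ?k2) \<le> e / (2 * c) * (h * c)"
      proof (rule order_trans)
        show "norm (D (x + ?k2) v - D x v - A ?k2) \<le> e / (2 * c) * norm ?k2"
          using d0(2)[of "x + ?k2"] near(2)[OF s] hc by simp
        show "e / (2 * c) * norm ?k2 \<le> e / (2 * c) * (h * c)"
          by (rule mult_left_mono[OF near(2)[OF s]]) (use e c in simp)
      qed
      have "D (x + ?k1) v - D (x + ?k2) v - h *\<^sub>R A w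
          = (D (x + ?k1) v - D x v - A ?k1) - (D (x + ?k2) v - D x v - A ?k2)"
        by (simp add: A.add A.scaleR)
      then have "norm (D (x + ?k1) v - D (x + ?k2) v - h *\<^sub>R A w) \<le> e / (2 * c) * (h * c) + e / (2 * c) * (h * c)"
        using norm_triangle_le_diff[of _ _ "e / (2 * c) * (h * c) + e / (2 * c) * (h * c)"] n1 n2
        by (metis add_mono)
      also have "\<dots> = e * h" using c by (simp add: field_simps)
      finally have *: "norm (D (x + ?k1) v - D (x + ?k2) v - h *\<^sub>R A w) \<le> e * h" .
      have "\<phi>' s t = (t * h) *\<^sub>R (D (x + ?k1) v - D (x + ?k2) v - h *\<^sub>R A w)"
        unfolding \<phi>'_def D1.scaleR D2.scaleR by (simp add: algebra_simps)
      then have "norm (\<phi>' s t) = (\<bar>t\<bar> * h) * norm (D (x + ?k1) v - D (x + ?k2) v - h *\<^sub>R A w)"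
        using h by (simp add: abs_mult)
      also have "\<dots> \<le> (\<bar>t\<bar> * h) * (e * h)" by (rule mult_left_mono[OF *]) (use h in auto)
      finally show ?thesis by (simp add: mult_ac)
    qed
    have "norm (\<phi> 1 - \<phi> 0) \<le> (e * (h * h)) * norm (1 - 0 :: real)"
      by (rule differentiable_bound[OF convex_real_interval(5) der onorm_bound])
        (use bound e h in auto)
    then show "norm (f (x + h *\<^sub>R v + h *\<^sub>R w) - f (x + h *\<^sub>R v) - f (x + h *\<^sub>R w) + f x - (h * h) *\<^sub>R A w) \<le> e * (h * h)"
      by (simp add: \<phi>_def algebra_simps)
  qed
qed

text \<open>The second difference is symmetric in \<open>v\<close> and \<open>w\<close>, and divided
  by \<open>h * h\<close> it is arbitrarily close both to \<open>A w\<close> and to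
  \<open>B v\<close>.\<close>

lemma second_derivative_symmetric:
  fixes f :: "'e::real_normed_vector \<Rightarrow> 'f::real_normed_vector"
  assumes U: "open U" "x \<in> U" and D: "\<And>y. y \<in> U \<Longrightarrow> (f has_derivative D y) (at y)"
    and A: "((\<lambda>y. D y v) has_derivative A) (at x)" and B: "((\<lambda>y. D y w) has_derivative B) (at x)"
  shows "A w = B v"
proof -
  have "norm (A w - B v) \<le> 0 + e" if e: "e > 0" for e
  proof -
    obtain d1 where d1: "d1 > 0" "\<And>h. 0 < h \<Longrightarrow> h < d1 \<Longrightarrow>
      norm (f (x + h *\<^sub>R v + h *\<^sub>R w) - f (x + h *\<^sub>R v) - f (x + h *\<^sub>R w) + f x - (h * h) *\<^sub>R A w) \<le> e / 2 * (h * h)"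
      using second_difference_estimate[OF U D A, of "e/2" w] e by auto
    obtain d2 where d2: "d2 > 0" "\<And>h. 0 < h \<Longrightarrow> h < d2 \<Longrightarrow>
      norm (f (x + h *\<^sub>R w + h *\<^sub>R v) - f (x + h *\<^sub>R w) - f (x + h *\<^sub>R v) + f x - (h * h) *\<^sub>R B v) \<le> e / 2 * (h * h)"
      using second_difference_estimate[OF U D B, of "e/2" v] e by auto
    define h where "h = min d1 d2 / 2"
    have h: "0 < h" "h < d1" "h < d2" using d1(1) d2(1) by (auto simp: h_def)
    define \<Delta> where "\<Delta> = f (x + h *\<^sub>R v + h *\<^sub>R w) - f (x + h *\<^sub>R v) - f (x + h *\<^sub>R w) + f x"
    have 1: "norm (\<Delta> - (h * h) *\<^sub>R A w) \<le> e / 2 * (h * h)" using d1(2) h by (simp add: \<Delta>_def)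
    have "\<Delta> = f (x + h *\<^sub>R w + h *\<^sub>R v) - f (x + h *\<^sub>R w) - f (x + h *\<^sub>R v) + f x"
      by (simp add: \<Delta>_def algebra_simps)
    then have 2: "norm (\<Delta> - (h * h) *\<^sub>R B v) \<le> e / 2 * (h * h)" using d2(2) h by simp
    have "(h * h) *\<^sub>R (A w - B v) = (\<Delta> - (h * h) *\<^sub>R B v) - (\<Delta> - (h * h) *\<^sub>R A w)"
      by (simp add: algebra_simps)
    then have "(h * h) * norm (A w - B v) = norm ((\<Delta> - (h * h) *\<^sub>R B v) - (\<Delta> - (h * h) *\<^sub>R A w))"
      using h by (metis abs_of_pos mult_pos_pos norm_scaleR)
    also have "\<dots> \<le> (h * h) * e" using norm_triangle_le_diff[OF add_mono[OF 2 1]] by (simp add: mult.commute)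
    finally show ?thesis using h by simp
  qed
  then have "norm (A w - B v) \<le> 0" by (rule field_le_epsilon)
  then show ?thesis by simp
qed

lemma smooth_on_second_fderiv_symmetric:
  assumes V: "relopen S V" and f: "smooth_on S V f" and x: "x \<in> V" and v: "v \<in> S" and w: "w \<in> S"
  shows "fderiv V (\<lambda>y. fderiv V f y v) x w = fderiv V (\<lambda>y. fderiv V f y w) x v"
proof -
  have S: "subspace S" using V by (simp add: relopen_def)
  have px: "proj S x = x" using x relopen_in[OF V] proj_id[OF S] by blast
  obtain f' where f': "\<And>u. u \<in> proj S -` V \<Longrightarrow> ((\<lambda>u. f (proj S u)) has_derivative blinfun_apply (f' u)) (at u)"
    "\<And>u v. u \<in> proj S -` V \<Longrightarrow> blinfun_apply (f' u) v = fderiv V f (proj S u) (proj S v)"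
    using smooth_on_extend[OF V f] by metis
  have *: "((\<lambda>u. f' u v) has_derivative (\<lambda>k. fderiv V (\<lambda>y. fderiv V f y v) x (proj S k))) (at x)"
    if v: "v \<in> S" for v
  proof -
    have "((\<lambda>u. fderiv V f (proj S u) v) has_derivative (\<lambda>k. fderiv V (\<lambda>y. fderiv V f y v) x (proj S k))) (at x)"
      using has_derivative_comp_proj[OF V, of x "\<lambda>y. fderiv V f y v"] smooth_on_has_derivative[OF smooth_on_fderiv[OF f v] x] x px
      by simp
    then show ?thesis
      by (rule has_derivative_transform_within_open[OF _ relopen_proj_vimage[OF V]])
        (use x px f'(2) proj_id[OF S v] in auto)
  qed
  have "fderiv V (\<lambda>y. fderiv V f y v) x (proj S w) = fderiv V (\<lambda>y. fderiv V f y w) x (proj S v)"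
    by (rule second_derivative_symmetric[OF relopen_proj_vimage[OF V] _ f'(1) *[OF v] *[OF w]]) (use x px in auto)
  then show ?thesis using proj_id[OF S] v w by simp
qed

subsection \<open>Smoothness of inversion\<close>

text \<open>The first factor need not be differentiable because the second one vanishes at \<open>x\<close>.\<close>

lemma has_derivative_mult_zero:
  assumes mul: "bounded_bilinear mul" and p: "continuous (at x within V) p"
    and g: "(g has_derivative g') (at x within V)" and g0: "g x = 0"
  shows "((\<lambda>y. mul (p y) (g y)) has_derivative (\<lambda>v. mul (p x) (g' v))) (at x within V)"
proof -
  interpret mul: bounded_bilinear mul by fact
  interpret g': bounded_linear g' using g by (rule has_derivative_bounded_linear)
  have p0: "((\<lambda>y. p y - p x) \<longlongrightarrow> 0) (at x within V)"
    using p by (simp add: continuous_within LIM_zero)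
  have 1: "((\<lambda>y. mul (p y) ((1 / norm (y - x)) *\<^sub>R (g y - (g x + g' (y - x))))) \<longlongrightarrow> mul (p x) 0) (at x within V)"
    by (rule mul.tendsto) (use g p in \<open>auto simp: has_derivative_within continuous_within\<close>)
  have 2: "((\<lambda>y. mul (p y - p x) ((1 / norm (y - x)) *\<^sub>R g' (y - x))) \<longlongrightarrow> 0) (at x within V)"
  proof -
    obtain K where K: "K > 0" "\<And>a b. norm (mul a b) \<le> norm a * norm b * K" using mul.pos_bounded by blast
    obtain L where L: "L > 0" "\<And>a. norm (g' a) \<le> norm a * L" using g'.pos_bounded by blast
    have "norm ((1 / norm (y - x)) *\<^sub>R g' (y - x)) \<le> L" for y
      using L by (cases "y = x") (auto simp: g'.zero field_simps)
    then have "norm (mul (p y - p x) ((1 / norm (y - x)) *\<^sub>R g' (y - x))) \<le> norm (p y - p x) * L * K" for y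
      using K by (intro order_trans[OF K(2)] mult_right_mono mult_left_mono) auto
    moreover have "((\<lambda>y. norm (p y - p x) * L * K) \<longlongrightarrow> 0) (at x within V)"
      using tendsto_mult_left_zero[OF tendsto_mult_left_zero[OF tendsto_norm_zero[OF p0]]] .
    ultimately show ?thesis by (rule Lim_null_comparison[OF always_eventually, rule_format])
  qed
  have "((\<lambda>y. (1 / norm (y - x)) *\<^sub>R (mul (p y) (g y) - (mul (p x) (g x) + mul (p x) (g' (y - x))))) \<longlongrightarrow> 0) (at x within V)"
    using tendsto_add[OF 1 2] g0
    by (simp add: mul.zero_right mul.zero_left mul.scaleR_right mul.diff_right mul.diff_left algebra_simps)
  then show ?thesis
    by (simp add: has_derivative_within bounded_linear_compose[OF mul.bounded_linear_right g'.bounded_linear_axioms])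
qed

text \<open>In \<open>J y = J x + J y (C x - C y) J x\<close> the middle factor vanishes at
  \<open>y = x\<close>. With \<open>J\<close> bounded, the identity first gives continuity of
  \<open>J\<close> and then, by the product rule for a vanishing factor, its derivative
  \<open>- J (DC v) J\<close>. This is as smooth as \<open>J\<close> and \<open>DC\<close>, so the
  order rises by induction.\<close>

lemma Ck_on_blinfun_inverse:
  fixes C J :: "'e::euclidean_space \<Rightarrow> ('x::real_normed_vector \<Rightarrow>\<^sub>L 'x)"
  assumes V: "relopen S V" and inv: "\<And>x. x \<in> V \<Longrightarrow> C x o\<^sub>L J x = id_blinfun" "\<And>x. x \<in> V \<Longrightarrow> J x o\<^sub>L C x = id_blinfun"
    and B: "\<And>x. x \<in> V \<Longrightarrow> norm (J x) \<le> B"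
    and C: "Ck_on k S V C"
  shows "Ck_on k S V J"
proof -
  have J_eq: "J y = J x + (J y o\<^sub>L ((C x - C y) o\<^sub>L J x))" if "x \<in> V" "y \<in> V" for x y
  proof -
    have id: "F o\<^sub>L id_blinfun = F" "id_blinfun o\<^sub>L F = F" for F :: "'x \<Rightarrow>\<^sub>L 'x"
      by (auto intro: blinfun_eqI)
    have "J y o\<^sub>L ((C x - C y) o\<^sub>L J x) = (J y o\<^sub>L (C x o\<^sub>L J x)) - ((J y o\<^sub>L C y) o\<^sub>L J x)"
      by (rule blinfun_eqI) (simp add: blinfun.bilinear_simps)
    then show ?thesis using inv(1)[OF that(1)] inv(2)[OF that(2)] id by simp
  qed
  have cont: "continuous_on V J" if C: "continuous_on V C"
  proof -
    have "(J \<longlongrightarrow> J x) (at x within V)" if x: "x \<in> V" for x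
    proof (rule LIM_zero_cancel, rule Lim_null_comparison)
      have "norm (J y - J x) \<le> B * (norm (C x - C y) * B)" if y: "y \<in> V" for y
      proof -
        have "0 \<le> B" using B[OF x] norm_ge_zero order_trans by blast
        have "norm (J y - J x) = norm (J y o\<^sub>L ((C x - C y) o\<^sub>L J x))"
          using J_eq[OF x y] by (metis add_diff_cancel_left')
        also have "\<dots> \<le> norm (J y) * (norm (C x - C y) * norm (J x))"
          by (meson norm_blinfun_compose order_trans mult_left_mono norm_ge_zero)
        also have "\<dots> \<le> B * (norm (C x - C y) * B)"
          using B[OF x] B[OF y] \<open>0 \<le> B\<close> by (intro mult_mono) auto
        finally show ?thesis .
      qed
      then show "\<forall>\<^sub>F y in at x within V. norm (J y - J x) \<le> B * (norm (C x - C y) * B)"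
        by (auto simp: eventually_at_filter)
      have "((\<lambda>y. C x - C y) \<longlongrightarrow> C x - C x) (at x within V)"
        using C x by (intro tendsto_intros) (simp add: continuous_on)
      then have "((\<lambda>y. norm (C x - C y)) \<longlongrightarrow> 0) (at x within V)" by (simp add: tendsto_norm_zero)
      then show "((\<lambda>y. B * (norm (C x - C y) * B)) \<longlongrightarrow> 0) (at x within V)"
        using tendsto_mult_right_zero tendsto_mult_left_zero by blast
    qed
    then show ?thesis by (simp add: continuous_on)
  qed
  show ?thesis using C
  proof (induction k)
    case 0
    then show ?case using cont by simp
  next
    case (Suc k)
    have J: "Ck_on k S V J" by (rule Suc.IH[OF Ck_on_Suc_imp[OF Suc.prems]])
    show ?case
    proof (rule Ck_on_SucI[OF V, where f' = "\<lambda>x v. J x o\<^sub>L ((- fderiv V C x v) o\<^sub>L J x)"])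
      fix x assume x: "x \<in> V"
      have C': "(C has_derivative fderiv V C x) (at x within V)" by (rule Ck_on_SucD(1)[OF Suc.prems x])
      have "((\<lambda>y. (C x - C y) o\<^sub>L J x) has_derivative (\<lambda>v. (- fderiv V C x v) o\<^sub>L J x)) (at x within V)"
        by (rule bounded_linear.has_derivative[OF bounded_bilinear.bounded_linear_left[OF bounded_bilinear_blinfun_compose]])
          (use has_derivative_diff[OF has_derivative_const C'] in simp)
      then have "((\<lambda>y. J y o\<^sub>L ((C x - C y) o\<^sub>L J x)) has_derivative
          (\<lambda>v. J x o\<^sub>L ((- fderiv V C x v) o\<^sub>L J x))) (at x within V)"
        by (rule has_derivative_mult_zero[OF bounded_bilinear_blinfun_compose, rotated])
          (use Ck_on_continuous[OF J] x in \<open>auto simp: continuous_on_eq_continuous_within\<close>)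
      then have "((\<lambda>y. J x + (J y o\<^sub>L ((C x - C y) o\<^sub>L J x))) has_derivative
          (\<lambda>v. J x o\<^sub>L ((- fderiv V C x v) o\<^sub>L J x))) (at x within V)"
        using has_derivative_add[OF has_derivative_const] by fastforce
      then show "(J has_derivative (\<lambda>v. J x o\<^sub>L ((- fderiv V C x v) o\<^sub>L J x))) (at x within V)"
        by (rule has_derivative_transform[OF x, rotated]) (rule J_eq[OF x])
    next
      fix v assume v: "v \<in> S"
      have "Ck_on k S V (\<lambda>x. - fderiv V C x v)"
        by (rule Ck_on_bounded_linear_comp[OF V bounded_linear_minus[OF bounded_linear_ident] Ck_on_SucD(2)[OF Suc.prems v]])
      then show "Ck_on k S V (\<lambda>x. J x o\<^sub>L ((- fderiv V C x v) o\<^sub>L J x))"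
        by (intro Ck_on_bilinear[OF V bounded_bilinear_blinfun_compose] J)
    qed
  qed
qed

lemma smooth_on_blinfun_inverse:
  fixes C J :: "'e::euclidean_space \<Rightarrow> ('x::real_normed_vector \<Rightarrow>\<^sub>L 'x)"
  assumes "relopen S V" "\<And>x. x \<in> V \<Longrightarrow> C x o\<^sub>L J x = id_blinfun" "\<And>x. x \<in> V \<Longrightarrow> J x o\<^sub>L C x = id_blinfun"
    and "\<And>x. x \<in> V \<Longrightarrow> norm (J x) \<le> B" "smooth_on S V C"
  shows "smooth_on S V J"
  unfolding smooth_on_def
proof
  show "Ck_on k S V J" for k
    by (rule Ck_on_blinfun_inverse[OF assms(1), where C = C and B = B]) (use assms in \<open>auto simp: smooth_on_def\<close>)
qed

subsection \<open>Total differential equations\<close>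

lemma C1_bounds_near:
  fixes a :: "'e::euclidean_space \<Rightarrow> 'f::real_normed_vector"
  assumes U: "open U" "p \<in> U" and der: "\<And>u. u \<in> U \<Longrightarrow> (a has_derivative blinfun_apply (a' u)) (at u)"
    and cont: "continuous_on U a'"
  obtains R K where "R > 0" "K \<ge> 1" "cball p R \<subseteq> U" "\<And>u. u \<in> cball p R \<Longrightarrow> norm (a u) \<le> K"
    "\<And>u. u \<in> cball p R \<Longrightarrow> norm (a' u) \<le> K"
    "\<And>u v. u \<in> cball p R \<Longrightarrow> v \<in> cball p R \<Longrightarrow> norm (a u - a v) \<le> K * norm (u - v)"
proof -
  obtain R where R: "R > 0" "cball p R \<subseteq> U" using U open_contains_cball by blast
  have "continuous_on (cball p R) a"
    by (rule has_derivative_continuous_on) (use der R has_derivative_at_withinI in blast)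
  then have "bounded (a ` cball p R)" by (intro compact_imp_bounded compact_continuous_image) auto
  then obtain K1 where K1: "\<And>u. u \<in> cball p R \<Longrightarrow> norm (a u) \<le> K1"
    unfolding bounded_iff by blast
  have "continuous_on (cball p R) a'" by (rule continuous_on_subset[OF cont R(2)])
  then have "bounded (a' ` cball p R)" by (intro compact_imp_bounded compact_continuous_image) auto
  then obtain K2 where K2: "\<And>u. u \<in> cball p R \<Longrightarrow> norm (a' u) \<le> K2"
    unfolding bounded_iff by blast
  define K where "K = max 1 (max K1 K2)"
  have K: "K \<ge> 1" "\<And>u. u \<in> cball p R \<Longrightarrow> norm (a u) \<le> K" "\<And>u. u \<in> cball p R \<Longrightarrow> norm (a' u) \<le> K"
    using K1 K2 by (auto simp: K_def le_max_iff_disj)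
  have "norm (a u - a v) \<le> K * norm (u - v)" if "u \<in> cball p R" "v \<in> cball p R" for u v
    by (rule differentiable_bound[OF convex_cball has_derivative_at_withinI[OF der] _ that])
      (use R(2) K(3) in \<open>auto simp: norm_blinfun.rep_eq[symmetric]\<close>)
  with that[OF R(1) K(1) R(2) K(2,3)] show thesis by blast
qed

text \<open>Both maps solve the same equation along a common \<open>L\<close>, so on a small ball
  the mean value inequality bounds the maximum \<open>s\<close> of \<open>norm (g w - h w)\<close>
  by \<open>s / 2\<close>. This later compares a map tangent to the distribution with a
  plaque.\<close>

lemma local_uniqueness:
  fixes a :: "'e::euclidean_space \<Rightarrow> ('s::euclidean_space \<Rightarrow>\<^sub>L 'e)" and g h :: "'w::euclidean_space \<Rightarrow> 'e"
    and L :: "'w \<Rightarrow> ('w \<Rightarrow>\<^sub>L 's)"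
  assumes U: "open U" "g w0 \<in> U" and der: "\<And>u. u \<in> U \<Longrightarrow> (a has_derivative blinfun_apply (a' u)) (at u)"
    and cont: "continuous_on U a'" and W: "open W" "w0 \<in> W" and eq: "g w0 = h w0"
    and g: "\<And>w. w \<in> W \<Longrightarrow> (g has_derivative (\<lambda>v. a (g w) (L w v))) (at w)"
    and h: "\<And>w. w \<in> W \<Longrightarrow> (h has_derivative (\<lambda>v. a (h w) (L w v))) (at w)"
    and L: "continuous_on W L"
  obtains e where "e > 0" "ball w0 e \<subseteq> W" "\<And>w. w \<in> ball w0 e \<Longrightarrow> g w = h w"
proof -
  obtain R K where R: "R > 0" "K \<ge> 1"
    and lip: "\<And>u v. u \<in> cball (g w0) R \<Longrightarrow> v \<in> cball (g w0) R \<Longrightarrow> norm (a u - a v) \<le> K * norm (u - v)"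
    using C1_bounds_near[OF U der cont] by metis
  have cg: "continuous_on W g" and ch: "continuous_on W h"
    by (rule has_derivative_continuous_on, use g h has_derivative_at_withinI in blast)+
  define W1 where "W1 = (W \<inter> g -` ball (g w0) R) \<inter> (W \<inter> h -` ball (g w0) R)"
  have "open W1" unfolding W1_def
    by (intro open_Int continuous_open_preimage cg ch W open_ball)
  moreover have "w0 \<in> W1" using W eq R by (auto simp: W1_def)
  ultimately obtain e1 where e1: "e1 > 0" "cball w0 e1 \<subseteq> W1" using open_contains_cball by blast
  have sub: "cball w0 e1 \<subseteq> W" using e1 by (auto simp: W1_def)
  have "bounded (L ` cball w0 e1)"
    by (intro compact_imp_bounded compact_continuous_image continuous_on_subset[OF L sub]) auto
  then obtain C0 where C0: "\<And>w. w \<in> cball w0 e1 \<Longrightarrow> norm (L w) \<le> C0" unfolding bounded_iff by blast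
  define C where "C = max C0 1"
  have C: "C > 0" "\<And>w. w \<in> cball w0 e1 \<Longrightarrow> norm (L w) \<le> C" using C0 by (auto simp: C_def le_max_iff_disj)
  \<comment> \<open>The derivative of \<open>g - h\<close> is bounded by \<open>K * s * C\<close>;
    the radius \<open>1 / (2 * K * C)\<close> turns this into the factor 1/2.\<close>
  define e where "e = min e1 (1 / (2 * K * C))"
  have e: "e > 0" "e \<le> e1" "K * C * e \<le> 1/2"
  proof -
    show "e > 0" "e \<le> e1" using e1 R C by (auto simp: e_def)
    have "K * C * e \<le> K * C * (1 / (2 * K * C))" by (rule mult_left_mono) (use R C in \<open>auto simp: e_def\<close>)
    then show "K * C * e \<le> 1/2" using R C by simp
  qed
  define \<delta> where "\<delta> = (\<lambda>w. g w - h w)"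
  have "continuous_on (cball w0 e) (\<lambda>w. norm (\<delta> w))" unfolding \<delta>_def
    by (intro continuous_intros continuous_on_subset[OF cg] continuous_on_subset[OF ch]) (use sub e(2) in auto)
  then obtain w1 where w1: "w1 \<in> cball w0 e" "\<And>w. w \<in> cball w0 e \<Longrightarrow> norm (\<delta> w) \<le> norm (\<delta> w1)"
    using continuous_attains_sup[of "cball w0 e" "\<lambda>w. norm (\<delta> w)"] e(1) by auto
  define s where "s = norm (\<delta> w1)"
  have "norm (\<delta> w1 - \<delta> w0) \<le> (K * s * C) * norm (w1 - w0)"
  proof (rule differentiable_bound[OF convex_cball[of w0 e], where f' = "\<lambda>w v. a (g w) (L w v) - a (h w) (L w v)"])
    fix w assume w: "w \<in> cball w0 e"
    then have wW: "w \<in> W" "w \<in> W1" "w \<in> cball w0 e1" using sub e(2) e1(2) by auto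
    show "(\<delta> has_derivative (\<lambda>v. a (g w) (L w v) - a (h w) (L w v))) (at w within cball w0 e)"
      unfolding \<delta>_def
      by (rule has_derivative_diff[OF has_derivative_at_withinI[OF g[OF wW(1)]] has_derivative_at_withinI[OF h[OF wW(1)]]])
    show "onorm (\<lambda>v. a (g w) (L w v) - a (h w) (L w v)) \<le> K * s * C"
    proof (rule onorm_bound)
      show "0 \<le> K * s * C" using R C by (simp add: s_def)
      fix v
      have n: "norm (a (g w) - a (h w)) \<le> K * s"
        using lip[of "g w" "h w"] wW(2) w1(2)[OF w] R(2) unfolding W1_def s_def \<delta>_def
        by (smt (verit) Int_iff ball_subset_cball in_mono mult_left_mono vimage_eq)
      have "norm (a (g w) (L w v) - a (h w) (L w v)) = norm ((a (g w) - a (h w)) (L w v))"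
        by (simp add: blinfun.diff_left)
      also have "\<dots> \<le> norm (a (g w) - a (h w)) * (norm (L w) * norm v)"
        by (meson norm_blinfun order_trans mult_left_mono norm_ge_zero)
      also have "\<dots> \<le> (K * s) * (C * norm v)"
        using n C(2)[OF wW(3)] R C by (intro mult_mono) (auto simp: s_def)
      finally show "norm (a (g w) (L w v) - a (h w) (L w v)) \<le> K * s * C * norm v" by (simp add: mult_ac)
    qed
  qed (use w1 e in auto)
  also have "\<dots> \<le> (K * s * C) * e"
    using w1(1) R C by (intro mult_left_mono) (auto simp: s_def dist_norm norm_minus_commute)
  also have "\<dots> = s * (K * C * e)" by (simp add: mult_ac)
  also have "\<dots> \<le> s * (1/2)" by (rule mult_left_mono[OF e(3)]) (simp add: s_def)
  finally have "s \<le> s / 2" using eq by (simp add: \<delta>_def s_def)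
  then have "s = 0" by (simp add: s_def)
  then have "\<delta> w = 0" if "w \<in> cball w0 e" for w using w1(2)[OF that] by (simp add: s_def)
  then show thesis using that[of e] e sub by (force simp: \<delta>_def)
qed

text \<open>
  Picard iteration along rays for \<open>DG(x) = a(G(x))\<close>. For \<open>H(x) = p + \<integral>\<^sub>0\<^sup>1 a(G(tx))x dt\<close>, the symmetry
  of \<open>Da(a s) t\<close> in \<open>s\<close> and \<open>t\<close> makes the defect \<open>DH(x) - a(G(x))\<close> a small multiple of the previous
  defect \<open>DG - a \<circ> G\<close>, so the iterates converge in \<open>C\<^sup>1\<close>.
\<close>

locale ray_picard =
  fixes a :: "'e::euclidean_space \<Rightarrow> ('s::euclidean_space \<Rightarrow>\<^sub>L 'e)" and a' :: "'e \<Rightarrow> ('e \<Rightarrow>\<^sub>L ('s \<Rightarrow>\<^sub>L 'e))"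
    and p :: 'e and R K r :: real
  assumes R: "R > 0" and K: "K \<ge> 1" and r: "r > 0" "K * r \<le> R" "8 * (K * r) \<le> 1"
    and der: "\<And>u. u \<in> cball p R \<Longrightarrow> (a has_derivative blinfun_apply (a' u)) (at u)"
    and cont': "continuous_on (cball p R) a'"
    and bound: "\<And>u. u \<in> cball p R \<Longrightarrow> norm (a u) \<le> K" "\<And>u. u \<in> cball p R \<Longrightarrow> norm (a' u) \<le> K"
    and lip: "\<And>u v. u \<in> cball p R \<Longrightarrow> v \<in> cball p R \<Longrightarrow> norm (a u - a v) \<le> K * norm (u - v)"
    and sym: "\<And>u s t. u \<in> cball p R \<Longrightarrow> a' u (a u s) t = a' u (a u t) s"
begin

definition C1map :: "('s \<Rightarrow> 'e) \<Rightarrow> ('s \<Rightarrow> ('s \<Rightarrow>\<^sub>L 'e)) \<Rightarrow> bool" where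
  "C1map g g' \<longleftrightarrow> (\<forall>x\<in>ball 0 r. g x \<in> cball p R \<and> (g has_derivative blinfun_apply (g' x)) (at x)) \<and>
     continuous_on (ball 0 r) g'"

definition step :: "('s \<Rightarrow> 'e) \<Rightarrow> 's \<Rightarrow> 'e" where
  "step g x = p + integral {0..1} (\<lambda>t. a (g (t *\<^sub>R x)) x)"

text \<open>The derivative in \<open>x\<close> of \<open>a (g (t *\<^sub>R x)) x\<close>, for
  differentiation under the integral; the inner \<open>t\<close> comes from the scaling of
  \<open>x\<close>.\<close>

definition integrand' :: "('s \<Rightarrow> 'e) \<Rightarrow> ('s \<Rightarrow> ('s \<Rightarrow>\<^sub>L 'e)) \<Rightarrow> 's \<Rightarrow> real \<Rightarrow> ('s \<Rightarrow>\<^sub>L 'e)" where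
  "integrand' g g' x t = Blinfun (\<lambda>v. a' (g (t *\<^sub>R x)) (t *\<^sub>R g' (t *\<^sub>R x) v) x + a (g (t *\<^sub>R x)) v)"

definition step' :: "('s \<Rightarrow> 'e) \<Rightarrow> ('s \<Rightarrow> ('s \<Rightarrow>\<^sub>L 'e)) \<Rightarrow> 's \<Rightarrow> ('s \<Rightarrow>\<^sub>L 'e)" where
  "step' g g' x = integral {0..1} (integrand' g g' x)"

lemma integrand'_apply:
  "blinfun_apply (integrand' g g' x t) v = a' (g (t *\<^sub>R x)) (t *\<^sub>R g' (t *\<^sub>R x) v) x + a (g (t *\<^sub>R x)) v"
  unfolding integrand'_def
  by (subst bounded_linear_Blinfun_apply) (auto intro!: bounded_linear_intros)

lemma cont_a: "continuous_on (cball p R) a"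
  by (rule has_derivative_continuous_on) (use der has_derivative_at_withinI in blast)

lemma ray_in_ball: "(x::'s) \<in> ball 0 r \<Longrightarrow> t \<in> {0..1} \<Longrightarrow> t *\<^sub>R x \<in> ball 0 r"
  using mult_left_le_one_le[of "norm x" t] by auto

lemma C1map_continuous: "C1map g g' \<Longrightarrow> continuous_on (ball 0 r) g"
  unfolding C1map_def by (intro has_derivative_continuous_on[of _ g "\<lambda>x. blinfun_apply (g' x)"])
    (use has_derivative_at_withinI in blast)

lemma continuous_ray:
  assumes "continuous_on (ball 0 r) (f :: 's \<Rightarrow> 'z::topological_space)"
  shows "continuous_on (ball 0 r \<times> {0..1}) (\<lambda>z. f (snd z *\<^sub>R fst z))"
  by (rule continuous_on_compose2[OF assms]) (use ray_in_ball in \<open>auto intro!: continuous_intros\<close>)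

lemma continuous_coeff:
  assumes g: "C1map g g'"
  shows "continuous_on (ball 0 r \<times> {0..1}) (\<lambda>z. a (g (snd z *\<^sub>R fst z)))"
    and "continuous_on (ball 0 r \<times> {0..1}) (\<lambda>z. a' (g (snd z *\<^sub>R fst z)))"
  by (rule continuous_on_compose2[OF _ continuous_ray[OF C1map_continuous[OF g]]],
      use cont_a cont' ray_in_ball g in \<open>auto simp: C1map_def\<close>)+

lemma integrable_coeff:
  assumes g: "C1map g g'" and x: "x \<in> ball 0 r"
  shows "continuous_on {0..1} (\<lambda>t. a (g (t *\<^sub>R x)) v)"
proof -
  have "continuous_on {0..1} (\<lambda>t. (x, t::real))" by (intro continuous_intros)
  then have "continuous_on {0..1} (\<lambda>t. a (g (snd (x, t) *\<^sub>R fst (x, t))))"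
    by (rule continuous_on_compose2[OF continuous_coeff(1)[OF g]]) (use x in auto)
  then show ?thesis by (simp add: blinfun.continuous_on)
qed

lemma continuous_integrand':
  assumes g: "C1map g g'"
  shows "continuous_on (ball 0 r \<times> {0..1}) (\<lambda>(x, t). integrand' g g' x t)"
proof (rule continuous_on_blinfun_componentwise)
  fix i :: 's assume "i \<in> Basis"
  have "continuous_on (ball 0 r) g'" using g by (simp add: C1map_def)
  from continuous_ray[OF this] continuous_coeff[OF g]
  have "continuous_on (ball 0 r \<times> {0..1}) (\<lambda>z. a' (g (snd z *\<^sub>R fst z)) (snd z *\<^sub>R g' (snd z *\<^sub>R fst z) i) (fst z)
      + a (g (snd z *\<^sub>R fst z)) i)"
    by (intro continuous_intros)
  then show "continuous_on (ball 0 r \<times> {0..1}) (\<lambda>z. blinfun_apply (case z of (x, t) \<Rightarrow> integrand' g g' x t) i)"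
    by (rule continuous_on_eq) (auto simp: integrand'_apply)
qed

lemma integrable_integrand':
  assumes g: "C1map g g'" and x: "x \<in> ball 0 r"
  shows "integrand' g g' x integrable_on {0..1}"
proof -
  have "continuous_on {0..1} (\<lambda>t. (x, t::real))" by (intro continuous_intros)
  then have "continuous_on {0..1} (\<lambda>t. case (x, t) of (x, t) \<Rightarrow> integrand' g g' x t)"
    by (rule continuous_on_compose2[OF continuous_integrand'[OF g]]) (use x in auto)
  then show ?thesis by (simp add: integrable_continuous_real)
qed

lemma step_has_derivative:
  assumes g: "C1map g g'" and x: "x \<in> ball 0 r"
  shows "(step g has_derivative blinfun_apply (step' g g' x)) (at x)"
proof -
  have "((\<lambda>x. integral (cbox 0 1) (\<lambda>t. a (g (t *\<^sub>R x)) x)) has_derivative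
      blinfun_apply (integral (cbox 0 1) (integrand' g g' x))) (at x within ball 0 r)"
  proof (rule leibniz_rule)
    fix y :: 's and t :: real assume y: "y \<in> ball 0 r" and t: "t \<in> cbox 0 1"
    have ty: "t *\<^sub>R y \<in> ball 0 r" using ray_in_ball[OF y] t by simp
    then have gy: "g (t *\<^sub>R y) \<in> cball p R" "(g has_derivative blinfun_apply (g' (t *\<^sub>R y))) (at (t *\<^sub>R y))"
      using g by (auto simp: C1map_def)
    have 1: "((\<lambda>x. t *\<^sub>R x) has_derivative (\<lambda>v. t *\<^sub>R v)) (at y)" by (auto intro!: derivative_eq_intros)
    have 2: "((\<lambda>x. a (g (t *\<^sub>R x))) has_derivative (\<lambda>v. a' (g (t *\<^sub>R y)) (g' (t *\<^sub>R y) (t *\<^sub>R v)))) (at y)"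
      by (rule has_derivative_compose[OF has_derivative_compose[OF 1 gy(2)] der[OF gy(1)]])
    have "((\<lambda>x. a (g (t *\<^sub>R x)) x) has_derivative
        (\<lambda>v. a (g (t *\<^sub>R y)) v + a' (g (t *\<^sub>R y)) (g' (t *\<^sub>R y) (t *\<^sub>R v)) y)) (at y)"
      by (rule blinfun.FDERIV[OF 2 has_derivative_ident])
    moreover have "blinfun_apply (integrand' g g' y t) = (\<lambda>v. a (g (t *\<^sub>R y)) v + a' (g (t *\<^sub>R y)) (g' (t *\<^sub>R y) (t *\<^sub>R v)) y)"
      by (simp add: fun_eq_iff integrand'_apply blinfun.scaleR_right add.commute)
    ultimately show "((\<lambda>x. a (g (t *\<^sub>R x)) x) has_derivative blinfun_apply (integrand' g g' y t)) (at y within ball 0 r)"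
      by (simp add: has_derivative_at_withinI)
  next
    show "(\<lambda>t. a (g (t *\<^sub>R y)) y) integrable_on cbox 0 1" if "y \<in> ball 0 r" for y
      using integrable_continuous_real[OF integrable_coeff[OF g that]] by simp
  qed (use continuous_integrand'[OF g] x in auto)
  then have "((\<lambda>x. integral {0..1} (\<lambda>t. a (g (t *\<^sub>R x)) x)) has_derivative blinfun_apply (step' g g' x)) (at x)"
    by (simp add: step'_def at_within_open[OF x open_ball])
  from has_derivative_add[OF has_derivative_const this, of p] show ?thesis
    unfolding step_def[abs_def] by simp
qed

lemma step_close:
  assumes g: "C1map g g'" and x: "x \<in> ball 0 r"
  shows "step g x \<in> cball p R"
proof -
  have "norm (integral {0..1} (\<lambda>t. a (g (t *\<^sub>R x)) x)) \<le> K * r * (1 - 0)"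
  proof (rule integral_bound)
    fix t :: real assume "t \<in> {0..1}"
    then have "norm (a (g (t *\<^sub>R x))) \<le> K" using bound(1) g ray_in_ball[OF x] by (auto simp: C1map_def)
    then show "norm (a (g (t *\<^sub>R x)) x) \<le> K * r"
      using norm_blinfun[of "a (g (t *\<^sub>R x))" x] x mult_mono[of "norm (a (g (t *\<^sub>R x)))" K "norm x" r] K by auto
  qed (use integrable_coeff[OF g x] in auto)
  then show ?thesis using r(2) by (simp add: step_def dist_norm)
qed

lemma step_C1map:
  assumes g: "C1map g g'"
  shows "C1map (step g) (step' g g')"
proof -
  have "continuous_on (ball 0 r) (\<lambda>x. integral (cbox 0 1) (integrand' g g' x))"
    by (rule integral_continuous_on_param) (use continuous_integrand'[OF g] in simp)
  then have "continuous_on (ball 0 r) (step' g g')" by (simp add: step'_def[abs_def])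
  then show ?thesis using step_has_derivative[OF g] step_close[OF g] by (simp add: C1map_def)
qed

text \<open>\<open>a\<close> is Lipschitz with constant \<open>K\<close> and the ray is shorter than
  \<open>r\<close>, which gives the factor \<open>K * r\<close>, at most 1/8.\<close>

lemma step_contraction:
  assumes g: "C1map g g'" and h: "C1map h h'" and d: "\<And>x. x \<in> ball 0 r \<Longrightarrow> norm (g x - h x) \<le> d" and x: "x \<in> ball 0 r"
  shows "norm (step g x - step h x) \<le> d / 4"
proof -
  have d0: "0 \<le> d" using d[OF x] norm_ge_zero order_trans by blast
  have "step g x - step h x = integral {0..1} (\<lambda>t. a (g (t *\<^sub>R x)) x - a (h (t *\<^sub>R x)) x)"
    unfolding step_def using integrable_continuous_real[OF integrable_coeff[OF g x]]
      integrable_continuous_real[OF integrable_coeff[OF h x]] by (simp add: integral_diff)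
  moreover have "norm (integral {0..1} (\<lambda>t. a (g (t *\<^sub>R x)) x - a (h (t *\<^sub>R x)) x)) \<le> K * d * r * (1 - 0)"
  proof (rule integral_bound)
    fix t :: real assume t: "t \<in> {0..1}"
    have tx: "t *\<^sub>R x \<in> ball 0 r" by (rule ray_in_ball[OF x t])
    have "norm (a (g (t *\<^sub>R x)) - a (h (t *\<^sub>R x))) \<le> K * norm (g (t *\<^sub>R x) - h (t *\<^sub>R x))"
      using lip g h tx by (auto simp: C1map_def)
    also have "\<dots> \<le> K * d" by (rule mult_left_mono[OF d[OF tx]]) (use K in simp)
    finally have "norm (a (g (t *\<^sub>R x)) - a (h (t *\<^sub>R x))) * norm x \<le> K * d * r"
      using x d0 K by (intro mult_mono) auto
    then show "norm (a (g (t *\<^sub>R x)) x - a (h (t *\<^sub>R x)) x) \<le> K * d * r"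
      using norm_blinfun[of "a (g (t *\<^sub>R x)) - a (h (t *\<^sub>R x))" x] by (simp add: blinfun.diff_left)
  qed (auto intro!: continuous_intros integrable_coeff[OF g x] integrable_coeff[OF h x])
  moreover have "K * d * r \<le> d / 4"
    using mult_right_mono[OF r(3) d0] d0 by (simp add: mult_ac)
  ultimately show ?thesis by simp
qed

text \<open>By the fundamental theorem of calculus, \<open>a (g x) v\<close> is the integral of the
  derivative of \<open>t a(g(tx)) v\<close>. Subtracted from \<open>integrand'\<close> this leaves
  \<open>t (A (g' v) x - A (g' x) v)\<close> with \<open>A = a'(g(tx))\<close>. Writing
  \<open>g' = a(g) + E\<close>, the contributions of \<open>a(g)\<close> cancel by
  \<open>sym\<close>, and only the old defect \<open>E\<close> remains.\<close>

lemma step'_defect: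
  assumes g: "C1map g g'" and e: "\<And>x. x \<in> ball 0 r \<Longrightarrow> norm (g' x - a (g x)) \<le> e" and x: "x \<in> ball 0 r"
  shows "norm (step' g g' x - a (g x)) \<le> e / 4"
proof (rule norm_blinfun_bound)
  have e0: "0 \<le> e" using e[OF x] norm_ge_zero order_trans by blast
  then show "0 \<le> e / 4" by simp
  fix v
  define E where "E = (\<lambda>t. g' (t *\<^sub>R x) - a (g (t *\<^sub>R x)))"
  define A where "A = (\<lambda>t. a' (g (t *\<^sub>R x)))"
  have tx: "t *\<^sub>R x \<in> ball 0 r" "g (t *\<^sub>R x) \<in> cball p R" if "t \<in> {0..1}" for t
    using ray_in_ball[OF x that] g by (auto simp: C1map_def)
  have 1: "((\<lambda>t. integrand' g g' x t v) has_integral step' g g' x v) {0..1}"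
    using has_integral_linear[OF integrable_integral[OF integrable_integrand'[OF g x]] blinfun.bounded_linear_left[of v]]
    by (simp add: step'_def o_def)
  have 2: "((\<lambda>t. a (g (t *\<^sub>R x)) v + t *\<^sub>R A t (g' (t *\<^sub>R x) x) v) has_integral
      1 *\<^sub>R a (g (1 *\<^sub>R x)) v - 0 *\<^sub>R a (g (0 *\<^sub>R x)) v) {0..1}"
  proof (rule fundamental_theorem_of_calculus)
    fix t :: real assume t: "t \<in> {0..1}"
    have p: "((\<lambda>t. t *\<^sub>R x) has_derivative (\<lambda>h. h *\<^sub>R x)) (at t within {0..1})"
      by (auto intro!: derivative_eq_intros)
    have gt: "(g has_derivative blinfun_apply (g' (t *\<^sub>R x))) (at (t *\<^sub>R x))" using g tx(1)[OF t] by (auto simp: C1map_def)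
    have "((\<lambda>t. a (g (t *\<^sub>R x))) has_derivative (\<lambda>h. A t (g' (t *\<^sub>R x) (h *\<^sub>R x)))) (at t within {0..1})"
      unfolding A_def by (rule has_derivative_compose[OF has_derivative_compose[OF p gt] der[OF tx(2)[OF t]]])
    then have "((\<lambda>t. t *\<^sub>R a (g (t *\<^sub>R x)) v) has_derivative
        (\<lambda>h. t *\<^sub>R A t (g' (t *\<^sub>R x) (h *\<^sub>R x)) v + h *\<^sub>R a (g (t *\<^sub>R x)) v)) (at t within {0..1})"
      by (auto intro!: derivative_eq_intros)
    then show "((\<lambda>t. t *\<^sub>R a (g (t *\<^sub>R x)) v) has_vector_derivative
        a (g (t *\<^sub>R x)) v + t *\<^sub>R A t (g' (t *\<^sub>R x) x) v) (at t within {0..1})"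
      by (auto simp: has_vector_derivative_def blinfun.bilinear_simps algebra_simps elim!: has_derivative_eq_rhs)
  qed simp
  have *: "integrand' g g' x t v - (a (g (t *\<^sub>R x)) v + t *\<^sub>R A t (g' (t *\<^sub>R x) x) v)
      = t *\<^sub>R (A t (E t v) x - A t (E t x) v)" if t: "t \<in> {0..1}" for t
    using sym[OF tx(2)[OF t], of x v]
    by (simp add: integrand'_apply A_def E_def blinfun.bilinear_simps algebra_simps)
  have B: "norm (integrand' g g' x t v - (a (g (t *\<^sub>R x)) v + t *\<^sub>R A t (g' (t *\<^sub>R x) x) v)) \<le> e / 4 * norm v"
    if "t \<in> {0..1} - {}" for t
  proof -
    from that have t: "t \<in> {0..1}" "\<bar>t\<bar> \<le> 1" by auto
    have Et: "norm (E t) \<le> e" unfolding E_def by (rule e[OF tx(1)[OF t(1)]])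
    have At: "norm (A t) \<le> K" unfolding A_def by (rule bound(2)[OF tx(2)[OF t(1)]])
    have n: "norm (A t (E t v) w) \<le> K * e * norm v * norm w" for v w
    proof -
      have "norm (A t (E t v) w) \<le> norm (A t) * (norm (E t) * norm v) * norm w"
        by (meson norm_blinfun order_trans mult_left_mono mult_right_mono norm_ge_zero)
      also have "\<dots> \<le> K * (e * norm v) * norm w" using At Et K e0 by (intro mult_mono) auto
      finally show ?thesis by (simp add: mult_ac)
    qed
    have "norm (A t (E t v) x - A t (E t x) v) \<le> 2 * (K * e * norm v * norm x)"
      using norm_triangle_ineq4[of "A t (E t v) x" "A t (E t x) v"] n[of v x] n[of x v] by (simp add: mult_ac)
    also have "\<dots> \<le> 2 * (K * e * norm v * r)" using K e0 x by (intro mult_left_mono) auto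
    \<comment> \<open>Two terms with \<open>E\<close>, and a gain of 1/4 to be reached: this is the
      origin of the 8 in the assumption on \<open>r\<close>.\<close>
    also have "\<dots> = (8 * (K * r)) * (e * norm v / 4)" by simp
    also have "\<dots> \<le> 1 * (e * norm v / 4)" by (rule mult_right_mono[OF r(3)]) (use e0 in simp)
    finally have "norm (A t (E t v) x - A t (E t x) v) \<le> e / 4 * norm v" by simp
    moreover have "norm (t *\<^sub>R (A t (E t v) x - A t (E t x) v)) \<le> norm (A t (E t v) x - A t (E t x) v)"
      using t(2) by (simp add: mult_left_le_one_le)
    ultimately show ?thesis using *[OF t(1)] by simp
  qed
  have "norm (step' g g' x v - a (g x) v) \<le> e / 4 * norm v"
    using has_integral_bound_real[OF _ finite.emptyI has_integral_diff[OF 1 2[simplified]] B] e0 by simp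
  then show "norm ((step' g g' x - a (g x)) v) \<le> e / 4 * norm v" by (simp add: blinfun.diff_left)
qed

primrec iter :: "nat \<Rightarrow> ('s \<Rightarrow> 'e) \<times> ('s \<Rightarrow> ('s \<Rightarrow>\<^sub>L 'e))" where
  "iter 0 = (\<lambda>x. p, \<lambda>x. 0)"
| "iter (Suc k) = (step (fst (iter k)), step' (fst (iter k)) (snd (iter k)))"

abbreviation "G k \<equiv> fst (iter k)"
abbreviation "G' k \<equiv> snd (iter k)"

lemma iter_C1map: "C1map (G k) (G' k)"
proof (induction k)
  case 0
  then show ?case using R by (auto simp: C1map_def zero_blinfun.rep_eq[abs_def])
qed (simp add: step_C1map)

lemma iter_in: "x \<in> ball 0 r \<Longrightarrow> G k x \<in> cball p R"
  using iter_C1map[of k] by (auto simp: C1map_def)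

lemma iter_diff: "x \<in> ball 0 r \<Longrightarrow> norm (G (Suc k) x - G k x) \<le> R / 4 ^ k"
proof (induction k arbitrary: x)
  case 0
  then show ?case using step_close[OF iter_C1map[of 0]] by (simp add: dist_norm norm_minus_commute)
next
  case (Suc k)
  then show ?case
    using step_contraction[OF iter_C1map[of "Suc k"] iter_C1map[of k] Suc.IH Suc.prems] by simp
qed

text \<open>A step quarters the defect, but measures the new derivative against
  \<open>a (G k x)\<close>; passing to \<open>a (G (Suc k) x)\<close> costs
  \<open>K * R / 4 ^ k\<close>. The slower rate \<open>1 / 2 ^ k\<close> absorbs the sum of both,
  and the factor 4 in the constant makes the second term at most a quarter of the bound.\<close>

lemma iter_defect: "x \<in> ball 0 r \<Longrightarrow> norm (G' k x - a (G k x)) \<le> 4 * K * (R + 1) / 2 ^ k"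
proof (induction k arbitrary: x)
  case 0
  have "K * 1 \<le> K * (4 * (R + 1))" using K R by (intro mult_left_mono) auto
  then show ?case using bound(1)[of p] R by (simp add: algebra_simps)
next
  case (Suc k)
  have "norm (G' (Suc k) x - a (G (Suc k) x)) \<le> norm (G' (Suc k) x - a (G k x)) + norm (a (G (Suc k) x) - a (G k x))"
    by (rule norm_diff_triangle_le[OF order_refl]) (simp add: norm_minus_commute)
  also have "norm (G' (Suc k) x - a (G k x)) \<le> 4 * K * (R + 1) / 2 ^ k / 4"
    using step'_defect[OF iter_C1map[of k] Suc.IH Suc.prems] by simp
  also have "norm (a (G (Suc k) x) - a (G k x)) \<le> K * (R / 4 ^ k)"
    using lip[OF iter_in iter_in, OF Suc.prems Suc.prems] iter_diff[OF Suc.prems, of k] K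
    by (meson mult_left_mono order_trans zero_le_one)
  also have "K * (R / 4 ^ k) \<le> 4 * K * (R + 1) / 2 ^ k / 4"
  proof -
    have "K * R / 4 ^ k \<le> K * (R + 1) / 2 ^ k"
      using K R by (intro frac_le mult_left_mono power_mono) auto
    then show ?thesis by simp
  qed
  finally show ?case by simp
qed

text \<open>A tail of the geometric series \<open>R / 4 ^ k\<close>, stated as a difference so that
  the induction on \<open>j\<close> telescopes; the constant 2 rounds up 4/3.\<close>

lemma iter_Cauchy:
  assumes x: "x \<in> ball 0 r"
  shows "norm (G (k + j) x - G k x) \<le> 2 * R / 4 ^ k - 2 * R / 4 ^ (k + j)"
proof (induction j)
  case (Suc j)
  have "norm (G (k + Suc j) x - G k x) \<le> norm (G (Suc (k + j)) x - G (k + j) x) + norm (G (k + j) x - G k x)"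
    using norm_triangle_ineq[of "G (Suc (k + j)) x - G (k + j) x" "G (k + j) x - G k x"] by (simp only: add_Suc_right diff_add_cancel add_diff_eq)
  also have "\<dots> \<le> R / 4 ^ (k + j) + (2 * R / 4 ^ k - 2 * R / 4 ^ (k + j))"
    using iter_diff[OF x] Suc by (intro add_mono)
  also have "\<dots> \<le> 2 * R / 4 ^ k - 2 * R / 4 ^ (k + Suc j)"
    using R by (simp add: field_simps)
  finally show ?case .
qed simp

lemma iter_convergent:
  assumes x: "x \<in> ball 0 r"
  shows "convergent (\<lambda>k. G k x)"
proof -
  have lim: "(\<lambda>k. 2 * R / 4 ^ k) \<longlonglongrightarrow> 0" by (rule LIMSEQ_divide_realpow_zero) simp
  show ?thesis
    unfolding Cauchy_convergent_iff[symmetric]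
  proof (rule CauchyI')
    fix e :: real assume "e > 0"
    then obtain N where N: "\<And>k. k \<ge> N \<Longrightarrow> norm (2 * R / 4 ^ k) < e"
      using LIMSEQ_D[OF lim] by auto
    have "norm (G m x - G n x) < e" if "m \<ge> N" "n > m" for m n
    proof -
      have "norm (G (m + (n - m)) x - G m x) \<le> 2 * R / 4 ^ m - 2 * R / 4 ^ (m + (n - m))"
        by (rule iter_Cauchy[OF x])
      also have "\<dots> \<le> 2 * R / 4 ^ m" using R by simp
      also have "\<dots> < e" using N[OF that(1)] R by simp
      finally show ?thesis using that by (simp add: norm_minus_commute)
    qed
    then show "\<exists>M. \<forall>m\<ge>M. \<forall>n>m. dist (G m x) (G n x) < e" by (auto simp: dist_norm)
  qed
qed

text \<open>The derivatives converge by way of the defect: uniformly in \<open>x\<close>,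
  \<open>G' k x\<close> approaches \<open>a (G k x)\<close>, which approaches
  \<open>a (g x)\<close>. A uniform limit of derivatives is the derivative of the limit.\<close>

lemma solution:
  obtains g where "g 0 = p" "\<And>x. x \<in> ball 0 r \<Longrightarrow> g x \<in> cball p R"
    "\<And>x. x \<in> ball 0 r \<Longrightarrow> (g has_derivative blinfun_apply (a (g x))) (at x)"
proof -
  define g where "g = (\<lambda>x. lim (\<lambda>k. G k x))"
  have lim: "(\<lambda>k. G k x) \<longlonglongrightarrow> g x" if "x \<in> ball 0 r" for x
    using iter_convergent[OF that] by (simp add: g_def convergent_LIMSEQ_iff)
  have gin: "g x \<in> cball p R" if "x \<in> ball 0 r" for x
    by (rule closed_sequentially[OF closed_cball _ lim[OF that]]) (use iter_in[OF that] in auto)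
  have close: "norm (g x - G k x) \<le> 2 * R / 4 ^ k" if x: "x \<in> ball 0 r" for x k
  proof (rule LIMSEQ_le_const2)
    show "(\<lambda>j. norm (G (j + k) x - G k x)) \<longlonglongrightarrow> norm (g x - G k x)"
      by (intro tendsto_intros LIMSEQ_ignore_initial_segment lim[OF x])
    have "norm (G (j + k) x - G k x) \<le> 2 * R / 4 ^ k" for j
      using iter_Cauchy[OF x, of k j] R by (simp add: add.commute order_trans[of _ "2 * R / 4 ^ k - 2 * R / 4 ^ (k + j)"])
    then show "\<exists>N. \<forall>j\<ge>N. norm (G (j + k) x - G k x) \<le> 2 * R / 4 ^ k" by blast
  qed
  have G0: "G k 0 = p" for k by (cases k) (auto simp: step_def blinfun.zero_right)
  define c where "c = (\<lambda>k::nat. 4 * K * (R + 1) / 2 ^ k + K * (2 * R / 4 ^ k))"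
  have c0: "c \<longlonglongrightarrow> 0" unfolding c_def
    by (intro tendsto_add_zero tendsto_mult_right_zero LIMSEQ_divide_realpow_zero) auto
  have defect: "norm (G' k x - a (g x)) \<le> c k" if x: "x \<in> ball 0 r" for k x
  proof -
    have "norm (a (G k x) - a (g x)) \<le> K * norm (G k x - g x)" by (rule lip[OF iter_in[OF x] gin[OF x]])
    also have "\<dots> \<le> K * (2 * R / 4 ^ k)"
      using close[OF x, of k] K by (intro mult_left_mono) (auto simp: norm_minus_commute)
    finally show ?thesis
      unfolding c_def using iter_defect[OF x, of k] norm_diff_triangle_le by blast
  qed
  have "\<exists>h. \<forall>x\<in>ball 0 r. (\<lambda>k. G k x) \<longlonglongrightarrow> h x \<and> (h has_derivative blinfun_apply (a (g x))) (at x within ball 0 r)"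
  proof (rule has_derivative_sequence[OF convex_ball])
    show "(G k has_derivative blinfun_apply (G' k x)) (at x within ball 0 r)" if "x \<in> ball 0 r" for k x
      using iter_C1map[of k] that by (auto simp: C1map_def intro: has_derivative_at_withinI)
    show "\<forall>\<^sub>F k in sequentially. \<forall>x\<in>ball 0 r. \<forall>h. norm (G' k x h - a (g x) h) \<le> e * norm h" if "e > 0" for e
    proof -
      have "\<forall>\<^sub>F k in sequentially. c k < e" using c0 that by (rule order_tendstoD(2))
      then show ?thesis
      proof (rule eventually_mono, safe)
        fix k x h assume k: "c k < e" and x: "x \<in> ball (0::'s) r"
        have "norm (G' k x h - a (g x) h) \<le> norm (G' k x - a (g x)) * norm h"
          using norm_blinfun[of "G' k x - a (g x)" h] by (simp add: blinfun.diff_left)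
        also have "\<dots> \<le> e * norm h" using defect[OF x, of k] k by (intro mult_right_mono) auto
        finally show "norm (G' k x h - a (g x) h) \<le> e * norm h" .
      qed
    qed
    show "(0::'s) \<in> ball 0 r" using r by simp
    show "(\<lambda>k. G k 0) \<longlonglongrightarrow> p" by (simp add: G0)
  qed
  then obtain h where h: "\<And>x. x \<in> ball 0 r \<Longrightarrow> (\<lambda>k. G k x) \<longlonglongrightarrow> h x"
    "\<And>x. x \<in> ball 0 r \<Longrightarrow> (h has_derivative blinfun_apply (a (g x))) (at x within ball 0 r)" by blast
  have gh: "h x = g x" if "x \<in> ball 0 r" for x using LIMSEQ_unique[OF h(1)[OF that] lim[OF that]] .
  show thesis
  proof (rule that[of g])
    show "g 0 = p" using LIMSEQ_unique[OF lim[of 0]] G0 r by simp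
    show "g x \<in> cball p R" if "x \<in> ball 0 r" for x using gin[OF that] .
    show "(g has_derivative blinfun_apply (a (g x))) (at x)" if x: "x \<in> ball 0 r" for x
    proof (rule has_derivative_transform_within_open[OF _ open_ball x])
      show "(h has_derivative blinfun_apply (a (g x))) (at x)"
        using h(2)[OF x] at_within_open[OF x open_ball] by simp
    qed (rule gh)
  qed
qed

end

lemma total_differential_equation:
  fixes a :: "'e::euclidean_space \<Rightarrow> ('s::euclidean_space \<Rightarrow>\<^sub>L 'e)"
  assumes U: "open U" "p \<in> U" and der: "\<And>u. u \<in> U \<Longrightarrow> (a has_derivative blinfun_apply (a' u)) (at u)"
    and cont: "continuous_on U a'"
    and sym: "\<And>u s t. u \<in> U \<Longrightarrow> a' u (a u s) t = a' u (a u t) s"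
  obtains r g where "r > 0" "g 0 = p" "\<And>x. x \<in> ball 0 r \<Longrightarrow> g x \<in> U"
    "\<And>x. x \<in> ball 0 r \<Longrightarrow> (g has_derivative blinfun_apply (a (g x))) (at x)"
proof -
  obtain R K where RK: "R > 0" "K \<ge> 1" "cball p R \<subseteq> U" "\<And>u. u \<in> cball p R \<Longrightarrow> norm (a u) \<le> K"
    "\<And>u. u \<in> cball p R \<Longrightarrow> norm (a' u) \<le> K"
    "\<And>u v. u \<in> cball p R \<Longrightarrow> v \<in> cball p R \<Longrightarrow> norm (a u - a v) \<le> K * norm (u - v)"
    using C1_bounds_near[OF U der cont] by metis
  \<comment> \<open>This makes \<open>K * r\<close> equal to \<open>min 1 R / 8\<close>, which meets
    both bounds on \<open>r\<close> in the locale.\<close>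
  define r where "r = min 1 R / (8 * K)"
  have Kr: "K * r = min 1 R / 8" using RK(2) by (simp add: r_def)
  interpret ray_picard a a' p R K r
  proof
    show "r > 0" using RK(1,2) by (simp add: r_def)
    show "K * r \<le> R" "8 * (K * r) \<le> 1" unfolding Kr using RK(1) by linarith+
    show "continuous_on (cball p R) a'" by (rule continuous_on_subset[OF cont RK(3)])
    show "(a has_derivative blinfun_apply (a' u)) (at u)" if "u \<in> cball p R" for u
      using der that RK(3) by blast
    show "a' u (a u s) t = a' u (a u t) s" if "u \<in> cball p R" for u s t
      using sym that RK(3) by blast
  qed (fact RK)+
  obtain g where g: "g 0 = p" "\<And>x. x \<in> ball 0 r \<Longrightarrow> g x \<in> cball p R"
    "\<And>x. x \<in> ball 0 r \<Longrightarrow> (g has_derivative blinfun_apply (a (g x))) (at x)" by (fact solution)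
  show thesis
  proof (rule that[of r g])
    show "g x \<in> U" if "x \<in> ball 0 r" for x using g(2)[OF that] RK(3) by blast
  qed (fact r(1) g)+
qed

subsection \<open>Bump functions\<close>

text \<open>The usual \<open>exp (-1/t)\<close>, continued by 0. The polynomial factor in
  \<open>1 / t\<close> makes the family closed under differentiation, so that one induction over all
  \<open>P\<close> reaches every order.\<close>

definition flat :: "real poly \<Rightarrow> real \<Rightarrow> real" where
  "flat P t = (if t > 0 then poly P (1 / t) * exp (- (1 / t)) else 0)"

lemma flat_tendsto_0: "(flat P \<longlongrightarrow> 0) (at 0)"
proof (rule filterlim_split_at)
  have "((\<lambda>x::real. 0) \<longlongrightarrow> 0) (at_left 0)" by simp
  then show "(flat P \<longlongrightarrow> 0) (at_left 0)"
    by (rule Lim_transform_eventually) (auto simp: flat_def eventually_at_filter)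
  have "((\<lambda>y. poly P y * exp (- y)) \<longlongrightarrow> 0) at_top"
  proof -
    have "((\<lambda>y. \<Sum>i\<le>degree P. coeff P i * (y ^ i / exp y)) \<longlongrightarrow> (\<Sum>i\<le>degree P. coeff P i * 0)) at_top"
      by (intro tendsto_sum tendsto_mult tendsto_const tendsto_power_div_exp_0)
    then show ?thesis by (simp add: poly_altdef sum_distrib_right exp_minus divide_inverse mult.assoc)
  qed
  from filterlim_compose[OF this filterlim_inverse_at_top_right]
  have "((\<lambda>t. poly P (1 / t) * exp (- (1 / t))) \<longlongrightarrow> 0) (at_right 0)"
    by (simp add: inverse_eq_divide)
  then show "(flat P \<longlongrightarrow> 0) (at_right 0)"
    by (rule Lim_transform_eventually) (auto simp: flat_def eventually_at_filter)
qed

text \<open>For positive \<open>t\<close>, differentiating \<open>P(1/t) exp(-1/t)\<close> produces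
  the factor \<open>(1/t)^2 (P - P')(1/t)\<close>, hence the polynomial
  \<open>[:0, 0, 1:] * (P - pderiv P)\<close>.\<close>

lemma flat_has_derivative:
  "(flat P has_real_derivative flat ([:0, 0, 1:] * (P - pderiv P)) t) (at t)"
proof (cases t "0::real" rule: linorder_cases)
  case less
  have "((\<lambda>x. 0) has_real_derivative 0) (at t)" by simp
  then have "(flat P has_real_derivative 0) (at t)"
    by (rule has_field_derivative_transform_within_open[of _ _ _ "{..<0}"]) (use less in \<open>auto simp: flat_def\<close>)
  then show ?thesis using less by (simp add: flat_def)
next
  case equal
  \<comment> \<open>At 0 the difference quotient is itself a flat function: dividing by
    \<open>h\<close> multiplies the polynomial by its variable.\<close>
  have "((\<lambda>h. (flat P (0 + h) - flat P 0) / h) \<longlongrightarrow> 0) (at 0)"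
    by (rule Lim_transform_eventually[OF flat_tendsto_0[of "[:0, 1:] * P"]])
      (auto simp: flat_def eventually_at_filter)
  then show ?thesis using equal by (simp add: DERIV_def flat_def)
next
  case greater
  have "((\<lambda>t. poly P (1 / t) * exp (- (1 / t))) has_real_derivative
      poly (pderiv P) (1 / t) * (- (1 / t\<^sup>2)) * exp (- (1 / t)) + exp (- (1 / t)) * (1 / t\<^sup>2) * poly P (1 / t)) (at t)"
    using greater by (auto intro!: derivative_eq_intros DERIV_chain2[OF poly_DERIV] simp: power2_eq_square)
  then have "(flat P has_real_derivative
      poly (pderiv P) (1 / t) * (- (1 / t\<^sup>2)) * exp (- (1 / t)) + exp (- (1 / t)) * (1 / t\<^sup>2) * poly P (1 / t)) (at t)"
    by (rule has_field_derivative_transform_within_open[of _ _ _ "{0<..}"]) (use greater in \<open>auto simp: flat_def\<close>)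
  then show ?thesis using greater by (simp add: flat_def algebra_simps power2_eq_square)
qed

lemma Ck_on_flat: "Ck_on k UNIV UNIV (flat P)"
proof (induction k arbitrary: P)
  case 0
  have "isCont (flat P) t" for t using flat_has_derivative by (rule DERIV_isCont)
  then show ?case by (simp add: continuous_at_imp_continuous_on)
next
  case (Suc k)
  have ro: "relopen (UNIV :: real set) UNIV" by (simp add: relopen_UNIV)
  show ?case
  proof (rule Ck_on_SucI[OF ro, where f' = "\<lambda>t v. flat ([:0, 0, 1:] * (P - pderiv P)) t * v"])
    show "(flat P has_derivative (\<lambda>v. flat ([:0, 0, 1:] * (P - pderiv P)) t * v)) (at t within UNIV)" for t
      using flat_has_derivative[of P t] by (simp add: has_field_derivative_def)
    show "Ck_on k UNIV UNIV (\<lambda>t. flat ([:0, 0, 1:] * (P - pderiv P)) t * v)" for v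
      by (rule Ck_on_bounded_linear_comp[OF ro bounded_linear_mult_left Suc.IH])
  qed
qed

lemma bump_exists:
  fixes p :: "'e::euclidean_space"
  assumes r: "r > 0"
  obtains \<phi> :: "'e \<Rightarrow> real" where "\<And>S V. relopen S V \<Longrightarrow> smooth_on S V \<phi>" "\<phi> p = 1"
    "\<And>u. dist p u \<ge> r \<Longrightarrow> \<phi> u = 0"
proof -
  \<comment> \<open>The squared distance is polynomial, hence smooth also at \<open>p\<close>; the
    denominator normalises the value there to 1.\<close>
  define \<phi> where "\<phi> = (\<lambda>u. flat 1 (r\<^sup>2 - (u - p) \<bullet> (u - p)) / flat 1 (r\<^sup>2))"
  have sm: "smooth_on S V \<phi>" if V: "relopen S V" for S V
  proof -
    have id: "smooth_on S V (\<lambda>u. u - p)"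
      by (rule smooth_on_minus[OF V smooth_on_bounded_linear[OF V bounded_linear_ident] smooth_on_const[OF V]])
    have "smooth_on S V (\<lambda>u. r\<^sup>2 - (u - p) \<bullet> (u - p))"
      by (rule smooth_on_minus[OF V smooth_on_const[OF V] smooth_on_bilinear[OF V bounded_bilinear_inner id id]])
    moreover have "smooth_on (UNIV :: real set) UNIV (flat 1)" by (simp add: smooth_on_def Ck_on_flat)
    ultimately have "smooth_on S V (\<lambda>u. flat 1 (r\<^sup>2 - (u - p) \<bullet> (u - p)))"
      by (rule smooth_on_comp[OF V relopen_UNIV[THEN iffD2, OF open_UNIV] subset_UNIV])
    then show ?thesis
      unfolding \<phi>_def by (rule smooth_on_bounded_linear_comp[OF V bounded_linear_divide])
  qed
  show thesis
  proof (rule that[of \<phi>, OF sm])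
    show "\<phi> p = 1" using r by (simp add: \<phi>_def flat_def)
    show "\<phi> u = 0" if "dist p u \<ge> r" for u
    proof -
      have "r\<^sup>2 \<le> (norm (u - p))\<^sup>2" using that r by (intro power_mono) (auto simp: dist_norm norm_minus_commute)
      then show ?thesis by (simp add: \<phi>_def flat_def power2_norm_eq_inner)
    qed
  qed
qed

subsection \<open>Normalised frames\<close>

text \<open>\<open>norm (A x)\<close> is at least \<open>norm x / 2\<close>, which yields
  injectivity, surjectivity by finite dimension, and the bound 2 on the inverse. This uniform bound
  is what the smoothness of inversion rests on.\<close>

lemma blinfun_near_id_invertible:
  fixes A :: "'e::euclidean_space \<Rightarrow>\<^sub>L 'e"
  assumes A: "norm (A - id_blinfun) < 1 / 2"
  obtains J where "A o\<^sub>L J = id_blinfun" "J o\<^sub>L A = id_blinfun" "norm J \<le> 2"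
proof -
  have low: "norm x / 2 \<le> norm (A x)" for x
  proof -
    have "norm (A x - x) \<le> norm (A - id_blinfun) * norm x"
      using norm_blinfun[of "A - id_blinfun" x] by (simp add: blinfun.diff_left)
    also have "\<dots> \<le> 1 / 2 * norm x" by (rule mult_right_mono) (use A in auto)
    finally show ?thesis using norm_triangle_ineq3[of "A x" x] by linarith
  qed
  have lin: "linear (blinfun_apply A)" by (simp add: blinfun.bounded_linear_right bounded_linear.linear)
  have inj: "inj (blinfun_apply A)"
  proof (rule injI)
    fix x y assume "A x = A y"
    then show "x = y" using low[of "x - y"] by (simp add: blinfun.diff_right)
  qed
  then have surj: "surj (blinfun_apply A)" using linear_injective_imp_surjective[OF lin] by blast
  have J: "bounded_linear (inv (blinfun_apply A))"
    using linear_injective_left_inverse linear_conv_bounded_linear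
    by (metis bij_betw_def inj inj_linear_imp_inv_linear lin)
  show thesis
  proof (rule that[of "Blinfun (inv (blinfun_apply A))"])
    show "A o\<^sub>L Blinfun (inv (blinfun_apply A)) = id_blinfun"
      by (rule blinfun_eqI) (simp add: bounded_linear_Blinfun_apply[OF J] surj_f_inv_f[OF surj])
    show "Blinfun (inv (blinfun_apply A)) o\<^sub>L A = id_blinfun"
      by (rule blinfun_eqI) (simp add: bounded_linear_Blinfun_apply[OF J] inv_f_f[OF inj])
    show "norm (Blinfun (inv (blinfun_apply A))) \<le> 2"
    proof (rule norm_blinfun_bound)
      show "norm (Blinfun (inv (blinfun_apply A)) x) \<le> 2 * norm x" for x
        using low[of "inv (blinfun_apply A) x"] by (simp add: bounded_linear_Blinfun_apply[OF J] surj_f_inv_f[OF surj])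
    qed simp
  qed
qed

text \<open>
  The frame \<open>\<xi>\<close> is replaced by \<open>a\<close>, which satisfies \<open>P (a u s) = s\<close> on the model space \<open>T\<close> for a
  projection \<open>P\<close> that does not depend on \<open>u\<close>.
\<close>

lemma normalised_frame:
  fixes \<xi> :: "nat \<Rightarrow> 'e::euclidean_space \<Rightarrow> 'e"
  assumes V: "relopen S V" and u0: "u0 \<in> V" and \<xi>: "\<And>i. i < m \<Longrightarrow> smooth_on S V (\<xi> i)"
    and indep: "\<And>c. (\<Sum>i<m. c i *\<^sub>R \<xi> i u0) = 0 \<Longrightarrow> \<forall>i<m. c i = 0"
    and T: "subspace T" "dim T = m"
  obtains W P and a :: "'e \<Rightarrow> ('e \<Rightarrow>\<^sub>L 'e)" where "relopen S W" "u0 \<in> W" "W \<subseteq> V" "bounded_linear P" "range P \<subseteq> T"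
    "smooth_on S W a" "\<And>u. u \<in> W \<Longrightarrow> blinfun_apply (a u) ` T = span ((\<lambda>i. \<xi> i u) ` {..<m})"
    "\<And>u s. u \<in> W \<Longrightarrow> P (a u s) = proj T s" "\<And>u s. u \<in> W \<Longrightarrow> a u s = a u (proj T s)"
proof -
  obtain B where B: "B \<subseteq> T" "pairwise orthogonal B" "\<And>x. x \<in> B \<Longrightarrow> norm x = 1" "independent B" "card B = dim T" "span B = T"
    using orthonormal_basis_subspace[OF T(1)] by metis
  have "finite B" using B(4) by (rule independent_imp_finite)
  then obtain b where b: "bij_betw b {..<m} B"
    using ex_bij_betw_nat_finite[of B] B(5) T(2) by (auto simp: atLeast0LessThan)
  have bT: "b i \<in> T" if "i < m" for i using b B(1) that by (auto simp: bij_betw_def)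
  have bb: "b i \<bullet> b j = (if i = j then 1 else 0)" if "i < m" "j < m" for i j
  proof (cases "i = j")
    case True
    then show ?thesis using B(3)[of "b j"] b that by (auto simp: bij_betw_def norm_eq_1)
  next
    case False
    then have "b i \<noteq> b j" using b that by (auto simp: bij_betw_def inj_on_def)
    then show ?thesis using B(2) b that False by (auto simp: bij_betw_def pairwise_def orthogonal_def)
  qed
  have pl: "bounded_linear (proj T)" by (rule proj_linear[OF T(1)])
  interpret p: bounded_linear "proj T" by (rule pl)
  define fnl where "fnl = (\<lambda>i. blinfun_inner_left (b i) o\<^sub>L Blinfun (proj T))"
  \<comment> \<open>Sends the orthonormal basis \<open>b\<close> of \<open>T\<close> to the frame at
    \<open>u\<close>, and factors through \<open>proj T\<close>.\<close>
  define Bop where "Bop = (\<lambda>u. \<Sum>i<m. blinfun_scaleR_left (\<xi> i u) o\<^sub>L fnl i)"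
  have Bop: "blinfun_apply (Bop u) s = (\<Sum>i<m. (proj T s \<bullet> b i) *\<^sub>R \<xi> i u)" for u s
    unfolding Bop_def by (simp add: blinfun.sum_left fnl_def bounded_linear_Blinfun_apply[OF pl])
  have expand: "s = (\<Sum>i<m. (s \<bullet> b i) *\<^sub>R b i)" if s: "s \<in> T" for s
  proof -
    define d where "d = s - (\<Sum>i<m. (s \<bullet> b i) *\<^sub>R b i)"
    have dT: "d \<in> T" unfolding d_def using s bT T(1) by (intro subspace_diff subspace_sum subspace_scale) auto
    have "d \<bullet> b j = 0" if j: "j < m" for j
    proof -
      have "(\<Sum>i<m. (s \<bullet> b i) * (b i \<bullet> b j)) = (\<Sum>i<m. if i = j then s \<bullet> b j else 0)"
        by (rule sum.cong) (use bb j in auto)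
      then show ?thesis using j by (simp add: d_def inner_diff_left inner_sum_left)
    qed
    then have "orthogonal d x" if "x \<in> B" for x using b that by (auto simp: bij_betw_def orthogonal_def)
    then have "orthogonal d x" if "x \<in> span B" for x using orthogonal_to_span[OF that] by blast
    from this[of d] have "d = 0" using dT B(6) by (simp add: orthogonal_def)
    then show ?thesis by (simp add: d_def)
  qed
  have Bop_span: "blinfun_apply (Bop u) ` T = span ((\<lambda>i. \<xi> i u) ` {..<m})" for u
  proof
    show "blinfun_apply (Bop u) ` T \<subseteq> span ((\<lambda>i. \<xi> i u) ` {..<m})"
      by (auto simp: Bop intro!: span_sum span_scale intro: span_base)
    have lin: "linear (blinfun_apply (Bop u))" by (simp add: blinfun.bounded_linear_right bounded_linear.linear)
    have "\<xi> j u \<in> blinfun_apply (Bop u) ` T" if j: "j < m" for j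
    proof
      have "(\<Sum>i<m. (b j \<bullet> b i) *\<^sub>R \<xi> i u) = (\<Sum>i<m. if i = j then \<xi> j u else 0)"
        by (rule sum.cong) (use bb j in auto)
      then show "\<xi> j u = blinfun_apply (Bop u) (b j)" using j by (simp add: Bop proj_id[OF T(1) bT])
    qed (rule bT[OF j])
    then show "span ((\<lambda>i. \<xi> i u) ` {..<m}) \<subseteq> blinfun_apply (Bop u) ` T"
      by (intro span_minimal linear_subspace_image lin T(1)) auto
  qed
  have inj: "inj_on (blinfun_apply (Bop u0)) T"
  proof (rule inj_onI)
    fix s t assume s: "s \<in> T" and t: "t \<in> T" and eq: "Bop u0 s = Bop u0 t"
    have d: "s - t \<in> T" using s t T(1) by (simp add: subspace_diff)
    have "Bop u0 (s - t) = 0" using eq by (simp add: blinfun.diff_right)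
    then have "\<forall>i<m. (s - t) \<bullet> b i = 0" using indep[of "\<lambda>i. (s - t) \<bullet> b i"] by (simp add: Bop proj_id[OF T(1) d])
    then have "(\<Sum>i<m. ((s - t) \<bullet> b i) *\<^sub>R b i) = 0" by simp
    then show "s = t" using expand[OF d] by simp
  qed
  have "linear (blinfun_apply (Bop u0))" by (simp add: blinfun.bounded_linear_right bounded_linear.linear)
  from linear_exists_left_inverse_on[OF this T(1) inj]
  obtain P where P: "range P \<subseteq> T" "linear P" "\<And>s. s \<in> T \<Longrightarrow> P (Bop u0 s) = s" by auto
  have Pl: "bounded_linear P" using P(2) by (simp add: linear_conv_bounded_linear)
  define Pb where "Pb = Blinfun P"
  define pb where "pb = Blinfun (proj T)"
  have Pb: "blinfun_apply Pb = P" and pb: "blinfun_apply pb = proj T"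
    unfolding Pb_def pb_def by (rule bounded_linear_Blinfun_apply Pl pl)+
  \<comment> \<open>On \<open>T\<close> this is \<open>P o Bop u\<close>; the second summand fills
    it up by the identity on the kernel of \<open>proj T\<close>. So \<open>C u0\<close> is the
    identity of the whole space, and \<open>C u\<close> is invertible for \<open>u\<close> near
    \<open>u0\<close>.\<close>
  define C where "C = (\<lambda>u. (Pb o\<^sub>L Bop u) + (id_blinfun - pb))"
  have C: "blinfun_apply (C u) s = P (Bop u s) + (s - proj T s)" for u s
    unfolding C_def by (simp add: blinfun.add_left blinfun.diff_left Pb pb)
  have Bop_proj: "Bop u (proj T s) = Bop u s" for u s by (simp add: Bop proj_id[OF T(1) proj_in[OF T(1)]])
  have C0: "C u0 = id_blinfun"
  proof (rule blinfun_eqI)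
    fix s
    have "P (Bop u0 s) = proj T s" using P(3)[OF proj_in[OF T(1)], of s] by (simp add: Bop_proj)
    then show "C u0 s = id_blinfun s" by (simp add: C)
  qed
  have smB: "smooth_on S V Bop"
    unfolding Bop_def
  proof (rule smooth_on_sum[OF V])
    fix i assume "i \<in> {..<m}"
    then have "smooth_on S V (\<lambda>u. blinfun_scaleR_left (\<xi> i u))"
      by (intro smooth_on_bounded_linear_comp[OF V bounded_linear_blinfun_scaleR_left] \<xi>) simp
    then show "smooth_on S V (\<lambda>u. blinfun_scaleR_left (\<xi> i u) o\<^sub>L fnl i)"
      by (rule smooth_on_bounded_linear_comp[OF V bounded_bilinear.bounded_linear_left[OF bounded_bilinear_blinfun_compose]])
  qed
  have smC: "smooth_on S V C" unfolding C_def
    by (intro smooth_on_add V smooth_on_const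
        smooth_on_bounded_linear_comp[OF V bounded_bilinear.bounded_linear_right[OF bounded_bilinear_blinfun_compose] smB])
  define W where "W = {u \<in> V. C u \<in> ball id_blinfun (1 / 2)}"
  have W: "relopen S W" unfolding W_def
    by (rule relopen_preimage[OF V smooth_on_continuous[OF smC], of UNIV]) auto
  have WV: "W \<subseteq> V" by (auto simp: W_def)
  have u0W: "u0 \<in> W" using u0 C0 by (simp add: W_def)
  have "\<exists>J. \<forall>u\<in>W. C u o\<^sub>L J u = id_blinfun \<and> J u o\<^sub>L C u = id_blinfun \<and> norm (J u) \<le> 2"
  proof (rule bchoice, rule ballI)
    fix u assume "u \<in> W"
    then have "norm (C u - id_blinfun) < 1 / 2" by (simp add: W_def dist_norm norm_minus_commute)
    then show "\<exists>J. C u o\<^sub>L J = id_blinfun \<and> J o\<^sub>L C u = id_blinfun \<and> norm J \<le> 2"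
      using blinfun_near_id_invertible by metis
  qed
  then obtain J where J: "\<And>u. u \<in> W \<Longrightarrow> C u o\<^sub>L J u = id_blinfun" "\<And>u. u \<in> W \<Longrightarrow> J u o\<^sub>L C u = id_blinfun"
    "\<And>u. u \<in> W \<Longrightarrow> norm (J u) \<le> 2" by blast
  have smJ: "smooth_on S W J"
    by (rule smooth_on_blinfun_inverse[OF W J smooth_on_open_subset[OF V W WV smC]])
  have CJ: "C u (J u s) = s" "J u (C u s) = s" if "u \<in> W" for u s
    using J(1,2)[OF that] by (metis blinfun_apply_blinfun_compose blinfun_apply_id_blinfun id_apply)+
  have CT: "blinfun_apply (C u) ` T = T" if u: "u \<in> W" for u
  proof (rule subspace_dim_equal)
    have lin: "linear (blinfun_apply (C u))" by (simp add: blinfun.bounded_linear_right bounded_linear.linear)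
    show "subspace (blinfun_apply (C u) ` T)" by (rule linear_subspace_image[OF lin T(1)])
    show "blinfun_apply (C u) ` T \<subseteq> T" using P(1) by (auto simp: C proj_id[OF T(1)])
    have "inj_on (blinfun_apply (C u)) (span T)" by (rule inj_on_inverseI[of _ "J u"]) (rule CJ(2)[OF u])
    then show "dim T \<le> dim (blinfun_apply (C u) ` T)" using dim_image_eq[OF lin] by simp
  qed (rule T(1))
  have JT: "J u s \<in> T" if u: "u \<in> W" and s: "s \<in> T" for u s
    using CT[OF u] s CJ(2)[OF u] by (metis imageE)
  \<comment> \<open>Precomposing with the inverse of \<open>P o Bop u\<close> on \<open>T\<close>
    turns it into the identity there, with the same \<open>P\<close> for every
    \<open>u\<close>.\<close>
  define a where "a = (\<lambda>u. (Bop u o\<^sub>L J u) o\<^sub>L pb)"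
  have a: "blinfun_apply (a u) s = Bop u (J u (proj T s))" for u s by (simp add: a_def pb)
  show thesis
  proof (rule that[OF W u0W WV Pl P(1), of a])
    show "smooth_on S W a" unfolding a_def
      by (intro smooth_on_bounded_linear_comp[OF W bounded_bilinear.bounded_linear_left[OF bounded_bilinear_blinfun_compose]]
          smooth_on_bilinear[OF W bounded_bilinear_blinfun_compose] smJ smooth_on_open_subset[OF V W WV smB])
    show "blinfun_apply (a u) ` T = span ((\<lambda>i. \<xi> i u) ` {..<m})" if u: "u \<in> W" for u
    proof -
      have "blinfun_apply (a u) ` T = blinfun_apply (Bop u) ` (blinfun_apply (J u) ` T)"
        by (auto simp: a proj_id[OF T(1)] image_iff)
      also have "blinfun_apply (J u) ` T = T"
        using JT[OF u] CT[OF u] CJ(2)[OF u] by (metis (no_types, lifting) image_cong image_ident image_image)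
      finally show ?thesis using Bop_span by simp
    qed
    show "P (a u s) = proj T s" if u: "u \<in> W" for u s
    proof -
      have "J u (proj T s) \<in> T" by (rule JT[OF u proj_in[OF T(1)]])
      then show ?thesis using CJ(1)[OF u, of "proj T s"] by (simp add: C a proj_id[OF T(1)])
    qed
    show "a u s = a u (proj T s)" for u s by (simp add: a proj_id[OF T(1) proj_in[OF T(1)]])
  qed
qed

subsection \<open>Brackets in coordinates\<close>

lemma has_derivative_unique_on:
  fixes f :: "'e::euclidean_space \<Rightarrow> 'f::real_normed_vector"
  assumes "relopen S V" "x \<in> V" "(f has_derivative f1) (at x within V)" "(f has_derivative f2) (at x within V)" "v \<in> S"
  shows "f1 v = f2 v"
  using frechet_within_unique[OF assms(1-3,5)] frechet_within_unique[OF assms(1,2,4,5)] by simp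

lemma derivative_in_subspace:
  fixes f :: "'e::euclidean_space \<Rightarrow> 'f::euclidean_space"
  assumes V: "relopen S V" and x: "x \<in> V" and f: "(f has_derivative f') (at x within V)"
    and T: "f ` V \<subseteq> T" "subspace T" and v: "v \<in> S"
  shows "f' v \<in> T"
  using has_derivative_unique_on[OF V x f has_derivative_proj_left[OF T(2) f T(1) x] v] proj_in[OF T(2)] by metis

text \<open>Product rule for evaluating \<open>Df\<close> on a varying vector; its two terms are
  read off after expanding the vector along \<open>Basis\<close>.\<close>

lemma fderiv_along_has_derivative:
  assumes V: "relopen S V" and f: "smooth_on S V f" and x: "x \<in> V"
    and X: "(X has_derivative X') (at x within V)" "X ` V \<subseteq> S"
  obtains E where "((\<lambda>y. fderiv V f y (X y)) has_derivative E) (at x within V)"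
    "\<And>v. v \<in> S \<Longrightarrow> E v = fderiv V (\<lambda>y. fderiv V f y (X x)) x v + fderiv V f x (X' v)"
proof -
  have S: "subspace S" using V by (simp add: relopen_def)
  define F where "F = (\<lambda>b y. fderiv V f y (proj S b))"
  have F: "(F b has_derivative fderiv V (F b) x) (at x within V)" for b
    unfolding F_def by (rule smooth_on_has_derivative[OF smooth_on_fderiv[OF f proj_in[OF S]] x])
  have Xx: "X x \<in> S" using X(2) x by auto
  define E where "E = (\<lambda>v. \<Sum>b\<in>Basis. (X x \<bullet> b) *\<^sub>R fderiv V (F b) x v + (X' v \<bullet> b) *\<^sub>R F b x)"
  have "((\<lambda>y. \<Sum>b\<in>Basis. (X y \<bullet> b) *\<^sub>R F b y) has_derivative E) (at x within V)"
    unfolding E_def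
    by (intro has_derivative_sum bounded_bilinear.FDERIV[OF bounded_bilinear_scaleR _ F]
        bounded_linear.has_derivative[OF bounded_linear_inner_left X(1)])
  then have 1: "((\<lambda>y. fderiv V f y (X y)) has_derivative E) (at x within V)"
    by (rule has_derivative_transform[OF x, rotated]) (use fderiv_expand[OF V f] X(2) in \<open>auto simp: F_def\<close>)
  have "((\<lambda>y. \<Sum>b\<in>Basis. (X x \<bullet> b) *\<^sub>R F b y) has_derivative (\<lambda>v. \<Sum>b\<in>Basis. (X x \<bullet> b) *\<^sub>R fderiv V (F b) x v))
      (at x within V)"
    by (intro has_derivative_sum bounded_linear.has_derivative[OF bounded_linear_scaleR_right F])
  then have 2: "((\<lambda>y. fderiv V f y (X x)) has_derivative (\<lambda>v. \<Sum>b\<in>Basis. (X x \<bullet> b) *\<^sub>R fderiv V (F b) x v)) (at x within V)"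
    by (rule has_derivative_transform[OF x, rotated]) (use fderiv_expand[OF V f _ Xx] in \<open>auto simp: F_def\<close>)
  show thesis
  proof (rule that[OF 1])
    fix v assume v: "v \<in> S"
    have "X' v \<in> S" by (rule derivative_in_subspace[OF V x X(1,2) S v])
    then have "fderiv V f x (X' v) = (\<Sum>b\<in>Basis. (X' v \<bullet> b) *\<^sub>R F b x)"
      unfolding F_def by (rule fderiv_expand[OF V f x])
    then show "E v = fderiv V (\<lambda>y. fderiv V f y (X x)) x v + fderiv V f x (X' v)"
      using frechet_within_unique[OF V x 2 v] by (simp add: E_def sum.distrib)
  qed
qed

text \<open>Differentiating the relations \<open>Z o f = Df X\<close> and
  \<open>Q o f = Df Y\<close> produces second derivatives of \<open>f\<close> on the vectors
  \<open>X u\<close> and \<open>Y u\<close>, which cancel by symmetry; the rest is the bracket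
  pushed forward by \<open>f\<close>.\<close>

lemma bracket_natural:
  fixes f :: "'e::euclidean_space \<Rightarrow> 'g::euclidean_space"
  assumes V: "relopen S V" and W: "relopen T W" and f: "smooth_on S V f" "f ` V \<subseteq> W" and u: "u \<in> V"
    and X: "(X has_derivative X') (at u within V)" "X ` V \<subseteq> S"
    and Y: "(Y has_derivative Y') (at u within V)" "Y ` V \<subseteq> S"
    and Z: "(Z has_derivative Z') (at (f u) within W)" "\<And>v. v \<in> V \<Longrightarrow> Z (f v) = fderiv V f v (X v)"
    and Q: "(Q has_derivative Q') (at (f u) within W)" "\<And>v. v \<in> V \<Longrightarrow> Q (f v) = fderiv V f v (Y v)"
  shows "Q' (Z (f u)) - Z' (Q (f u)) = fderiv V f u (Y' (X u) - X' (Y u))"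
proof -
  have main: "R' (fderiv V f u v) = fderiv V (\<lambda>y. fderiv V f y (A u)) u v + fderiv V f u (A' v)"
    if A: "(A has_derivative A') (at u within V)" "A ` V \<subseteq> S"
      and R: "(R has_derivative R') (at (f u) within W)" "\<And>v. v \<in> V \<Longrightarrow> R (f v) = fderiv V f v (A v)" and v: "v \<in> S"
    for A A' v and R R' :: "'g \<Rightarrow> 'g"
  proof -
    obtain E where E: "((\<lambda>y. fderiv V f y (A y)) has_derivative E) (at u within V)"
      "\<And>v. v \<in> S \<Longrightarrow> E v = fderiv V (\<lambda>y. fderiv V f y (A u)) u v + fderiv V f u (A' v)"
      using fderiv_along_has_derivative[OF V f(1) u A] by blast
    have "((R \<circ> f) has_derivative (R' \<circ> fderiv V f u)) (at u within V)"
      by (rule diff_chain_within[OF smooth_on_has_derivative[OF f(1) u] has_derivative_subset[OF R(1) f(2)]])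
    then have "((\<lambda>y. fderiv V f y (A y)) has_derivative (R' \<circ> fderiv V f u)) (at u within V)"
      by (rule has_derivative_transform[OF u, rotated]) (simp add: R(2))
    from has_derivative_unique_on[OF V u this E(1) v] E(2)[OF v] show ?thesis by simp
  qed
  have Xu: "X u \<in> S" and Yu: "Y u \<in> S" using X(2) Y(2) u by auto
  interpret D: bounded_linear "fderiv V f u"
    using smooth_on_has_derivative[OF f(1) u] by (rule has_derivative_bounded_linear)
  show ?thesis
    using main[OF Y Q Xu] main[OF X Z Yu] Z(2)[OF u] Q(2)[OF u]
      smooth_on_second_fderiv_symmetric[OF V f(1) u Xu Yu]
    by (simp add: D.diff)
qed

text \<open>Differentiate \<open>X = a (P X)\<close> and \<open>Y = a (P Y)\<close>. All derivatives
  of the fields are collected in the first summand; what remains depends on the fields only through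
  their values at \<open>u\<close> and decides whether the bracket is tangent.\<close>

lemma bracket_defect:
  fixes a :: "'e::euclidean_space \<Rightarrow> ('e \<Rightarrow>\<^sub>L 'e)"
  assumes V: "relopen S V" and u: "u \<in> V" and a: "smooth_on S V a" and P: "bounded_linear P"
    and X: "(X has_derivative X') (at u within V)" "\<And>v. v \<in> V \<Longrightarrow> X v = a v (P (X v))" "X u \<in> S"
    and Y: "(Y has_derivative Y') (at u within V)" "\<And>v. v \<in> V \<Longrightarrow> Y v = a v (P (Y v))" "Y u \<in> S"
  shows "Y' (X u) - X' (Y u) = a u (P (Y' (X u) - X' (Y u))) +
    (fderiv V a u (X u) (P (Y u)) - fderiv V a u (Y u) (P (X u)))"
proof -
  interpret P: bounded_linear P by fact
  have main: "A' v = a u (P (A' v)) + fderiv V a u v (P (A u))"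
    if A: "(A has_derivative A') (at u within V)" "\<And>v. v \<in> V \<Longrightarrow> A v = a v (P (A v))" and v: "v \<in> S" for A A' v
  proof -
    have "((\<lambda>v. a v (P (A v))) has_derivative (\<lambda>v. a u (P (A' v)) + fderiv V a u v (P (A u)))) (at u within V)"
      by (rule blinfun.FDERIV[OF smooth_on_has_derivative[OF a u] P.has_derivative[OF A(1)]])
    then have "(A has_derivative (\<lambda>v. a u (P (A' v)) + fderiv V a u v (P (A u)))) (at u within V)"
      by (rule has_derivative_transform[OF u, rotated]) (rule A(2))
    from has_derivative_unique_on[OF V u A(1) this v] show ?thesis .
  qed
  have aux: "y - x = (y' - x') + (p - q)" if "y = y' + p" "x = x' + q" for x x' y y' p q :: 'e
    using that by simp
  show ?thesis
    unfolding P.diff blinfun.diff_right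
    by (rule aux[OF main[OF Y(1,2) X(3)] main[OF X(1,2) Y(3)]])
qed

text \<open>Differentiating the tangency condition in direction \<open>s\<close> writes the second
  derivative of \<open>f\<close> as its own image under \<open>a P\<close> plus
  \<open>Da (Df s) (P (Df t))\<close>. As the second derivative is symmetric in \<open>s\<close> and
  \<open>t\<close>, so is the additional term.\<close>

lemma integral_map_symmetric:
  fixes a :: "'e::euclidean_space \<Rightarrow> ('e \<Rightarrow>\<^sub>L 'e)" and f :: "'w::euclidean_space \<Rightarrow> 'e"
  assumes W: "relopen T W" and V: "relopen S V" and f: "smooth_on T W f" "f ` W \<subseteq> V" and a: "smooth_on S V a"
    and P: "bounded_linear P" and eq: "\<And>w t. w \<in> W \<Longrightarrow> t \<in> T \<Longrightarrow> a (f w) (P (fderiv W f w t)) = fderiv W f w t"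
    and w: "w \<in> W" and s: "s \<in> T" and t: "t \<in> T"
  shows "fderiv V a (f w) (fderiv W f w s) (P (fderiv W f w t)) = fderiv V a (f w) (fderiv W f w t) (P (fderiv W f w s))"
proof -
  interpret P: bounded_linear P by fact
  have main: "fderiv W (\<lambda>w. fderiv W f w t) w z
      = a (f w) (P (fderiv W (\<lambda>w. fderiv W f w t) w z)) + fderiv V a (f w) (fderiv W f w z) (P (fderiv W f w t))"
    if t: "t \<in> T" and z: "z \<in> T" for t z
  proof -
    let ?g = "\<lambda>w. fderiv W f w t"
    have g: "(?g has_derivative fderiv W ?g w) (at w within W)"
      by (rule smooth_on_has_derivative[OF smooth_on_fderiv[OF f(1) t] w])
    have fwV: "f w \<in> V" using f(2) w by auto
    have "((a \<circ> f) has_derivative (fderiv V a (f w) \<circ> fderiv W f w)) (at w within W)"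
      by (rule diff_chain_within[OF smooth_on_has_derivative[OF f(1) w]
          has_derivative_subset[OF smooth_on_has_derivative[OF a fwV] f(2)]])
    then have "((\<lambda>w. a (f w)) has_derivative (\<lambda>z. fderiv V a (f w) (fderiv W f w z))) (at w within W)"
      by (simp add: o_def)
    from blinfun.FDERIV[OF this P.has_derivative[OF g]]
    have "(?g has_derivative (\<lambda>z. a (f w) (P (fderiv W ?g w z)) + fderiv V a (f w) (fderiv W f w z) (P (?g w)))) (at w within W)"
      by (rule has_derivative_transform[OF w, rotated]) (simp add: eq t)
    from has_derivative_unique_on[OF W w g this z] show ?thesis .
  qed
  have "fderiv W (\<lambda>w. fderiv W f w t) w s = fderiv W (\<lambda>w. fderiv W f w s) w t"
    by (rule smooth_on_second_fderiv_symmetric[OF W f(1) w t s])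
  with main[OF t s] main[OF s t] show ?thesis by (metis add_left_cancel)
qed

declare split_paired_All [simp del] split_paired_Ex [simp del]

subsection \<open>Charts, parametrisations and tangent vectors\<close>

abbreviation cdom :: "('a, 'e) chart \<Rightarrow> 'e set" where
  "cdom c \<equiv> snd c ` fst c"

definition pdom :: "'e set \<Rightarrow> ('e \<Rightarrow> 'a) \<Rightarrow> ('a, 'e) chart \<Rightarrow> 'e set" where
  "pdom B g c = {w \<in> B. g w \<in> fst c}"

definition pd :: "'e::euclidean_space set \<Rightarrow> ('e \<Rightarrow> 'a) \<Rightarrow> ('a, 'e) chart \<Rightarrow> 'e \<Rightarrow> 'e \<Rightarrow> 'e" where
  "pd B g c w = fderiv (pdom B g c) (\<lambda>w. snd c (g w)) w"

text \<open>One notion for inverse charts of \<open>M\<close>, inverse charts of a submanifold seen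
  in \<open>M\<close>, and plaques: a smooth map into \<open>M\<close> from an open subset of a
  model space \<open>T\<close> of any dimension. Openness of all \<open>pdom\<close> stands for
  continuity (see \<open>param_continuous\<close>).\<close>

definition param :: "('a, 'e::euclidean_space) mfd \<Rightarrow> 'e set \<Rightarrow> 'e set \<Rightarrow> ('e \<Rightarrow> 'a) \<Rightarrow> bool" where
  "param M T B g \<longleftrightarrow> relopen T B \<and> g ` B \<subseteq> points M \<and>
     (\<forall>c\<in>atlas M. relopen T (pdom B g c) \<and> smooth_on T (pdom B g c) (\<lambda>w. snd c (g w)))"

text \<open>The velocity of \<open>g\<close> in direction \<open>t\<close>: the tangent map of a
  parametrisation, for a domain that is just an open set.\<close>

definition ptan :: "('a, 'e::euclidean_space) mfd \<Rightarrow> 'e set \<Rightarrow> ('e \<Rightarrow> 'a) \<Rightarrow> 'e \<Rightarrow> 'e \<Rightarrow> ('a, 'e) tvec" where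
  "ptan M B g w t = (\<lambda>c. if c \<in> charts_at M (g w) then pd B g c w t else 0)"

locale smooth_mfd =
  fixes M :: "('a, 'e::euclidean_space) mfd"
  assumes smooth_manifold: "smooth_manifold M"
begin

lemma subspace_model: "subspace (model M)"
  using smooth_manifold by (simp add: smooth_manifold_def)

lemma chart: "c \<in> atlas M \<Longrightarrow> is_chart (mtop M) (model M) c"
  using smooth_manifold by (simp add: smooth_manifold_def)

lemma chart_open: "c \<in> atlas M \<Longrightarrow> openin (mtop M) (fst c)"
  using chart by (simp add: is_chart_def)

lemma chart_subset: "c \<in> atlas M \<Longrightarrow> fst c \<subseteq> points M"
  using chart_open openin_subset by blast

lemma relopen_cdom: "c \<in> atlas M \<Longrightarrow> relopen (model M) (cdom c)"
  using chart subspace_model by (simp add: is_chart_def relopen_def)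

lemma topspace_chart: "c \<in> atlas M \<Longrightarrow> topspace (subtopology (mtop M) (fst c)) = fst c"
  using chart_subset by (simp add: Int_absorb1)

lemma chart_homeo:
  "c \<in> atlas M \<Longrightarrow> homeomorphic_map (subtopology (mtop M) (fst c)) (top_of_set (cdom c)) (snd c)"
  using chart by (simp add: is_chart_def)

lemma chart_inj: "c \<in> atlas M \<Longrightarrow> inj_on (snd c) (fst c)"
  using homeomorphic_imp_injective_map[OF chart_homeo] topspace_chart by metis

lemma chart_inv_left: "c \<in> atlas M \<Longrightarrow> x \<in> fst c \<Longrightarrow> chart_inv c (snd c x) = x"
  by (simp add: chart_inj)

lemma chart_inv_in: "u \<in> cdom c \<Longrightarrow> chart_inv c u \<in> fst c"
  by (rule inv_into_into)

lemma chart_inv_point: "c \<in> atlas M \<Longrightarrow> u \<in> cdom c \<Longrightarrow> chart_inv c u \<in> points M"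
  by (rule subsetD[OF chart_subset chart_inv_in])

lemma chart_inv_image:
  assumes c: "c \<in> atlas M"
  shows "{u \<in> cdom c. chart_inv c u \<in> U} = snd c ` (fst c \<inter> U)"
proof (intro equalityI subsetI)
  fix u assume "u \<in> {u \<in> cdom c. chart_inv c u \<in> U}"
  then have u: "u \<in> cdom c" "chart_inv c u \<in> U" by blast+
  have "snd c (chart_inv c u) \<in> snd c ` (fst c \<inter> U)"
    by (rule imageI) (use u(2) chart_inv_in[OF u(1)] in blast)
  then show "u \<in> snd c ` (fst c \<inter> U)" by (simp only: f_inv_into_f[OF u(1)])
next
  fix u assume "u \<in> snd c ` (fst c \<inter> U)"
  then obtain x where x: "x \<in> fst c" "x \<in> U" "u = snd c x" by blast
  then show "u \<in> {u \<in> cdom c. chart_inv c u \<in> U}" by (simp add: chart_inv_left[OF c])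
qed

lemma chart_inv_right: "u \<in> cdom c \<Longrightarrow> snd c (chart_inv c u) = u"
  by (rule f_inv_into_f)

lemma chart_image_open:
  assumes c: "c \<in> atlas M" and W: "openin (mtop M) W"
  shows "relopen (model M) (snd c ` (fst c \<inter> W))"
proof -
  have "openin (subtopology (mtop M) (fst c)) (fst c \<inter> W)"
    using W by (simp add: openin_subtopology_Int2)
  then have "openin (top_of_set (cdom c)) (snd c ` (fst c \<inter> W))"
    using homeomorphic_imp_open_map[OF chart_homeo[OF c]] by (simp add: open_map_def)
  then show ?thesis using relopen_cdom[OF c] unfolding relopen_def by (meson openin_trans)
qed

lemma chart_preimage_open:
  assumes c: "c \<in> atlas M" and V: "openin (top_of_set (model M)) V"
  shows "openin (mtop M) {x \<in> fst c. snd c x \<in> V}"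
proof -
  have "continuous_map (subtopology (mtop M) (fst c)) (top_of_set (cdom c)) (snd c)"
    using chart_homeo[OF c] by (rule homeomorphic_imp_continuous_map)
  moreover have "openin (top_of_set (cdom c)) (cdom c \<inter> V)"
  proof -
    have "cdom c \<subseteq> model M" using relopen_subset[OF relopen_cdom[OF c]] .
    then show ?thesis using V by (auto simp: openin_open)
  qed
  ultimately have "openin (subtopology (mtop M) (fst c)) {x \<in> topspace (subtopology (mtop M) (fst c)). snd c x \<in> cdom c \<inter> V}"
    by (rule openin_continuous_map_preimage)
  moreover have "{x \<in> topspace (subtopology (mtop M) (fst c)). snd c x \<in> cdom c \<inter> V} = {x \<in> fst c. snd c x \<in> V}"
    unfolding topspace_chart[OF c] by auto
  ultimately show ?thesis using chart_open[OF c] openin_trans_full by fastforce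
qed

lemma ex_chart: "x \<in> points M \<Longrightarrow> \<exists>c. c \<in> charts_at M x"
  using smooth_manifold unfolding smooth_manifold_def charts_at_def by blast

lemma openin_charts:
  assumes W: "W \<subseteq> points M" and op: "\<And>c. c \<in> atlas M \<Longrightarrow> relopen (model M) (snd c ` (fst c \<inter> W))"
  shows "openin (mtop M) W"
proof (subst openin_subopen, rule ballI)
  fix x assume x: "x \<in> W"
  then obtain c where c: "c \<in> atlas M" "x \<in> fst c" using ex_chart W unfolding charts_at_def by blast
  let ?O = "{y \<in> fst c. snd c y \<in> snd c ` (fst c \<inter> W)}"
  have "openin (mtop M) ?O" using chart_preimage_open[OF c(1)] op[OF c(1)] by (simp add: relopen_def)
  moreover have "?O \<subseteq> W" using chart_inj[OF c(1)] by (auto simp: inj_on_def)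
  moreover have "x \<in> ?O" using c x by auto
  ultimately show "\<exists>U. openin (mtop M) U \<and> x \<in> U \<and> U \<subseteq> W" by blast
qed

lemma chart_inv_continuous:
  assumes c: "c \<in> atlas M"
  shows "continuous_map (top_of_set (cdom c)) (mtop M) (chart_inv c)"
  unfolding continuous_map_def
proof (intro conjI allI impI)
  show "chart_inv c \<in> topspace (top_of_set (cdom c)) \<rightarrow> points M"
    unfolding topspace_euclidean_subtopology by (rule Pi_I) (rule chart_inv_point[OF c])
  fix U assume U: "openin (mtop M) U"
  have "{u \<in> topspace (top_of_set (cdom c)). chart_inv c u \<in> U} = snd c ` (fst c \<inter> U)"
    unfolding topspace_euclidean_subtopology by (rule chart_inv_image[OF c])
  moreover have "openin (top_of_set (cdom c)) (snd c ` (fst c \<inter> U))"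
    using chart_image_open[OF c U] relopen_cdom[OF c] unfolding relopen_def
    by (meson image_mono inf_le1 openin_imp_subset openin_subset_trans)
  ultimately show "openin (top_of_set (cdom c)) {u \<in> topspace (top_of_set (cdom c)). chart_inv c u \<in> U}" by simp
qed

lemma pdom_chart:
  assumes c: "c \<in> atlas M"
  shows "pdom (cdom c) (chart_inv c) d = snd c ` (fst c \<inter> fst d)"
  unfolding pdom_def by (rule chart_inv_image[OF c])

lemma chart_param:
  assumes c: "c \<in> atlas M"
  shows "param M (model M) (cdom c) (chart_inv c)"
  unfolding param_def pdom_chart[OF c]
proof (intro conjI ballI)
  show "chart_inv c ` cdom c \<subseteq> points M" by (rule image_subsetI) (rule chart_inv_point[OF c])
  show "relopen (model M) (cdom c)" by (rule relopen_cdom[OF c])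
  fix d assume d: "d \<in> atlas M"
  show "relopen (model M) (snd c ` (fst c \<inter> fst d))" by (rule chart_image_open[OF c chart_open[OF d]])
  show "smooth_on (model M) (snd c ` (fst c \<inter> fst d)) (\<lambda>w. snd d (chart_inv c w))"
    using smooth_manifold c d unfolding smooth_manifold_def o_def by blast
qed

lemma param_relopen: "param M T B g \<Longrightarrow> c \<in> atlas M \<Longrightarrow> relopen T (pdom B g c)"
  and param_smooth: "param M T B g \<Longrightarrow> c \<in> atlas M \<Longrightarrow> smooth_on T (pdom B g c) (\<lambda>w. snd c (g w))"
  and param_relopen_dom: "param M T B g \<Longrightarrow> relopen T B"
  and param_points: "param M T B g \<Longrightarrow> w \<in> B \<Longrightarrow> g w \<in> points M"
  by (auto simp: param_def)

lemma pd_has_derivative: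
  "param M T B g \<Longrightarrow> c \<in> atlas M \<Longrightarrow> w \<in> pdom B g c \<Longrightarrow>
    ((\<lambda>w. snd c (g w)) has_derivative pd B g c w) (at w within pdom B g c)"
  unfolding pd_def by (rule smooth_on_has_derivative[OF param_smooth])

lemma pdom_image: "(\<lambda>w. snd c (g w)) ` pdom B g c \<subseteq> cdom c"
  by (auto simp: pdom_def)

lemma pd_in:
  assumes g: "param M T B g" and c: "c \<in> atlas M" and w: "w \<in> pdom B g c" and t: "t \<in> T"
  shows "pd B g c w t \<in> model M"
  by (rule derivative_in_subspace[OF param_relopen[OF g c] w pd_has_derivative[OF g c w] _ subspace_model t])
    (use pdom_image[of c g B] relopen_subset[OF relopen_cdom[OF c]] in blast)

text \<open>The chain rule for \<open>g' = g o h\<close> near \<open>w\<close>. Change of chart, and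
  the independence of \<open>tangent_map\<close> from its chart, are the instances in which
  \<open>h\<close> is a coordinate expression.\<close>

lemma pd_reparam:
  assumes g: "param M T B g" and g': "param M T' B' g'" and A: "relopen T' A" "A \<subseteq> B'" "w \<in> A"
    and h: "(h has_derivative h') (at w within A)" "h ` A \<subseteq> B" and eq: "\<And>z. z \<in> A \<Longrightarrow> g' z = g (h z)"
    and d: "d \<in> atlas M" "g' w \<in> fst d" and t: "t \<in> T'"
  shows "pd B' g' d w t = pd B g d (h w) (h' t)"
proof -
  define A' where "A' = A \<inter> pdom B' g' d"
  have A': "relopen T' A'" unfolding A'_def by (rule relopen_Int[OF A(1) param_relopen[OF g' d(1)]])
  have w: "w \<in> A'" "w \<in> pdom B' g' d" using A d by (auto simp: A'_def pdom_def)
  have hw: "h ` A' \<subseteq> pdom B g d" using h(2) eq by (auto simp: A'_def pdom_def)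
  have "(((\<lambda>w. snd d (g w)) \<circ> h) has_derivative (pd B g d (h w) \<circ> h')) (at w within A')"
    by (rule diff_chain_within[OF has_derivative_subset[OF h(1)]
        has_derivative_subset[OF pd_has_derivative[OF g d(1)] hw]])
      (use w hw in \<open>auto simp: A'_def\<close>)
  then have 1: "((\<lambda>w. snd d (g' w)) has_derivative (pd B g d (h w) \<circ> h')) (at w within A')"
    by (rule has_derivative_transform[OF w(1), rotated]) (simp add: A'_def eq)
  have 2: "((\<lambda>w. snd d (g' w)) has_derivative pd B' g' d w) (at w within A')"
    by (rule has_derivative_subset[OF pd_has_derivative[OF g' d(1) w(2)]]) (simp add: A'_def)
  show ?thesis using has_derivative_unique_on[OF A' w(1) 2 1 t] by simp
qed

lemma pd_change:
  assumes g: "param M T B g" and c: "c \<in> atlas M" "g w \<in> fst c" and d: "d \<in> atlas M" "g w \<in> fst d"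
    and w: "w \<in> B" and t: "t \<in> T"
  shows "pd B g d w t = pd (cdom c) (chart_inv c) d (snd c (g w)) (pd B g c w t)"
proof (rule pd_reparam[OF chart_param[OF c(1)] g param_relopen[OF g c(1)] _ _
      pd_has_derivative[OF g c(1)] pdom_image _ d t])
  show "g z = chart_inv c (snd c (g z))" if "z \<in> pdom B g c" for z
    using chart_inv_left[OF c(1)] that by (simp add: pdom_def)
qed (use w c in \<open>auto simp: pdom_def\<close>)

lemma pd_chart_self:
  assumes c: "c \<in> atlas M" and u: "u \<in> cdom c" and v: "v \<in> model M"
  shows "pd (cdom c) (chart_inv c) c u v = v"
proof -
  have "pdom (cdom c) (chart_inv c) c = cdom c" by (simp add: pdom_chart[OF c])
  moreover have "((\<lambda>u. snd c (chart_inv c u)) has_derivative (\<lambda>v. v)) (at u within cdom c)"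
    by (rule has_derivative_transform[OF u _ has_derivative_ident]) (rule chart_inv_right)
  ultimately show ?thesis
    unfolding pd_def using frechet_within_unique[OF relopen_cdom[OF c] u _ v] by simp
qed

section \<open>Tangent vectors in charts\<close>

lemma ptan_in_tangent_space:
  assumes g: "param M T B g" and w: "w \<in> B" and t: "t \<in> T"
  shows "ptan M B g w t \<in> tangent_space M (g w)"
proof -
  have "ptan M B g w t c \<in> model M" if "c \<in> charts_at M (g w)" for c
    using pd_in[OF g _ _ t, of c w] that w by (simp add: ptan_def charts_at_def pdom_def)
  moreover have "ptan M B g w t d = frechet_derivative (snd d \<circ> chart_inv c)
      (at (snd c (g w)) within snd c ` (fst c \<inter> fst d)) (ptan M B g w t c)"
    if "c \<in> charts_at M (g w)" "d \<in> charts_at M (g w)" for c d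
    using pd_change[OF g _ _ _ _ w t, of c d] that
    by (simp add: ptan_def charts_at_def) (simp add: pd_def pdom_chart o_def)
  moreover have "ptan M B g w t c = 0" if "c \<notin> charts_at M (g w)" for c
    using that by (simp add: ptan_def)
  ultimately show ?thesis unfolding tangent_space_def by blast
qed

lemma tangent_change:
  assumes v: "v \<in> tangent_space M x" and c: "c \<in> charts_at M x" and d: "d \<in> charts_at M x"
  shows "v d = pd (cdom c) (chart_inv c) d (snd c x) (v c)"
proof -
  have "c \<in> atlas M" using c by (simp add: charts_at_def)
  moreover have "v d = frechet_derivative (snd d \<circ> chart_inv c) (at (snd c x) within snd c ` (fst c \<inter> fst d)) (v c)"
    using v c d unfolding tangent_space_def by blast
  ultimately show ?thesis unfolding pd_def by (simp only: pdom_chart o_def)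
qed

lemma tangent_in_model: "v \<in> tangent_space M x \<Longrightarrow> c \<in> charts_at M x \<Longrightarrow> v c \<in> model M"
  and tangent_outside: "v \<in> tangent_space M x \<Longrightarrow> c \<notin> charts_at M x \<Longrightarrow> v c = 0"
  unfolding tangent_space_def by blast+

lemma tangent_eqI:
  assumes "v \<in> tangent_space M x" "w \<in> tangent_space M x" "c \<in> charts_at M x" "v c = w c"
  shows "v = w"
proof
  fix d
  show "v d = w d"
  proof (cases "d \<in> charts_at M x")
    case True
    then show ?thesis using tangent_change[OF _ assms(3) True] assms by metis
  next
    case False
    then show ?thesis using tangent_outside assms(1,2) by metis
  qed
qed

lemma ex_tangent:
  assumes c: "c \<in> charts_at M x" and v: "v \<in> model M"
  obtains t where "t \<in> tangent_space M x" "t c = v"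
proof -
  have c': "c \<in> atlas M" "x \<in> fst c" using c by (auto simp: charts_at_def)
  have "ptan M (cdom c) (chart_inv c) (snd c x) v \<in> tangent_space M (chart_inv c (snd c x))"
    by (rule ptan_in_tangent_space[OF chart_param[OF c'(1)] _ v]) (use c' in auto)
  moreover have "ptan M (cdom c) (chart_inv c) (snd c x) v c = v"
    using pd_chart_self[OF c'(1) _ v, of "snd c x"] c c' by (simp add: ptan_def chart_inv_left)
  ultimately show thesis using that c' by (simp add: chart_inv_left)
qed

lemma vfield_chart:
  assumes X: "smooth_vfield_on M (points M) X" and c: "c \<in> atlas M"
  shows "smooth_on (model M) (cdom c) (\<lambda>u. X (chart_inv c u) c)"
    and "(\<lambda>u. X (chart_inv c u) c) ` cdom c \<subseteq> model M"
proof -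
  have "smooth_on (model M) (snd c ` (fst c \<inter> points M)) (\<lambda>u. X (chart_inv c u) c)"
    using X c unfolding smooth_vfield_on_def by blast
  moreover have "fst c \<inter> points M = fst c" using chart_subset[OF c] by blast
  ultimately show "smooth_on (model M) (cdom c) (\<lambda>u. X (chart_inv c u) c)" by simp
  show "(\<lambda>u. X (chart_inv c u) c) ` cdom c \<subseteq> model M"
  proof (rule image_subsetI)
    fix u assume u: "u \<in> cdom c"
    have "X (chart_inv c u) \<in> tangent_space M (chart_inv c u)"
      using X chart_inv_point[OF c u] unfolding smooth_vfield_on_def by blast
    moreover have "c \<in> charts_at M (chart_inv c u)" using c chart_inv_in[OF u] by (simp add: charts_at_def)
    ultimately show "X (chart_inv c u) c \<in> model M" by (rule tangent_in_model)
  qed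
qed

lemma param_chart_comp:
  assumes c: "c \<in> atlas M" and B: "relopen T B" and h: "smooth_on T B h" "h ` B \<subseteq> cdom c"
  shows "param M T B (\<lambda>w. chart_inv c (h w))"
  unfolding param_def
proof (intro conjI ballI)
  show "relopen T B" by fact
  show "(\<lambda>w. chart_inv c (h w)) ` B \<subseteq> points M"
    by (rule image_subsetI, rule chart_inv_point[OF c]) (use h(2) in auto)
  fix d assume d: "d \<in> atlas M"
  let ?A = "snd c ` (fst c \<inter> fst d)"
  have A: "relopen (model M) ?A" by (rule chart_image_open[OF c chart_open[OF d]])
  have eq: "pdom B (\<lambda>w. chart_inv c (h w)) d = {w \<in> B. h w \<in> ?A}"
    using h(2) pdom_chart[OF c, of d] by (auto simp: pdom_def)
  show *: "relopen T (pdom B (\<lambda>w. chart_inv c (h w)) d)"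
    unfolding eq using A relopen_subset[OF relopen_cdom[OF c]] h(2)
    by (intro relopen_preimage[OF B smooth_on_continuous[OF h(1)], of "model M"]) (auto simp: relopen_def)
  have "smooth_on T (pdom B (\<lambda>w. chart_inv c (h w)) d) h"
    by (rule smooth_on_open_subset[OF B * _ h(1)]) (auto simp: pdom_def)
  then show "smooth_on T (pdom B (\<lambda>w. chart_inv c (h w)) d) (\<lambda>w. snd d (chart_inv c (h w)))"
    by (intro smooth_on_comp[OF * A _ _ param_smooth[OF chart_param[OF c] d, unfolded pdom_chart[OF c]]])
      (auto simp: eq)
qed

end

subsection \<open>Submanifolds and distributions\<close>

lemma submanifold_param:
  assumes M: "smooth_manifold M" and N: "smooth_manifold N" and f: "smooth_map N M (\<lambda>x. x)" and c: "c \<in> atlas N"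
  shows "param M (model N) (cdom c) (chart_inv c)"
proof -
  interpret M: smooth_mfd M by unfold_locales (rule M)
  interpret N: smooth_mfd N by unfold_locales (rule N)
  have id: "continuous_map (mtop N) (mtop M) (\<lambda>x. x)" using f by (simp add: smooth_map_def)
  show ?thesis
    unfolding param_def N.pdom_chart[OF c]
  proof (intro conjI ballI)
    show "relopen (model N) (cdom c)" by (rule N.relopen_cdom[OF c])
    have "points N \<subseteq> points M" using id unfolding continuous_map_def by auto
    then show "chart_inv c ` cdom c \<subseteq> points M"
      using N.chart_inv_point[OF c] by (meson image_subsetI subsetD)
    fix d assume d: "d \<in> atlas M"
    have "openin (mtop N) {x \<in> points N. x \<in> fst d}"
      by (rule openin_continuous_map_preimage[OF id M.chart_open[OF d]])
    from N.chart_image_open[OF c this] have "relopen (model N) (snd c ` (fst c \<inter> {x \<in> points N. x \<in> fst d}))" .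
    moreover have "fst c \<inter> {x \<in> points N. x \<in> fst d} = fst c \<inter> fst d" using N.chart_subset[OF c] by blast
    ultimately show "relopen (model N) (snd c ` (fst c \<inter> fst d))" by simp
    have "smooth_on (model N) (rep_dom c d (\<lambda>x. x)) (rep c d (\<lambda>x. x))"
      using f c d unfolding smooth_map_def by blast
    moreover have "rep_dom c d (\<lambda>x. x) = snd c ` (fst c \<inter> fst d)" unfolding rep_dom_def by blast
    ultimately show "smooth_on (model N) (snd c ` (fst c \<inter> fst d)) (\<lambda>w. snd d (chart_inv c w))"
      by (simp add: rep_def o_def)
  qed
qed

text \<open>\<open>tangent_map\<close> evaluates in a chart \<open>b\<close> picked by choice. The
  transition from \<open>c\<close> to \<open>b\<close> is a reparametrisation, so
  \<open>pd_reparam\<close> replaces \<open>b\<close> by the given \<open>c\<close>.\<close>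

lemma tangent_map_eq_ptan:
  assumes M: "smooth_manifold M" and N: "smooth_manifold N" and f: "smooth_map N M (\<lambda>x. x)"
    and c: "c \<in> charts_at N x" and v: "v \<in> tangent_space N x"
  shows "tangent_map N M (\<lambda>x. x) x v = ptan M (cdom c) (chart_inv c) (snd c x) (v c)"
proof -
  interpret M: smooth_mfd M by unfold_locales (rule M)
  interpret N: smooth_mfd N by unfold_locales (rule N)
  define b where "b = (SOME c. c \<in> charts_at N x)"
  have b: "b \<in> charts_at N x" unfolding b_def by (rule someI) (rule c)
  have c': "c \<in> atlas N" "x \<in> fst c" and b': "b \<in> atlas N" "x \<in> fst b" using b c by (auto simp: charts_at_def)
  have rd: "rep_dom b d (\<lambda>x. x) = pdom (cdom b) (chart_inv b) d" for d :: "('a, 'b) chart"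
    unfolding N.pdom_chart[OF b'(1)] rep_dom_def by blast
  have inv: "chart_inv c (snd c x) = x" "chart_inv b (snd b x) = x"
    using N.chart_inv_left[OF c'] N.chart_inv_left[OF b'] .
  have "tangent_map N M (\<lambda>x. x) x v d = ptan M (cdom c) (chart_inv c) (snd c x) (v c) d" for d
  proof (cases "d \<in> charts_at M x")
    case True
    then have d: "d \<in> atlas M" "x \<in> fst d" by (auto simp: charts_at_def)
    let ?A = "snd c ` (fst c \<inter> fst b)"
    have pA: "pdom (cdom c) (chart_inv c) b = ?A" by (rule N.pdom_chart[OF c'(1)])
    have xA: "snd c x \<in> ?A" using c' b' by blast
    have hd: "((\<lambda>u. snd b (chart_inv c u)) has_derivative pd (cdom c) (chart_inv c) b (snd c x)) (at (snd c x) within ?A)"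
      using N.pd_has_derivative[OF N.chart_param[OF c'(1)] b'(1)] xA unfolding pA by blast
    have "pd (cdom c) (chart_inv c) d (snd c x) (v c) =
      pd (cdom b) (chart_inv b) d (snd b (chart_inv c (snd c x))) (pd (cdom c) (chart_inv c) b (snd c x) (v c))"
    proof (rule M.pd_reparam[OF submanifold_param[OF M N f b'(1)] submanifold_param[OF M N f c'(1)] _ _ xA hd _ _ d(1)])
      show "relopen (model N) ?A" by (rule N.chart_image_open[OF c'(1) N.chart_open[OF b'(1)]])
      show "(\<lambda>u. snd b (chart_inv c u)) ` ?A \<subseteq> cdom b" using N.chart_inv_left[OF c'(1)] by auto
      show "chart_inv c z = chart_inv b (snd b (chart_inv c z))" if "z \<in> ?A" for z
        using that N.chart_inv_left[OF c'(1)] N.chart_inv_left[OF b'(1)] by auto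
      show "chart_inv c (snd c x) \<in> fst d" using d inv by simp
      show "v c \<in> model N" by (rule N.tangent_in_model[OF v c])
    qed auto
    moreover have "v b = pd (cdom c) (chart_inv c) b (snd c x) (v c)" by (rule N.tangent_change[OF v c b])
    moreover have "tangent_map N M (\<lambda>x. x) x v d = pd (cdom b) (chart_inv b) d (snd b x) (v b)"
      using True unfolding tangent_map_def b_def[symmetric] Let_def pd_def rd by (simp add: rep_def o_def)
    ultimately show ?thesis using True by (simp add: ptan_def inv)
  next
    case False
    then show ?thesis unfolding tangent_map_def Let_def by (simp add: ptan_def inv)
  qed
  then show ?thesis by blast
qed

lemma sum_apply: "(\<Sum>i\<in>A. f i) c = (\<Sum>i\<in>A. f i c)"
  by (induction A rule: infinite_finite_induct) auto

lemma tv_span_image_sum: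
  fixes f :: "nat \<Rightarrow> 'c \<Rightarrow> 'e::real_vector"
  assumes "v \<in> tv.span (f ` {..<m})"
  obtains r where "v = (\<Sum>i<m. tscale (r i) (f i))"
proof -
  let ?R = "range (\<lambda>r. \<Sum>i<m. tscale (r i) (f i))"
  have "tv.subspace ?R"
  proof (rule tv.subspaceI)
    have "0 = (\<Sum>i<m. tscale ((\<lambda>i. 0) i) (f i))" by simp
    then show "0 \<in> ?R" by (rule range_eqI[where x = "\<lambda>i. 0"])
    fix x y assume "x \<in> ?R" "y \<in> ?R"
    then obtain r s where "x = (\<Sum>i<m. tscale (r i) (f i))" "y = (\<Sum>i<m. tscale (s i) (f i))" by blast
    then have "x + y = (\<Sum>i<m. tscale ((\<lambda>i. r i + s i) i) (f i))"
      by (simp add: tv.scale_left_distrib sum.distrib)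
    then show "x + y \<in> ?R" by (rule range_eqI[where x = "\<lambda>i. r i + s i"])
  next
    fix k x assume "x \<in> ?R"
    then obtain r where "x = (\<Sum>i<m. tscale (r i) (f i))" by blast
    then have "tscale k x = (\<Sum>i<m. tscale ((\<lambda>i. k * r i) i) (f i))"
      by (simp add: tv.scale_sum_right)
    then show "tscale k x \<in> ?R" by (rule range_eqI[where x = "\<lambda>i. k * r i"])
  qed
  moreover have "f ` {..<m} \<subseteq> ?R"
  proof (rule image_subsetI)
    fix j assume j: "j \<in> {..<m}"
    have "(\<Sum>i<m. tscale (if i = j then 1 else 0) (f i)) = (\<Sum>i<m. if i = j then f j else 0)"
      by (rule sum.cong) auto
    then have "f j = (\<Sum>i<m. tscale ((\<lambda>i. if i = j then 1 else 0) i) (f i))" using j by simp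
    then show "f j \<in> ?R" by (rule range_eqI[where x = "\<lambda>i. if i = j then 1 else 0"])
  qed
  ultimately have "tv.span (f ` {..<m}) \<subseteq> ?R" by (rule tv.span_minimal[rotated])
  then show thesis using assms that by blast
qed

text \<open>\<open>L\<close> is a fixed copy of \<open>m\<close>-dimensional space inside the
  ambient type: the parameter space of all plaques and the model of their union.\<close>

locale distribution_on = smooth_mfd M for M :: "('a, 'e::euclidean_space) mfd" +
  fixes D :: "('a, 'e) distribution" and m :: nat and L :: "'e set"
  assumes distribution: "tangent_distribution M m D" and L: "subspace L" "dim L = m"
begin

lemma D_subspace: "x \<in> points M \<Longrightarrow> tv.subspace (D x)"
  and D_tangent: "x \<in> points M \<Longrightarrow> D x \<subseteq> tangent_space M x"
  and D_dim: "x \<in> points M \<Longrightarrow> tv.dim (D x) = m"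
  using distribution unfolding tangent_distribution_def by blast+

section \<open>The local form of a distribution\<close>

lemma frame:
  assumes "x \<in> points M"
  obtains W X where "openin (mtop M) W" "x \<in> W" "\<And>i. i < m \<Longrightarrow> smooth_vfield_on M W (X i)"
    "\<And>y. y \<in> W \<Longrightarrow> D y = tv.span ((\<lambda>i. X i y) ` {..<m})"
proof -
  have "\<forall>x\<in>points M. \<exists>W X. openin (mtop M) W \<and> x \<in> W \<and> (\<forall>i<m. smooth_vfield_on M W (X i)) \<and>
      (\<forall>y\<in>W. D y = tv.span ((\<lambda>i. X i y) ` {..<m}))"
    using distribution unfolding tangent_distribution_def by (rule conjunct2)
  from bspec[OF this assms] show thesis using that by (elim exE conjE) blast
qed

text \<open>Tangency of a parametrised map, the form in which submanifolds of any dimension and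
  plaques enter the uniqueness argument alike.\<close>

definition Dparam :: "'e set \<Rightarrow> 'e set \<Rightarrow> ('e \<Rightarrow> 'a) \<Rightarrow> bool" where
  "Dparam T B g \<longleftrightarrow> param M T B g \<and> (\<forall>w\<in>B. \<forall>t\<in>T. ptan M B g w t \<in> D (g w))"

text \<open>The local form of the distribution in the chart \<open>c\<close>. The operators
  \<open>a u\<close> act on the whole ambient type; off \<open>L\<close> they are pinned by
  factoring through \<open>proj L\<close>.\<close>

definition adapted :: "('a, 'e) chart \<Rightarrow> 'e set \<Rightarrow> ('e \<Rightarrow> 'e) \<Rightarrow> ('e \<Rightarrow> ('e \<Rightarrow>\<^sub>L 'e)) \<Rightarrow> bool" where
  "adapted c V P a \<longleftrightarrow> c \<in> atlas M \<and> relopen (model M) V \<and> V \<subseteq> cdom c \<and> bounded_linear P \<and> range P \<subseteq> L \<and>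
     smooth_on (model M) V a \<and> (\<forall>u\<in>V. (\<lambda>v. v c) ` D (chart_inv c u) = blinfun_apply (a u) ` L) \<and>
     (\<forall>u\<in>V. \<forall>s. P (a u s) = proj L s \<and> a u s = a u (proj L s))"

text \<open>A relation between the components in the single chart \<open>c\<close> is one between
  tangent vectors, since these are determined by one component. It would make one of the
  \<open>m\<close> spanning vectors redundant, against \<open>tv.dim (D x) = m\<close>.\<close>

lemma frame_independent:
  assumes x: "x \<in> points M" and c: "c \<in> charts_at M x" and D: "D x = tv.span (X ` {..<m})"
    and r: "(\<Sum>i<m. r i *\<^sub>R X i c) = 0"
  shows "\<forall>i<m. r i = (0::real)"
proof (rule ccontr)
  assume "\<not> (\<forall>i<m. r i = 0)"
  then obtain j where j: "j < m" "r j \<noteq> 0" by blast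
  have X: "X i \<in> D x" if "i < m" for i unfolding D by (rule tv.span_base) (use that in blast)
  define v where "v = (\<Sum>i<m. tscale (r i) (X i))"
  have vD: "v \<in> D x" unfolding v_def
    by (intro tv.subspace_sum tv.subspace_scale D_subspace[OF x] X) auto
  have "v c = (\<Sum>i<m. r i *\<^sub>R X i c)" by (simp add: v_def tscale_def sum_apply)
  then have "v c = (0 :: ('a, 'e) tvec) c" using r by simp
  moreover have "0 \<in> D x" by (rule tv.subspace_0[OF D_subspace[OF x]])
  ultimately have v0: "v = 0" using tangent_eqI[OF _ _ c] vD D_tangent[OF x] by blast
  have "v = tscale (r j) (X j) + (\<Sum>i\<in>{..<m} - {j}. tscale (r i) (X i))"
    unfolding v_def using j by (intro sum.remove) auto
  then have "tscale (r j) (X j) = - (\<Sum>i\<in>{..<m} - {j}. tscale (r i) (X i))"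
    using v0 by (simp add: eq_neg_iff_add_eq_0)
  moreover have "- (\<Sum>i\<in>{..<m} - {j}. tscale (r i) (X i)) \<in> tv.span (X ` ({..<m} - {j}))"
    by (intro tv.span_neg tv.span_sum tv.span_scale tv.span_base imageI)
  ultimately have "tscale (1 / r j) (tscale (r j) (X j)) \<in> tv.span (X ` ({..<m} - {j}))"
    by (simp only: tv.span_scale)
  then have "X j \<in> tv.span (X ` ({..<m} - {j}))" using j by simp
  then have "X i \<in> tv.span (X ` ({..<m} - {j}))" if "i < m" for i
    using that by (cases "i = j") (auto intro: tv.span_base)
  then have "X ` {..<m} \<subseteq> tv.span (X ` ({..<m} - {j}))" by blast
  then have "D x \<subseteq> tv.span (X ` ({..<m} - {j}))" unfolding D by (simp add: tv.span_minimal)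
  then have "tv.dim (D x) \<le> card (X ` ({..<m} - {j}))" by (intro tv.dim_le_card) auto
  also have "\<dots> \<le> card ({..<m} - {j})" by (rule card_image_le) simp
  also have "\<dots> < m" using j by simp
  finally show False using D_dim[OF x] by simp
qed

lemma eval_span: "(\<lambda>v. v c) ` tv.span A = span ((\<lambda>v. v c) ` A)" for A :: "('a, 'e) tvec set"
proof -
  have "module_hom (tscale :: real \<Rightarrow> ('a, 'e) tvec \<Rightarrow> ('a, 'e) tvec) scaleR (\<lambda>v. v c)"
    by unfold_locales (auto simp: tscale_def algebra_simps)
  from module_hom.span_image[OF this, of A] show ?thesis by (simp add: span_raw_def)
qed

lemma adapted_exists:
  assumes x: "x \<in> points M" and c: "c \<in> charts_at M x"
  obtains V P a where "adapted c V P a" "snd c x \<in> V"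
proof -
  have c': "c \<in> atlas M" "x \<in> fst c" using c by (auto simp: charts_at_def)
  obtain W X where W: "openin (mtop M) W" "x \<in> W" and X: "\<And>i. i < m \<Longrightarrow> smooth_vfield_on M W (X i)"
    and DX: "\<And>y. y \<in> W \<Longrightarrow> D y = tv.span ((\<lambda>i. X i y) ` {..<m})" using frame[OF x] by blast
  define \<xi> where "\<xi> = (\<lambda>i u. X i (chart_inv c u) c)"
  have V0: "relopen (model M) (snd c ` (fst c \<inter> W))" by (rule chart_image_open[OF c'(1) W(1)])
  have \<xi>: "smooth_on (model M) (snd c ` (fst c \<inter> W)) (\<xi> i)" if "i < m" for i
    unfolding \<xi>_def using X[OF that] c' unfolding smooth_vfield_on_def by blast
  have xV: "snd c x \<in> snd c ` (fst c \<inter> W)" using W c' by blast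
  have indep: "\<forall>i<m. r i = 0" if "(\<Sum>i<m. r i *\<^sub>R \<xi> i (snd c x)) = 0" for r
    by (rule frame_independent[OF x c DX[OF W(2)]]) (use that in \<open>simp add: \<xi>_def chart_inv_left[OF c']\<close>)
  obtain V P and a :: "'e \<Rightarrow> ('e \<Rightarrow>\<^sub>L 'e)" where V: "relopen (model M) V" "snd c x \<in> V" "V \<subseteq> snd c ` (fst c \<inter> W)"
    and P: "bounded_linear P" "range P \<subseteq> L" and a: "smooth_on (model M) V a"
    "\<And>u. u \<in> V \<Longrightarrow> blinfun_apply (a u) ` L = span ((\<lambda>i. \<xi> i u) ` {..<m})"
    "\<And>u s. u \<in> V \<Longrightarrow> P (a u s) = proj L s" "\<And>u s. u \<in> V \<Longrightarrow> a u s = a u (proj L s)"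
  proof (rule normalised_frame[of "model M" "snd c ` (fst c \<inter> W)" "snd c x" m \<xi> L, OF V0 xV])
    show "smooth_on (model M) (snd c ` (fst c \<inter> W)) (\<xi> i)" if "i < m" for i by (rule \<xi>[OF that])
    show "\<forall>i<m. r i = 0" if "(\<Sum>i<m. r i *\<^sub>R \<xi> i (snd c x)) = 0" for r by (rule indep[OF that])
  qed (rule L(1), rule L(2), (rule that; assumption))
  have "(\<lambda>v. v c) ` D (chart_inv c u) = blinfun_apply (a u) ` L" if u: "u \<in> V" for u
  proof -
    have "chart_inv c u \<in> W" using u V(3) chart_inv_left[OF c'(1)] by auto
    then show ?thesis by (simp only: DX eval_span a(2)[OF u] image_image \<xi>_def)
  qed
  moreover have "V \<subseteq> cdom c" using V(3) by blast
  ultimately have "adapted c V P a" unfolding adapted_def using c' V P a(1,3,4) by blast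
  then show thesis using V(2) that by blast
qed

lemma adapted_param:
  assumes "adapted c V P a"
  shows "c \<in> atlas M" "relopen (model M) V" "V \<subseteq> cdom c" "bounded_linear P" "smooth_on (model M) V a" "P x \<in> L"
  using assms unfolding adapted_def by auto

lemma adapted_point: "adapted c V P a \<Longrightarrow> u \<in> V \<Longrightarrow> chart_inv c u \<in> points M"
  using chart_inv_point unfolding adapted_def by blast

lemma adapted_retract:
  assumes "adapted c V P a" "u \<in> V"
  shows "P (a u s) = proj L s" "a u (proj L s) = a u s"
  using assms unfolding adapted_def by metis+

lemma adapted_apply:
  assumes ad: "adapted c V P a" and u: "u \<in> V" and v: "v \<in> D (chart_inv c u)"
  shows "a u (P (v c)) = v c"
proof -
  obtain s where s: "s \<in> L" "v c = a u s" using ad u v unfolding adapted_def by blast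
  then show ?thesis using adapted_retract(1)[OF ad u] proj_id[OF L(1)] by simp
qed

lemma adapted_vector:
  assumes ad: "adapted c V P a" and u: "u \<in> V"
  obtains v where "v \<in> D (chart_inv c u)" "v c = a u s"
proof -
  have "a u (proj L s) \<in> (\<lambda>v. v c) ` D (chart_inv c u)"
    using ad u proj_in[OF L(1)] unfolding adapted_def by blast
  then show thesis using that adapted_retract(2)[OF ad u] by force
qed

lemma adapted_in_model:
  assumes ad: "adapted c V P a" and u: "u \<in> V"
  shows "a u s \<in> model M"
proof -
  obtain v where v: "v \<in> D (chart_inv c u)" "v c = a u s" using adapted_vector[OF ad u] by blast
  have "c \<in> charts_at M (chart_inv c u)"
    using adapted_param(1)[OF ad] chart_inv_in[OF subsetD[OF adapted_param(3)[OF ad] u]] by (simp add: charts_at_def)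
  from tangent_in_model[OF subsetD[OF D_tangent[OF adapted_point[OF ad u]] v(1)] this] show ?thesis
    using v(2) by simp
qed

text \<open>The two sides differ by the bracket at \<open>u\<close> of the local fields
  \<open>a(.) s\<close> and \<open>a(.) t\<close>; the condition says that these commute
  there.\<close>

definition integrable_at :: "'e set \<Rightarrow> ('e \<Rightarrow> ('e \<Rightarrow>\<^sub>L 'e)) \<Rightarrow> 'e \<Rightarrow> bool" where
  "integrable_at V a u \<longleftrightarrow> (\<forall>s t. fderiv V a u (a u s) t = fderiv V a u (a u t) s)"

text \<open>Along directions of the model space the derivative of \<open>a\<close> inherits
  \<open>a u t = a u (proj L t)\<close>, so testing on \<open>L\<close> is enough.\<close>

lemma integrable_atI:
  assumes ad: "adapted c V P a" and u: "u \<in> V"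
    and eq: "\<And>s t. s \<in> L \<Longrightarrow> t \<in> L \<Longrightarrow> fderiv V a u (a u s) t = fderiv V a u (a u t) s"
  shows "integrable_at V a u"
proof -
  note V = adapted_param(2)[OF ad] and a = adapted_param(5)[OF ad]
  have *: "fderiv V a u v t = fderiv V a u v (proj L t)" if v: "v \<in> model M" for v t
  proof -
    have d: "((\<lambda>u. a u t) has_derivative (\<lambda>v. fderiv V a u v t)) (at u within V)" for t
      by (rule bounded_linear.has_derivative[OF blinfun.bounded_linear_left smooth_on_has_derivative[OF a u]])
    have "((\<lambda>u. a u t) has_derivative (\<lambda>v. fderiv V a u v (proj L t))) (at u within V)"
      by (rule has_derivative_transform[OF u _ d]) (simp add: adapted_retract(2)[OF ad])
    from has_derivative_unique_on[OF V u d this v] show ?thesis .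
  qed
  have "fderiv V a u (a u s) t = fderiv V a u (a u t) s" for s t
    using eq[OF proj_in[OF L(1), of s] proj_in[OF L(1), of t]] adapted_in_model[OF ad u] *
    by (metis adapted_retract(2)[OF ad u])
  then show ?thesis by (simp add: integrable_at_def)
qed

section \<open>Lie brackets of fields in the distribution\<close>

lemma vfield_has_derivative:
  assumes ad: "adapted c V P a" and u: "u \<in> V" and X: "vfield_in M D X"
  shows "((\<lambda>u. X (chart_inv c u) c) has_derivative fderiv (cdom c) (\<lambda>u. X (chart_inv c u) c) u) (at u within V)"
    and "X (chart_inv c u) c = a u (P (X (chart_inv c u) c))"
    and "X (chart_inv c u) c \<in> model M"
proof -
  note c = adapted_param(1)[OF ad]
  have s: "smooth_on (model M) (cdom c) (\<lambda>u. X (chart_inv c u) c)"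
    using X c unfolding vfield_in_def by (intro vfield_chart) auto
  show "((\<lambda>u. X (chart_inv c u) c) has_derivative fderiv (cdom c) (\<lambda>u. X (chart_inv c u) c) u) (at u within V)"
    by (rule has_derivative_subset[OF smooth_on_has_derivative[OF s]]) (use adapted_param(3)[OF ad] u in auto)
  have XD: "X (chart_inv c u) \<in> D (chart_inv c u)"
    using X adapted_point[OF ad u] unfolding vfield_in_def by blast
  then show "X (chart_inv c u) c = a u (P (X (chart_inv c u) c))"
    using adapted_apply[OF ad u] by simp
  then show "X (chart_inv c u) c \<in> model M" using adapted_in_model[OF ad u] by metis
qed

lemma lie_bracket_adapted:
  assumes ad: "adapted c V P a" and u: "u \<in> V" and X: "vfield_in M D X" and Y: "vfield_in M D Y"
  shows "lie_bracket M X Y (chart_inv c u) c = a u (P (lie_bracket M X Y (chart_inv c u) c)) +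
    (fderiv V a u (X (chart_inv c u) c) (P (Y (chart_inv c u) c)) - fderiv V a u (Y (chart_inv c u) c) (P (X (chart_inv c u) c)))"
proof -
  have uc: "u \<in> cdom c" using adapted_param(3)[OF ad] u by blast
  have "c \<in> charts_at M (chart_inv c u)" using adapted_param(1)[OF ad] chart_inv_in[OF uc] by (simp add: charts_at_def)
  then have "lie_bracket M X Y (chart_inv c u) c =
      fderiv (cdom c) (\<lambda>u. Y (chart_inv c u) c) u (X (chart_inv c u) c) -
      fderiv (cdom c) (\<lambda>u. X (chart_inv c u) c) u (Y (chart_inv c u) c)"
    unfolding lie_bracket_def using uc by (simp add: chart_inv_right)
  then show ?thesis
    using bracket_defect[OF adapted_param(2)[OF ad] u adapted_param(5,4)[OF ad]
      vfield_has_derivative(1)[OF ad u X] vfield_has_derivative(2)[OF ad _ X] vfield_has_derivative(3)[OF ad u X]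
      vfield_has_derivative(1)[OF ad u Y] vfield_has_derivative(2)[OF ad _ Y] vfield_has_derivative(3)[OF ad u Y]]
    by metis
qed

text \<open>This is \<open>bracket_natural\<close> for the transition map from \<open>c\<close> to
  \<open>d\<close>, whose derivative relates the components of each field in the two charts. It
  makes the family of coordinate brackets a tangent vector.\<close>

lemma lie_bracket_tangent:
  assumes x: "x \<in> points M" and X: "vfield_in M D X" and Y: "vfield_in M D Y"
    and c: "c \<in> charts_at M x" and d: "d \<in> charts_at M x"
  shows "lie_bracket M X Y x d = pd (cdom c) (chart_inv c) d (snd c x) (lie_bracket M X Y x c)"
proof -
  have c': "c \<in> atlas M" "x \<in> fst c" and d': "d \<in> atlas M" "x \<in> fst d" using c d by (auto simp: charts_at_def)
  let ?A = "snd c ` (fst c \<inter> fst d)"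
  have A: "relopen (model M) ?A" by (rule chart_image_open[OF c'(1) chart_open[OF d'(1)]])
  have pA: "pdom (cdom c) (chart_inv c) d = ?A" by (rule pdom_chart[OF c'(1)])
  let ?f = "\<lambda>u. snd d (chart_inv c u)"
  have f: "smooth_on (model M) ?A ?f" using param_smooth[OF chart_param[OF c'(1)] d'(1)] unfolding pA .
  have fA: "?f ` ?A \<subseteq> cdom d" using chart_inv_left[OF c'(1)] by auto
  have xA: "snd c x \<in> ?A" using c' d' by blast
  have xx: "?f (snd c x) = snd d x" using chart_inv_left[OF c'] by simp
  note fields = vfield_in_def[THEN iffD1, THEN conjunct1, THEN vfield_chart(1)] vfield_in_def[THEN iffD1, THEN conjunct1, THEN vfield_chart(2)]
  have xc: "snd c x \<in> cdom c" and xd: "snd d x \<in> cdom d" using c' d' by auto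
  have der_c: "((\<lambda>u. Z (chart_inv c u) c) has_derivative fderiv (cdom c) (\<lambda>u. Z (chart_inv c u) c) (snd c x)) (at (snd c x) within ?A)"
    and sub_c: "(\<lambda>u. Z (chart_inv c u) c) ` ?A \<subseteq> model M"
    and der_d: "((\<lambda>u. Z (chart_inv d u) d) has_derivative fderiv (cdom d) (\<lambda>u. Z (chart_inv d u) d) (snd d x)) (at (?f (snd c x)) within cdom d)"
    and rel: "\<And>u. u \<in> ?A \<Longrightarrow> Z (chart_inv d (?f u)) d = fderiv ?A ?f u (Z (chart_inv c u) c)"
    if Z: "vfield_in M D Z" for Z
  proof -
    show "((\<lambda>u. Z (chart_inv c u) c) has_derivative fderiv (cdom c) (\<lambda>u. Z (chart_inv c u) c) (snd c x)) (at (snd c x) within ?A)"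
      by (rule has_derivative_subset[OF smooth_on_has_derivative[OF fields(1)[OF Z c'(1)] xc]]) auto
    show "(\<lambda>u. Z (chart_inv c u) c) ` ?A \<subseteq> model M"
      by (rule order_trans[OF image_mono fields(2)[OF Z c'(1)]]) auto
    show "((\<lambda>u. Z (chart_inv d u) d) has_derivative fderiv (cdom d) (\<lambda>u. Z (chart_inv d u) d) (snd d x)) (at (?f (snd c x)) within cdom d)"
      unfolding xx by (rule smooth_on_has_derivative[OF fields(1)[OF Z d'(1)] xd])
    fix u assume "u \<in> ?A"
    then obtain y where y: "y \<in> fst c" "y \<in> fst d" "u = snd c y" by blast
    have "Z y \<in> tangent_space M y"
      using Z chart_subset[OF c'(1)] y unfolding vfield_in_def smooth_vfield_on_def by blast
    from tangent_change[OF this, of c d] y c' d' have "Z y d = pd (cdom c) (chart_inv c) d u (Z y c)"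
      by (simp add: charts_at_def)
    then show "Z (chart_inv d (?f u)) d = fderiv ?A ?f u (Z (chart_inv c u) c)"
      using y chart_inv_left[OF c'(1) y(1)] chart_inv_left[OF d'(1) y(2)] by (simp add: pd_def pA)
  qed
  have lb: "lie_bracket M X Y x e = fderiv (cdom e) (\<lambda>u. Y (chart_inv e u) e) (snd e x) (X (chart_inv e (snd e x)) e) -
      fderiv (cdom e) (\<lambda>u. X (chart_inv e u) e) (snd e x) (Y (chart_inv e (snd e x)) e)" if "e \<in> charts_at M x" for e
  proof -
    have "chart_inv e (snd e x) = x" using that by (auto simp: charts_at_def intro: chart_inv_left)
    then show ?thesis using that by (simp add: lie_bracket_def)
  qed
  show ?thesis
    unfolding lb[OF c] lb[OF d] pd_def pA
    using bracket_natural[OF A relopen_cdom[OF d'(1)] f fA xA der_c[OF X] sub_c[OF X] der_c[OF Y] sub_c[OF Y]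
        der_d[OF X] rel[OF X] der_d[OF Y] rel[OF Y]]
    unfolding xx .
qed

text \<open>At an integrable point the defect term vanishes, so in one chart the bracket coincides
  with some \<open>v\<close> in \<open>D x\<close>; the transformation law extends this to all
  charts. Smoothness is read off from the coordinate formula.\<close>

lemma integrable_imp_closed:
  assumes int: "\<And>x. x \<in> points M \<Longrightarrow> \<exists>c V P a. adapted c V P a \<and> c \<in> charts_at M x \<and> snd c x \<in> V \<and> integrable_at V a (snd c x)"
  shows "closed_under_bracket M D"
  unfolding closed_under_bracket_def
proof (intro allI impI)
  fix X Y assume X: "vfield_in M D X" and Y: "vfield_in M D Y"
  have inD: "lie_bracket M X Y x \<in> D x" if x: "x \<in> points M" for x
  proof -
    obtain c V P a where ad: "adapted c V P a" and c: "c \<in> charts_at M x" and xV: "snd c x \<in> V"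
      and i: "integrable_at V a (snd c x)" using int[OF x] by blast
    have c': "c \<in> atlas M" "x \<in> fst c" using c by (auto simp: charts_at_def)
    have xx: "chart_inv c (snd c x) = x" by (rule chart_inv_left[OF c'])
    have XY: "X x c = a (snd c x) (P (X x c))" "Y x c = a (snd c x) (P (Y x c))"
      using vfield_has_derivative(2)[OF ad xV X] vfield_has_derivative(2)[OF ad xV Y] unfolding xx .
    have "lie_bracket M X Y x c = a (snd c x) (P (lie_bracket M X Y x c))"
      using lie_bracket_adapted[OF ad xV X Y] i XY unfolding xx integrable_at_def by (metis add.right_neutral diff_self)
    then obtain v where v: "v \<in> D x" "v c = lie_bracket M X Y x c"
      using adapted_vector[OF ad xV] unfolding xx by metis
    have "lie_bracket M X Y x d = v d" for d
    proof (cases "d \<in> charts_at M x")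
      case True
      have "v \<in> tangent_space M x" using v(1) D_tangent[OF x] by blast
      from tangent_change[OF this c True] lie_bracket_tangent[OF x X Y c True] v(2) show ?thesis by simp
    next
      case False
      have "v \<in> tangent_space M x" using v(1) D_tangent[OF x] by blast
      then show ?thesis using tangent_outside False by (simp add: lie_bracket_def)
    qed
    then have "lie_bracket M X Y x = v" by blast
    then show ?thesis using v by simp
  qed
  have "smooth_on (model M) (snd c ` (fst c \<inter> points M)) (\<lambda>u. lie_bracket M X Y (chart_inv c u) c)" if c: "c \<in> atlas M" for c
  proof -
    have eq: "fst c \<inter> points M = fst c" using chart_subset[OF c] by blast
    have sm: "smooth_on (model M) (cdom c) (\<lambda>u. Z (chart_inv c u) c)" "(\<lambda>u. Z (chart_inv c u) c) ` cdom c \<subseteq> model M"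
      if "vfield_in M D Z" for Z
      using vfield_chart[OF _ c, of Z] that unfolding vfield_in_def by blast+
    have "smooth_on (model M) (cdom c) (\<lambda>u. fderiv (cdom c) (\<lambda>u. Y (chart_inv c u) c) u (X (chart_inv c u) c)
        - fderiv (cdom c) (\<lambda>u. X (chart_inv c u) c) u (Y (chart_inv c u) c))"
      by (rule smooth_on_minus[OF relopen_cdom[OF c]];
          rule smooth_on_fderiv_along[OF relopen_cdom[OF c]]) (rule sm X Y)+
    moreover have "lie_bracket M X Y (chart_inv c u) c = fderiv (cdom c) (\<lambda>u. Y (chart_inv c u) c) u (X (chart_inv c u) c)
        - fderiv (cdom c) (\<lambda>u. X (chart_inv c u) c) u (Y (chart_inv c u) c)" if u: "u \<in> cdom c" for u
      using c chart_inv_in[OF u] by (simp add: lie_bracket_def charts_at_def chart_inv_right[OF u])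
    ultimately show ?thesis unfolding eq by (simp cong: smooth_on_cong)
  qed
  then have "smooth_vfield_on M (points M) (lie_bracket M X Y)"
    unfolding smooth_vfield_on_def using inD D_tangent by blast
  then show "vfield_in M D (lie_bracket M X Y)" unfolding vfield_in_def using inD by blast
qed

text \<open>Closure under brackets speaks about global fields, so a vector of \<open>D x\<close> has
  to be extended to all of \<open>M\<close>: a local combination of the frame is cut off by a bump
  function.\<close>

lemma global_field:
  assumes x: "x \<in> points M" and v: "v \<in> D x"
  obtains Z where "vfield_in M D Z" "Z x = v"
proof -
  obtain c where c: "c \<in> charts_at M x" using ex_chart[OF x] by blast
  then have c': "c \<in> atlas M" "x \<in> fst c" by (auto simp: charts_at_def)
  obtain W X where W: "openin (mtop M) W" "x \<in> W" and X: "\<And>i. i < m \<Longrightarrow> smooth_vfield_on M W (X i)"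
    and DX: "\<And>y. y \<in> W \<Longrightarrow> D y = tv.span ((\<lambda>i. X i y) ` {..<m})" using frame[OF x] by blast
  obtain r where r: "v = (\<Sum>i<m. tscale (r i) (X i x))"
    using tv_span_image_sum[of v "\<lambda>i. X i x" m] v DX[OF W(2)] by blast
  define p where "p = snd c x"
  define V where "V = snd c ` (fst c \<inter> W)"
  have V: "relopen (model M) V" unfolding V_def by (rule chart_image_open[OF c'(1) W(1)])
  have pV: "p \<in> V" unfolding p_def V_def using c' W by blast
  obtain \<rho> where \<rho>: "\<rho> > 0" "cball p \<rho> \<inter> model M \<subseteq> V"
    using V pV unfolding relopen_def openin_contains_cball by blast
  obtain \<phi> :: "'e \<Rightarrow> real" where \<phi>: "\<And>S V. relopen S V \<Longrightarrow> smooth_on S V \<phi>" "\<phi> p = 1"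
    "\<And>u. dist p u \<ge> \<rho> \<Longrightarrow> \<phi> u = 0"
    using bump_exists[OF \<rho>(1), of p] by blast
  \<comment> \<open>The cut-off field vanishes off \<open>K\<close>. Compactness and the Hausdorff
    property make \<open>K\<close> closed in \<open>M\<close>, so the field is zero on an open set
    that together with the domain of the frame covers \<open>M\<close>.\<close>
  define K where "K = chart_inv c ` (cball p \<rho> \<inter> model M)"
  have Vc: "V \<subseteq> cdom c" unfolding V_def by blast
  have "closedin (mtop M) K"
  proof (rule compactin_imp_closedin)
    show "Hausdorff_space (mtop M)" using smooth_manifold by (simp add: smooth_manifold_def)
    have "compact (cball p \<rho> \<inter> model M)"
      by (intro compact_Int_closed compact_cball closed_subspace subspace_model)
    then have "compactin (top_of_set (cdom c)) (cball p \<rho> \<inter> model M)"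
      using \<rho>(2) Vc by (simp add: compactin_subtopology)
    then show "compactin (mtop M) K" unfolding K_def by (rule image_compactin[OF _ chart_inv_continuous[OF c'(1)]])
  qed
  then have Kop: "openin (mtop M) (points M - K)" by blast
  have KW: "K \<subseteq> fst c \<inter> W"
  proof -
    have "chart_inv c u \<in> fst c \<inter> W" if "u \<in> V" for u
      using that chart_inv_left[OF c'(1)] by (auto simp: V_def)
    then show ?thesis unfolding K_def using \<rho>(2) by blast
  qed
  define Y where "Y = (\<lambda>y. \<Sum>i<m. tscale (r i) (X i y))"
  define Z where "Z = (\<lambda>y. if y \<in> fst c \<inter> W then tscale (\<phi> (snd c y)) (Y y) else 0)"
  have ZD: "Z y \<in> D y" if y: "y \<in> points M" for y
  proof (cases "y \<in> fst c \<inter> W")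
    case True
    have "X i y \<in> D y" if "i < m" for i using DX[of y] True that by (simp add: tv.span_base)
    then have "tscale (\<phi> (snd c y)) (Y y) \<in> D y"
      unfolding Y_def by (intro tv.subspace_scale tv.subspace_sum D_subspace[OF y]) auto
    then show ?thesis using True by (simp add: Z_def)
  next
    case False
    then show ?thesis using tv.subspace_0[OF D_subspace[OF y]] by (simp only: Z_def if_False)
  qed
  have Z0: "Z y = 0" if "y \<notin> K" for y
  proof (cases "y \<in> fst c \<inter> W")
    case True
    have y: "snd c y \<in> model M" using relopen_in[OF relopen_cdom[OF c'(1)]] True by blast
    have "\<not> dist p (snd c y) \<le> \<rho>"
    proof
      assume "dist p (snd c y) \<le> \<rho>"
      then have "snd c y \<in> cball p \<rho> \<inter> model M" using y by simp
      then have "chart_inv c (snd c y) \<in> K" unfolding K_def by (rule imageI)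
      then show False using that True chart_inv_left[OF c'(1)] by simp
    qed
    then have "\<phi> (snd c y) = 0" using \<phi>(3) by simp
    then show ?thesis by (simp add: Z_def)
  next
    case False
    then show ?thesis unfolding Z_def by (rule if_not_P)
  qed
  have smooth: "smooth_on (model M) (snd d ` (fst d \<inter> points M)) (\<lambda>u. Z (chart_inv d u) d)" if d: "d \<in> atlas M" for d
  proof -
    have dp: "fst d \<inter> points M = fst d" using chart_subset[OF d] by blast
    \<comment> \<open>\<open>A\<close> and \<open>B\<close> cover the chart \<open>d\<close>: on
      \<open>A\<close> the field is given by the product formula, on \<open>B\<close> it is
      zero.\<close>
    define A where "A = snd d ` (fst d \<inter> (fst c \<inter> W))"
    define B where "B = snd d ` (fst d \<inter> (points M - K))"
    have A: "relopen (model M) A" unfolding A_def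
      by (rule chart_image_open[OF d openin_Int[OF chart_open[OF c'(1)] W(1)]])
    have B: "relopen (model M) B" unfolding B_def by (rule chart_image_open[OF d Kop])
    have sA: "smooth_on (model M) A (\<lambda>u. Z (chart_inv d u) d)"
    proof -
      have AdC: "relopen (model M) (snd d ` (fst d \<inter> fst c))" by (rule chart_image_open[OF d chart_open[OF c'(1)]])
      have 0: "smooth_on (model M) A (\<lambda>u. snd c (chart_inv d u))"
        by (rule smooth_on_open_subset[OF AdC A])
          (use param_smooth[OF chart_param[OF d] c'(1)] in \<open>auto simp: A_def pdom_chart[OF d]\<close>)
      have 1: "smooth_on (model M) A (\<lambda>u. \<phi> (snd c (chart_inv d u)))"
        by (rule smooth_on_comp[OF A relopen_cdom[OF c'(1)] _ 0 \<phi>(1)[OF relopen_cdom[OF c'(1)]]])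
          (use chart_inv_left[OF d] in \<open>auto simp: A_def\<close>)
      have 2: "smooth_on (model M) A (\<lambda>u. \<Sum>i<m. r i *\<^sub>R X i (chart_inv d u) d)"
      proof (rule smooth_on_sum[OF A])
        fix i assume "i \<in> {..<m}"
        then have "smooth_on (model M) (snd d ` (fst d \<inter> W)) (\<lambda>u. X i (chart_inv d u) d)"
          using X d unfolding smooth_vfield_on_def by blast
        then have "smooth_on (model M) A (\<lambda>u. X i (chart_inv d u) d)"
          by (rule smooth_on_open_subset[OF chart_image_open[OF d W(1)] A, rotated]) (auto simp: A_def)
        then show "smooth_on (model M) A (\<lambda>u. r i *\<^sub>R X i (chart_inv d u) d)"
          by (rule smooth_on_bounded_linear_comp[OF A bounded_linear_scaleR_right])
      qed
      have "Z (chart_inv d u) d = \<phi> (snd c (chart_inv d u)) *\<^sub>R (\<Sum>i<m. r i *\<^sub>R X i (chart_inv d u) d)" if "u \<in> A" for u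
        using that chart_inv_left[OF d] by (auto simp: A_def Z_def Y_def tscale_def sum_apply)
      then show ?thesis
        using smooth_on_bilinear[OF A bounded_bilinear_scaleR 1 2] by (simp cong: smooth_on_cong)
    qed
    have "Z (chart_inv d u) d = 0" if "u \<in> B" for u
      using that chart_inv_left[OF d] Z0 by (auto simp: B_def)
    then have sB: "smooth_on (model M) B (\<lambda>u. Z (chart_inv d u) d)"
      using smooth_on_const[OF B, of 0] by (simp cong: smooth_on_cong)
    show ?thesis unfolding dp
    proof (rule smooth_on_local[OF relopen_cdom[OF d]])
      fix u assume u: "u \<in> cdom d"
      have "u \<in> A \<or> u \<in> B" unfolding A_def B_def using u KW chart_subset[OF d] by blast
      moreover have "A \<subseteq> cdom d" "B \<subseteq> cdom d" unfolding A_def B_def by blast+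
      ultimately show "\<exists>W. relopen (model M) W \<and> u \<in> W \<and> W \<subseteq> cdom d \<and> smooth_on (model M) W (\<lambda>u. Z (chart_inv d u) d)"
        using A B sA sB by blast
    qed
  qed
  have "vfield_in M D Z"
    unfolding vfield_in_def smooth_vfield_on_def using ZD D_tangent smooth by blast
  moreover have "Z x = v" using c' W \<phi>(2) by (simp add: Z_def Y_def r p_def[symmetric])
  ultimately show thesis by (rule that)
qed

text \<open>The defect of the bracket involves the fields only through their values at the point, so
  any global extensions of the vectors with components \<open>a u s\<close> and \<open>a u t\<close>
  test the symmetry.\<close>

lemma closed_imp_integrable:
  assumes closed: "closed_under_bracket M D" and ad: "adapted c V P a" and u: "u \<in> V"
  shows "integrable_at V a u"
proof (rule integrable_atI[OF ad u])
  fix s t assume s: "s \<in> L" and t: "t \<in> L"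
  define x where "x = chart_inv c u"
  have x: "x \<in> points M" unfolding x_def by (rule adapted_point[OF ad u])
  obtain v where v: "v \<in> D x" "v c = a u s" using adapted_vector[OF ad u] unfolding x_def by blast
  obtain w where w: "w \<in> D x" "w c = a u t" using adapted_vector[OF ad u] unfolding x_def by blast
  obtain X where X: "vfield_in M D X" "X x = v" using global_field[OF x v(1)] by blast
  obtain Y where Y: "vfield_in M D Y" "Y x = w" using global_field[OF x w(1)] by blast
  have "lie_bracket M X Y x \<in> D x" using closed X(1) Y(1) x unfolding closed_under_bracket_def vfield_in_def by blast
  then have "a u (P (lie_bracket M X Y x c)) = lie_bracket M X Y x c"
    unfolding x_def by (rule adapted_apply[OF ad u])
  then have "fderiv V a u (v c) (P (w c)) = fderiv V a u (w c) (P (v c))"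
    using lie_bracket_adapted[OF ad u X(1) Y(1)] X(2) Y(2) unfolding x_def[symmetric]
    by (metis add.right_neutral add_left_cancel eq_iff_diff_eq_0)
  then show "fderiv V a u (a u s) t = fderiv V a u (a u t) s"
    unfolding v w adapted_retract(1)[OF ad u] by (simp only: proj_id[OF L(1)] s t)
qed

subsection \<open>Plaques\<close>

text \<open>\<open>a\<close> lives on a relatively open set, the differential equation on an open
  one. It is solved for \<open>a o proj (model M)\<close>, and the projected solution still solves
  it because \<open>a\<close> takes values in the model space.\<close>

lemma plaque_map:
  assumes ad: "adapted c V P a" and int: "\<And>u. u \<in> V \<Longrightarrow> integrable_at V a u" and u0: "u0 \<in> V"
  obtains r G where "r > 0" "G 0 = u0" "\<And>x. x \<in> ball 0 r \<Longrightarrow> G x \<in> V"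
    "\<And>x. x \<in> ball 0 r \<Longrightarrow> (G has_derivative blinfun_apply (a (G x))) (at x)"
proof -
  note V = adapted_param(2)[OF ad] and a = adapted_param(5)[OF ad] and S = subspace_model
  let ?pr = "proj (model M)"
  obtain a' where a': "\<And>u. u \<in> ?pr -` V \<Longrightarrow> ((\<lambda>u. a (?pr u)) has_derivative blinfun_apply (a' u)) (at u)"
    "continuous_on (?pr -` V) a'" "\<And>u v. u \<in> ?pr -` V \<Longrightarrow> blinfun_apply (a' u) v = fderiv V a (?pr u) (?pr v)"
    by (rule smooth_on_extend[OF V a]) (rule that; assumption)
  have pr: "?pr (a u s) = a u s" if "u \<in> V" for u s
    by (rule proj_id[OF S adapted_in_model[OF ad that]])
  obtain r g where r: "r > 0" and g: "g 0 = u0" "\<And>x. x \<in> ball 0 r \<Longrightarrow> g x \<in> ?pr -` V"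
    "\<And>x. x \<in> ball 0 r \<Longrightarrow> (g has_derivative blinfun_apply (a (?pr (g x)))) (at x)"
  proof (rule total_differential_equation[OF relopen_proj_vimage[OF V] _ a'(1,2)])
    show "u0 \<in> ?pr -` V" using u0 proj_id[OF S relopen_in[OF V u0]] by simp
    show "a' u (a (?pr u) s) t = a' u (a (?pr u) t) s" if "u \<in> ?pr -` V" for u s t
      using int[of "?pr u"] that pr by (simp add: a'(3)[OF that] integrable_at_def)
  qed (assumption, (rule that; assumption))
  show thesis
  proof (rule that[of r "\<lambda>x. ?pr (g x)"])
    show "?pr (g 0) = u0" using g(1) proj_id[OF S relopen_in[OF V u0]] by simp
    fix x :: 'e assume x: "x \<in> ball 0 r"
    show xV: "?pr (g x) \<in> V" using g(2)[OF x] by simp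
    have "((\<lambda>x. ?pr (g x)) has_derivative (\<lambda>v. ?pr (a (?pr (g x)) v))) (at x)"
      by (rule bounded_linear.has_derivative[OF proj_linear[OF S] g(3)[OF x]])
    then show "((\<lambda>x. ?pr (g x)) has_derivative blinfun_apply (a (?pr (g x)))) (at x)"
      by (simp add: pr[OF xV])
  qed (rule r)
qed

text \<open>\<open>\<rho>\<close> is a left inverse of \<open>G\<close> that is smooth on the
  ambient space; it will provide the chart of the plaque. The last clause says that any map tangent
  to the distribution meets the plaque in a relatively open set of parameters. It is required for
  every \<open>T\<close>, since it is applied to submanifolds of any dimension and to other
  plaques.\<close>

definition plaque :: "('a, 'e) chart \<Rightarrow> 'e set \<Rightarrow> ('e \<Rightarrow> 'e) \<Rightarrow> ('e \<Rightarrow> 'e) \<Rightarrow> bool" where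
  "plaque c B G \<rho> \<longleftrightarrow> c \<in> atlas M \<and> G ` B \<subseteq> cdom c \<and> (\<forall>x\<in>B. \<rho> (G x) = x) \<and>
     (\<forall>S V. relopen S V \<longrightarrow> smooth_on S V \<rho>) \<and> Dparam L B (\<lambda>w. chart_inv c (G w)) \<and>
     (\<forall>T A g. Dparam T A g \<longrightarrow> relopen T {w \<in> A. g w \<in> (\<lambda>w. chart_inv c (G w)) ` B})"

text \<open>Bootstrapping: if \<open>G\<close> is of class \<open>C^k\<close>, so is its derivative
  \<open>a o G\<close>.\<close>

lemma Ck_on_solution:
  assumes ad: "adapted c V P a" and B: "relopen L B" and GV: "G ` B \<subseteq> V"
    and G: "\<And>x. x \<in> B \<Longrightarrow> (G has_derivative blinfun_apply (a (G x))) (at x within B)"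
  shows "Ck_on k L B G"
proof (induction k)
  case 0
  show ?case using has_derivative_continuous_on[OF G] by simp
next
  case (Suc k)
  have "Ck_on k (model M) V a" using adapted_param(5)[OF ad] by (simp add: smooth_on_def)
  from Ck_on_comp[OF B adapted_param(2)[OF ad] GV Suc this]
  have "Ck_on k L B (\<lambda>x. a (G x))" .
  then have *: "Ck_on k L B (\<lambda>x. a (G x) v)" for v
    by (rule Ck_on_bounded_linear_comp[OF B blinfun.bounded_linear_left])
  show ?case by (rule Ck_on_SucI[OF B G *])
qed

text \<open>Let \<open>\<phi>\<close> be \<open>g\<close> in the chart \<open>c\<close>. Near a
  parameter \<open>w0\<close> where \<open>g\<close> meets the plaque, \<open>\<phi>\<close> and
  \<open>G (P \<phi> - P u0)\<close> solve the same total differential equation with driving term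
  \<open>P D\<phi>\<close>, and by \<open>left\<close> they agree at \<open>w0\<close>. So they
  coincide nearby, and \<open>g\<close> stays in the plaque.\<close>

lemma plaque_open:
  assumes ad: "adapted c V P a" and u0: "u0 \<in> V" and r: "r > 0"
    and GV: "\<And>x. x \<in> ball 0 r \<Longrightarrow> G x \<in> V"
    and G: "\<And>x. x \<in> ball 0 r \<Longrightarrow> (G has_derivative blinfun_apply (a (G x))) (at x)"
    and left: "\<And>x. x \<in> ball 0 r \<Longrightarrow> P (G x) - P u0 = proj L x"
    and g: "Dparam T A g"
  shows "relopen T {w \<in> A. g w \<in> (\<lambda>w. chart_inv c (G w)) ` (ball 0 r \<inter> L)}"
proof -
  note c = adapted_param(1)[OF ad] and V = adapted_param(2)[OF ad] and P = adapted_param(4)[OF ad]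
    and a = adapted_param(5)[OF ad] and S = subspace_model
  have gp: "param M T A g" and gD: "\<And>w t. w \<in> A \<Longrightarrow> t \<in> T \<Longrightarrow> ptan M A g w t \<in> D (g w)"
    using g by (auto simp: Dparam_def)
  have A: "relopen T A" by (rule param_relopen_dom[OF gp])
  then have T: "subspace T" by (simp add: relopen_def)
  define \<phi> where "\<phi> = (\<lambda>w. snd c (g w))"
  define W1 where "W1 = {w \<in> pdom A g c. \<phi> w \<in> V}"
  have sm: "smooth_on T (pdom A g c) \<phi>" unfolding \<phi>_def by (rule param_smooth[OF gp c])
  have W1: "relopen T W1" unfolding W1_def
    by (rule relopen_preimage[OF param_relopen[OF gp c] smooth_on_continuous[OF sm], of "model M"])
      (use V relopen_subset[OF relopen_cdom[OF c]] pdom_image[of c g A] in \<open>auto simp: relopen_def \<phi>_def\<close>)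
  have "continuous_on W1 (\<lambda>w. P (\<phi> w) - P u0)"
    by (intro continuous_on_diff continuous_on_const bounded_linear.continuous_on[OF P]
        continuous_on_subset[OF smooth_on_continuous[OF sm]]) (auto simp: W1_def)
  \<comment> \<open>Restricts to parameters at which \<open>G\<close> may be evaluated at
    \<open>P (\<phi> w) - P u0\<close>, by \<open>left\<close> the only possible plaque parameter of
    \<open>\<phi> w\<close> in \<open>L\<close>.\<close>
  define W where "W = {w \<in> W1. P (\<phi> w) - P u0 \<in> ball 0 r}"
  have W: "relopen T W" unfolding W_def
    by (rule relopen_preimage[OF W1 \<open>continuous_on W1 _\<close>, of UNIV]) auto
  have WA: "W \<subseteq> pdom A g c" "W \<subseteq> A" by (auto simp: W_def W1_def pdom_def)
  have smW: "smooth_on T W \<phi>" by (rule smooth_on_open_subset[OF param_relopen[OF gp c] W WA(1) sm])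
  have \<phi>D: "fderiv W \<phi> w t = a (\<phi> w) (P (fderiv W \<phi> w t))" if w: "w \<in> W" and t: "t \<in> T" for w t
  proof -
    have wp: "w \<in> pdom A g c" "w \<in> A" "g w \<in> fst c" "\<phi> w \<in> V" using w by (auto simp: W_def W1_def pdom_def)
    have "(\<phi> has_derivative pd A g c w) (at w within W)"
      unfolding \<phi>_def by (rule has_derivative_subset[OF pd_has_derivative[OF gp c wp(1)] WA(1)])
    from frechet_within_unique[OF W w this t] have eq: "fderiv W \<phi> w t = ptan M A g w t c"
      using wp c by (simp add: ptan_def charts_at_def)
    have "chart_inv c (\<phi> w) = g w" unfolding \<phi>_def by (rule chart_inv_left[OF c wp(3)])
    then have "a (\<phi> w) (P (ptan M A g w t c)) = ptan M A g w t c"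
      using adapted_apply[OF ad wp(4)] gD[OF wp(2) t] by simp
    then show ?thesis by (simp add: eq)
  qed
  let ?U = "proj (model M) -` V"
  obtain a' where a': "\<And>u. u \<in> ?U \<Longrightarrow> ((\<lambda>u. a (proj (model M) u)) has_derivative blinfun_apply (a' u)) (at u)"
    "continuous_on ?U a'"
    by (rule smooth_on_extend[OF V a]) (rule that; assumption)
  obtain \<phi>' where \<phi>': "\<And>w. w \<in> proj T -` W \<Longrightarrow> ((\<lambda>w. \<phi> (proj T w)) has_derivative blinfun_apply (\<phi>' w)) (at w)"
    "continuous_on (proj T -` W) \<phi>'" "\<And>w v. w \<in> proj T -` W \<Longrightarrow> blinfun_apply (\<phi>' w) v = fderiv W \<phi> (proj T w) (proj T v)"
    by (rule smooth_on_extend[OF W smW]) (rule that; assumption)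
  define Pb where "Pb = Blinfun P"
  have Pb: "blinfun_apply Pb = P" unfolding Pb_def by (rule bounded_linear_Blinfun_apply[OF P])
  have loc: "\<exists>e>0. ball w0 e \<inter> T \<subseteq> {w \<in> A. g w \<in> (\<lambda>w. chart_inv c (G w)) ` (ball 0 r \<inter> L)}"
    if w0: "w0 \<in> A" "g w0 \<in> (\<lambda>w. chart_inv c (G w)) ` (ball 0 r \<inter> L)" for w0
  proof -
    obtain x0 where x0: "x0 \<in> ball 0 r" "x0 \<in> L" "g w0 = chart_inv c (G x0)" using w0(2) by blast
    have Gc: "G x0 \<in> cdom c" using GV[OF x0(1)] adapted_param(3)[OF ad] by blast
    have \<phi>0: "\<phi> w0 = G x0" unfolding \<phi>_def x0(3) by (rule chart_inv_right[OF Gc])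
    have "P (\<phi> w0) - P u0 = x0" using left[OF x0(1)] proj_id[OF L(1) x0(2)] \<phi>0 by simp
    then have w0W: "w0 \<in> W" using w0(1) x0 chart_inv_in[OF Gc] \<phi>0 GV[OF x0(1)] by (simp add: W_def W1_def pdom_def)
    have pw0: "proj T w0 = w0" by (rule proj_id[OF T relopen_in[OF A w0(1)]])
    \<comment> \<open>Composed with \<open>proj T\<close>, both candidates are defined on an open
      subset of the ambient type, as \<open>local_uniqueness\<close> requires.\<close>
    define g1 where "g1 = (\<lambda>w. \<phi> (proj T w))"
    define h1 where "h1 = (\<lambda>w. G (P (\<phi> (proj T w)) - P u0))"
    have g1V: "g1 w \<in> V" if "w \<in> proj T -` W" for w using that by (auto simp: g1_def W_def W1_def)
    have pS: "proj (model M) u = u" if "u \<in> V" for u by (rule proj_id[OF S relopen_in[OF V that]])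
    obtain e where e: "e > 0" "ball w0 e \<subseteq> proj T -` W" "\<And>w. w \<in> ball w0 e \<Longrightarrow> g1 w = h1 w"
    proof (rule local_uniqueness[of ?U g1 w0 "\<lambda>u. a (proj (model M) u)" a' "proj T -` W" h1 "\<lambda>w. Pb o\<^sub>L \<phi>' w",
          OF relopen_proj_vimage[OF V] _ a' relopen_proj_vimage[OF W]])
      show "g1 w0 \<in> ?U" using g1V[of w0] pw0 w0W pS by simp
      show "w0 \<in> proj T -` W" using pw0 w0W by simp
      show "g1 w0 = h1 w0"
        using \<phi>0 \<open>P (\<phi> w0) - P u0 = x0\<close> by (simp add: g1_def h1_def pw0)
      show "continuous_on (proj T -` W) (\<lambda>w. Pb o\<^sub>L \<phi>' w)"
        by (intro bounded_linear.continuous_on[OF bounded_bilinear.bounded_linear_right[OF bounded_bilinear_blinfun_compose]] \<phi>'(2))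
      fix w assume w: "w \<in> proj T -` W"
      then have w': "proj T w \<in> W" by simp
      have "blinfun_apply (\<phi>' w) = (\<lambda>v. a (g1 w) (P (\<phi>' w v)))"
        using \<phi>D[OF w' proj_in[OF T]] by (simp add: fun_eq_iff \<phi>'(3)[OF w] g1_def)
      then show "(g1 has_derivative (\<lambda>v. a (proj (model M) (g1 w)) ((Pb o\<^sub>L \<phi>' w) v))) (at w)"
        using \<phi>'(1)[OF w] pS[OF g1V[OF w]] by (simp add: g1_def[symmetric] Pb)
      let ?y = "P (\<phi> (proj T w)) - P u0"
      have y: "?y \<in> ball 0 r" using w' by (simp add: W_def)
      have "((\<lambda>w. P (\<phi> (proj T w)) - P u0) has_derivative (\<lambda>v. P (\<phi>' w v))) (at w)"
        using has_derivative_diff[OF bounded_linear.has_derivative[OF P \<phi>'(1)[OF w]] has_derivative_const] by simp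
      from has_derivative_compose[OF this G[OF y]]
      have "(h1 has_derivative (\<lambda>v. a (h1 w) (P (\<phi>' w v)))) (at w)" unfolding h1_def .
      moreover have "h1 w \<in> V" unfolding h1_def by (rule GV[OF y])
      ultimately show "(h1 has_derivative (\<lambda>v. a (proj (model M) (h1 w)) ((Pb o\<^sub>L \<phi>' w) v))) (at w)"
        by (simp add: pS Pb)
    qed (assumption | (rule that; assumption))+
    have "w \<in> A \<and> g w \<in> (\<lambda>w. chart_inv c (G w)) ` (ball 0 r \<inter> L)" if w: "w \<in> ball w0 e" "w \<in> T" for w
    proof -
      have pw: "proj T w = w" by (rule proj_id[OF T w(2)])
      have wW: "w \<in> W" using e(2) w(1) pw by auto
      let ?y = "P (\<phi> w) - P u0"
      have "?y \<in> L" by (intro subspace_diff L(1) adapted_param(6)[OF ad])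
      then have y: "?y \<in> ball 0 r \<inter> L" using wW by (simp add: W_def)
      have "g w \<in> fst c" using subsetD[OF WA(1) wW] by (simp add: pdom_def)
      then have "g w = chart_inv c (\<phi> w)" unfolding \<phi>_def by (simp only: chart_inv_left[OF c])
      also have "\<phi> w = G ?y" using e(3)[OF w(1)] by (simp add: g1_def h1_def pw)
      finally show ?thesis using image_eqI[OF _ y, of "g w" "\<lambda>w. chart_inv c (G w)"] subsetD[OF WA(2) wW] by blast
    qed
    then show ?thesis using e(1) by blast
  qed
  have "{w \<in> A. g w \<in> (\<lambda>w. chart_inv c (G w)) ` (ball 0 r \<inter> L)} \<subseteq> T" using relopen_subset[OF A] by blast
  then show ?thesis unfolding relopen_def openin_contains_ball using T loc by blast
qed

lemma plaque_exists:
  assumes closed: "closed_under_bracket M D" and x: "x \<in> points M"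
  obtains c B G \<rho> where "plaque c B G \<rho>" "x \<in> (\<lambda>w. chart_inv c (G w)) ` B"
proof -
  obtain c where c: "c \<in> charts_at M x" using ex_chart[OF x] by blast
  then have c': "c \<in> atlas M" "x \<in> fst c" by (auto simp: charts_at_def)
  obtain V P a where ad: "adapted c V P a" and xV: "snd c x \<in> V" using adapted_exists[OF x c] by blast
  define u0 where "u0 = snd c x"
  have u0: "u0 \<in> V" using xV by (simp add: u0_def)
  note P = adapted_param(4)[OF ad]
  obtain r G where r: "r > 0" and G0: "G 0 = u0" and GV: "\<And>x. x \<in> ball 0 r \<Longrightarrow> G x \<in> V"
    and G: "\<And>x. x \<in> ball 0 r \<Longrightarrow> (G has_derivative blinfun_apply (a (G x))) (at x)"
    using plaque_map[OF ad closed_imp_integrable[OF closed ad] u0] by blast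
  \<comment> \<open>\<open>P (a u s) = proj L s\<close> makes the derivative of
    \<open>P o G - proj L\<close> zero, so this map is constant on the ball: up to a translation,
    \<open>P\<close> recovers the parameter.\<close>
  have left: "P (G x) - P u0 = proj L x" if x: "x \<in> ball 0 r" for x
  proof -
    have "((\<lambda>x. P (G x) - proj L x) has_derivative (\<lambda>h. 0)) (at x within ball 0 r)" if "x \<in> ball 0 r" for x
    proof -
      have "((\<lambda>x. P (G x) - proj L x) has_derivative (\<lambda>h. P (a (G x) h) - proj L h)) (at x)"
        by (intro has_derivative_diff bounded_linear.has_derivative[OF P G[OF that]]
            bounded_linear_imp_has_derivative proj_linear[OF L(1)])
      then show ?thesis by (simp add: adapted_retract(1)[OF ad GV[OF that]] has_derivative_at_withinI)
    qed
    then obtain k where k: "\<And>x. x \<in> ball 0 r \<Longrightarrow> P (G x) - proj L x = k"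
      using has_derivative_zero_constant[OF convex_ball, of 0 r "\<lambda>x. P (G x) - proj L x"] by blast
    have "proj L 0 = 0" using L(1) by (simp add: proj_id subspace_0)
    then have "P u0 = k" using k[of 0] r G0 by simp
    then show ?thesis using k[OF x] by (simp add: algebra_simps)
  qed
  \<comment> \<open>\<open>G\<close> is constant in the directions killed by \<open>proj L\<close>,
    so the plaque is parametrised by the part of the ball in \<open>L\<close>.\<close>
  define B where "B = ball 0 r \<inter> L"
  define \<rho> where "\<rho> = (\<lambda>u. P u - P u0)"
  have B: "relopen L B" unfolding B_def relopen_def using L(1) by (auto simp: openin_open)
  have GB: "G ` B \<subseteq> V" using GV by (auto simp: B_def)
  have GB': "G ` B \<subseteq> cdom c" using GB adapted_param(3)[OF ad] by blast
  have Gw: "(G has_derivative blinfun_apply (a (G x))) (at x within B)" if "x \<in> B" for x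
    using G that by (simp add: B_def has_derivative_at_withinI)
  have smG: "smooth_on L B G" unfolding smooth_on_def using Ck_on_solution[OF ad B GB Gw] by blast
  let ?g = "\<lambda>w. chart_inv c (G w)"
  have gp: "param M L B ?g" by (rule param_chart_comp[OF c'(1) B smG GB'])
  have gD: "ptan M B ?g w t \<in> D (?g w)" if w: "w \<in> B" and t: "t \<in> L" for w t
  proof -
    have Gwc: "G w \<in> cdom c" and GwV: "G w \<in> V" using GB GB' w by auto
    have gc: "?g w \<in> fst c" by (rule chart_inv_in[OF Gwc])
    have ch: "c \<in> charts_at M (?g w)" using c' gc by (simp add: charts_at_def)
    have "?g y \<in> fst c" if "y \<in> B" for y by (rule chart_inv_in) (use GB' that in auto)
    then have pB: "pdom B ?g c = B" unfolding pdom_def by blast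
    have "((\<lambda>w. snd c (?g w)) has_derivative blinfun_apply (a (G w))) (at w within B)"
      by (rule has_derivative_transform[OF w _ Gw[OF w]], rule chart_inv_right) (use GB' in auto)
    then have "pd B ?g c w t = a (G w) t" unfolding pd_def pB by (rule frechet_within_unique[OF B w _ t])
    then have pt: "ptan M B ?g w t c = a (G w) t" using ch by (simp add: ptan_def)
    obtain v where v: "v \<in> D (?g w)" "v c = a (G w) t" using adapted_vector[OF ad GwV] by blast
    have "ptan M B ?g w t = v"
      by (rule tangent_eqI[OF ptan_in_tangent_space[OF gp w t] _ ch])
        (use v pt D_tangent[OF adapted_point[OF ad GwV]] in auto)
    then show ?thesis using v by simp
  qed
  have "plaque c B G \<rho>"
    unfolding plaque_def
  proof (intro conjI allI impI ballI)
    show "\<rho> (G w) = w" if "w \<in> B" for w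
      using left[of w] that proj_id[OF L(1), of w] by (simp add: B_def \<rho>_def)
    show "smooth_on S V \<rho>" if "relopen S V" for S V
      unfolding \<rho>_def by (rule smooth_on_minus[OF that smooth_on_bounded_linear[OF that P] smooth_on_const[OF that]])
    show "Dparam L B ?g" unfolding Dparam_def using gp gD by blast
    show "relopen T {w \<in> A. g w \<in> ?g ` B}" if "Dparam T A g" for T A g
      unfolding B_def by (rule plaque_open[OF ad u0 r GV G left that])
  qed (use c' GB' in auto)
  moreover have "x = ?g 0" unfolding G0 u0_def using chart_inv_left[OF c'] by simp
  moreover have "0 \<in> B" using r L(1) by (simp add: B_def subspace_0)
  ultimately show thesis using that by blast
qed

subsection \<open>Integral manifolds\<close>

lemma integral_manifold_parts:
  assumes "integral_manifold M D N"
  shows "smooth_manifold N" "points N \<noteq> {}" "points N \<subseteq> points M" "smooth_map N M (\<lambda>x. x)"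
    "x \<in> points N \<Longrightarrow> inj_on (tangent_map N M (\<lambda>x. x) x) (tangent_space N x)"
    "x \<in> points N \<Longrightarrow> tangent_map N M (\<lambda>x. x) x ` tangent_space N x \<subseteq> D x"
  using assms unfolding integral_manifold_def injectively_immersed_submanifold_def by auto

lemma integral_manifold_Dparam:
  assumes N: "integral_manifold M D N" and c: "c \<in> atlas N"
  shows "Dparam (model N) (cdom c) (chart_inv c)"
proof -
  note N' = integral_manifold_parts[OF N]
  interpret N: smooth_mfd N by unfold_locales (rule N'(1))
  have "ptan M (cdom c) (chart_inv c) w t \<in> D (chart_inv c w)" if w: "w \<in> cdom c" and t: "t \<in> model N" for w t
  proof -
    let ?x = "chart_inv c w"
    have x: "?x \<in> points N" by (rule N.chart_inv_point[OF c w])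
    have ch: "c \<in> charts_at N ?x" using c N.chart_inv_in[OF w] by (simp add: charts_at_def)
    obtain v where v: "v \<in> tangent_space N ?x" "v c = t" using N.ex_tangent[OF ch t] by blast
    have "tangent_map N M (\<lambda>x. x) ?x v = ptan M (cdom c) (chart_inv c) w t"
      using tangent_map_eq_ptan[OF smooth_manifold N'(1,4) ch v(1)] v(2) N.chart_inv_right[OF w] by simp
    moreover have "tangent_map N M (\<lambda>x. x) ?x v \<in> D ?x"
      by (rule subsetD[OF N'(6)[OF x] imageI[OF v(1)]])
    ultimately show ?thesis by simp
  qed
  then show ?thesis
    unfolding Dparam_def using submanifold_param[OF smooth_manifold N'(1,4) c] by blast
qed

text \<open>In the charts \<open>c\<close> and \<open>d\<close> the inclusion has an injective
  derivative from the model of \<open>N\<close> into the image of \<open>L\<close> under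
  \<open>a (snd d x)\<close>, whose dimension is at most \<open>m\<close>. Comparing dimensions
  gives the inequality, and surjectivity in the case of equality.\<close>

lemma integral_manifold_derivative:
  assumes N: "integral_manifold M D N" and c: "c \<in> charts_at N x" and ad: "adapted d V P a"
    and d: "d \<in> charts_at M x" and xV: "snd d x \<in> V"
  shows "dim (model N) \<le> m"
    and "dim (model N) = m \<Longrightarrow> s \<in> L \<Longrightarrow> \<exists>t\<in>model N. pd (cdom c) (chart_inv c) d (snd c x) t = a (snd d x) s"
proof -
  note N' = integral_manifold_parts[OF N]
  interpret N: smooth_mfd N by unfold_locales (rule N'(1))
  have c': "c \<in> atlas N" "x \<in> fst c" and d': "d \<in> atlas M" "x \<in> fst d" using c d by (auto simp: charts_at_def)
  have x: "x \<in> points N" using N.chart_subset c' by blast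
  have xx: "chart_inv c (snd c x) = x" "chart_inv d (snd d x) = x" using N.chart_inv_left[OF c'] chart_inv_left[OF d'] .
  have w: "snd c x \<in> cdom c" using c' by blast
  have gD: "ptan M (cdom c) (chart_inv c) (snd c x) t \<in> D x" if "t \<in> model N" for t
    using integral_manifold_Dparam[OF N c'(1)] w that xx unfolding Dparam_def by force+
  have gp: "param M (model N) (cdom c) (chart_inv c)"
    using integral_manifold_Dparam[OF N c'(1)] unfolding Dparam_def by blast
  define f where "f = pd (cdom c) (chart_inv c) d (snd c x)"
  have pt: "ptan M (cdom c) (chart_inv c) (snd c x) t d = f t" for t
    using d by (simp add: ptan_def xx f_def)
  have "bounded_linear f" unfolding f_def
    by (rule has_derivative_bounded_linear[OF pd_has_derivative[OF gp d'(1)]]) (use w d' xx in \<open>simp add: pdom_def\<close>)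
  then have lin: "linear f" by (rule bounded_linear.linear)
  have inj: "inj_on f (model N)"
  proof (rule inj_onI)
    fix s t assume s: "s \<in> model N" and t: "t \<in> model N" and eq: "f s = f t"
    obtain v where v: "v \<in> tangent_space N x" "v c = s" using N.ex_tangent[OF c s] by blast
    obtain v' where v': "v' \<in> tangent_space N x" "v' c = t" using N.ex_tangent[OF c t] by blast
    have sub: "D x \<subseteq> tangent_space M x" using D_tangent N'(3) x by blast
    have "ptan M (cdom c) (chart_inv c) (snd c x) s = ptan M (cdom c) (chart_inv c) (snd c x) t"
      by (rule tangent_eqI[OF subsetD[OF sub gD[OF s]] subsetD[OF sub gD[OF t]] d]) (simp add: pt eq)
    then have "tangent_map N M (\<lambda>x. x) x v = tangent_map N M (\<lambda>x. x) x v'"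
      using tangent_map_eq_ptan[OF smooth_manifold N'(1,4) c v(1)] tangent_map_eq_ptan[OF smooth_manifold N'(1,4) c v'(1)] v(2) v'(2)
      by simp
    then have "v = v'" using inj_onD[OF N'(5)[OF x]] v(1) v'(1) by blast
    then show "s = t" using v(2) v'(2) by simp
  qed
  have sub: "f ` model N \<subseteq> blinfun_apply (a (snd d x)) ` L"
  proof (rule image_subsetI)
    fix t assume "t \<in> model N"
    then have "f t \<in> (\<lambda>v. v d) ` D (chart_inv d (snd d x))" using gD pt unfolding xx by (metis imageI)
    then show "f t \<in> blinfun_apply (a (snd d x)) ` L" using ad xV unfolding adapted_def by blast
  qed
  have Ns: "span (model N) = model N" using N.subspace_model by (simp add: span_eq_iff)
  have dimf: "dim (f ` model N) = dim (model N)" by (rule dim_image_eq[OF lin]) (simp add: Ns inj)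
  have lina: "linear (blinfun_apply (a (snd d x)))" by (simp add: blinfun.bounded_linear_right bounded_linear.linear)
  have dima: "dim (blinfun_apply (a (snd d x)) ` L) \<le> m" using dim_image_le[OF lina, of L] L(2) by simp
  show "dim (model N) \<le> m" using dim_subset[OF sub] dimf dima by linarith
  assume "dim (model N) = m" "s \<in> L"
  then have "f ` model N = blinfun_apply (a (snd d x)) ` L"
    by (intro subspace_dim_equal linear_subspace_image lin lina N.subspace_model L(1) sub) (use dimf dima in simp)
  then show "\<exists>t\<in>model N. pd (cdom c) (chart_inv c) d (snd c x) t = a (snd d x) s"
    using \<open>s \<in> L\<close> unfolding f_def[symmetric] by (metis imageE imageI)
qed

lemma integral_manifold_dim_le:
  assumes N: "integral_manifold M D N"
  shows "mfd_dim N \<le> m"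
proof -
  note N' = integral_manifold_parts[OF N]
  interpret N: smooth_mfd N by unfold_locales (rule N'(1))
  obtain x where x: "x \<in> points N" using N'(2) by blast
  obtain c where c: "c \<in> charts_at N x" using N.ex_chart[OF x] by blast
  have xM: "x \<in> points M" using x N'(3) by blast
  obtain d where d: "d \<in> charts_at M x" using ex_chart[OF xM] by blast
  obtain V P a where "adapted d V P a" "snd d x \<in> V" using adapted_exists[OF xM d] by blast
  from integral_manifold_derivative(1)[OF N c this(1) d this(2)] show ?thesis by (simp add: mfd_dim_def)
qed

text \<open>In full dimension every \<open>a u s\<close> is a value of the derivative of the
  inclusion, so the symmetry that \<open>integral_map_symmetric\<close> yields on tangent directions
  of \<open>N\<close> covers all of \<open>L\<close>.\<close>

lemma integral_manifold_integrable:
  assumes N: "integral_manifold M D N" and dimN: "mfd_dim N = m" and x: "x \<in> points N"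
    and ad: "adapted d V P a" and d: "d \<in> charts_at M x" and xV: "snd d x \<in> V"
  shows "integrable_at V a (snd d x)"
proof (rule integrable_atI[OF ad xV])
  note N' = integral_manifold_parts[OF N]
  interpret N: smooth_mfd N by unfold_locales (rule N'(1))
  obtain c where c: "c \<in> charts_at N x" using N.ex_chart[OF x] by blast
  have c': "c \<in> atlas N" "x \<in> fst c" and d': "d \<in> atlas M" "x \<in> fst d" using c d by (auto simp: charts_at_def)
  let ?g = "chart_inv c"
  have gp: "param M (model N) (cdom c) ?g" and gD: "\<And>w t. w \<in> cdom c \<Longrightarrow> t \<in> model N \<Longrightarrow> ptan M (cdom c) ?g w t \<in> D (?g w)"
    using integral_manifold_Dparam[OF N c'(1)] unfolding Dparam_def by blast+
  define \<phi> where "\<phi> = (\<lambda>w. snd d (?g w))"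
  define W where "W = {w \<in> pdom (cdom c) ?g d. \<phi> w \<in> V}"
  have sm: "smooth_on (model N) (pdom (cdom c) ?g d) \<phi>" unfolding \<phi>_def by (rule param_smooth[OF gp d'(1)])
  have W: "relopen (model N) W" unfolding W_def
    by (rule relopen_preimage[OF param_relopen[OF gp d'(1)] smooth_on_continuous[OF sm], of "model M"])
      (use adapted_param(2)[OF ad] relopen_subset[OF relopen_cdom[OF d'(1)]] pdom_image[of d ?g "cdom c"]
        in \<open>auto simp: relopen_def \<phi>_def\<close>)
  have Wp: "W \<subseteq> pdom (cdom c) ?g d" by (auto simp: W_def)
  have smW: "smooth_on (model N) W \<phi>" by (rule smooth_on_open_subset[OF param_relopen[OF gp d'(1)] W Wp sm])
  have fd: "fderiv W \<phi> w t = pd (cdom c) ?g d w t" if w: "w \<in> W" and t: "t \<in> model N" for w t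
    unfolding \<phi>_def
    by (rule frechet_within_unique[OF W w has_derivative_subset[OF pd_has_derivative[OF gp d'(1)] Wp] t]) (use Wp w in blast)
  have eq: "a (\<phi> w) (P (fderiv W \<phi> w t)) = fderiv W \<phi> w t" if w: "w \<in> W" and t: "t \<in> model N" for w t
  proof -
    have w': "w \<in> cdom c" "?g w \<in> fst d" "\<phi> w \<in> V" using w by (auto simp: W_def pdom_def)
    have "ptan M (cdom c) ?g w t d = fderiv W \<phi> w t"
      using w' d' by (simp add: ptan_def charts_at_def fd[OF w t])
    moreover have "chart_inv d (\<phi> w) = ?g w" unfolding \<phi>_def by (rule chart_inv_left[OF d'(1) w'(2)])
    ultimately show ?thesis using adapted_apply[OF ad w'(3)] gD[OF w'(1) t] by metis
  qed
  have gx: "?g (snd c x) = x" by (rule N.chart_inv_left[OF c'])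
  have \<phi>x: "\<phi> (snd c x) = snd d x" by (simp add: \<phi>_def gx)
  have wW: "snd c x \<in> W" using c' d' xV by (simp add: W_def pdom_def gx \<phi>x)
  have \<phi>V: "\<phi> ` W \<subseteq> V" by (auto simp: W_def)
  fix s t assume s: "s \<in> L" and t: "t \<in> L"
  have dimN': "dim (model N) = m" using dimN by (simp add: mfd_dim_def)
  obtain y where y: "y \<in> model N" "fderiv W \<phi> (snd c x) y = a (snd d x) s"
    using integral_manifold_derivative(2)[OF N c ad d xV dimN' s] fd[OF wW] by metis
  obtain z where z: "z \<in> model N" "fderiv W \<phi> (snd c x) z = a (snd d x) t"
    using integral_manifold_derivative(2)[OF N c ad d xV dimN' t] fd[OF wW] by metis
  have "P (a (snd d x) s) = s" "P (a (snd d x) t) = t"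
    using adapted_retract(1)[OF ad xV] proj_id[OF L(1)] s t by simp_all
  then show "fderiv V a (snd d x) (a (snd d x) s) t = fderiv V a (snd d x) (a (snd d x) t) s"
    using integral_map_symmetric[OF W adapted_param(2)[OF ad] smW \<phi>V adapted_param(5,4)[OF ad] eq wW y(1) z(1)]
    unfolding y(2) z(2) \<phi>x by simp
qed

end

subsection \<open>Unions of plaques\<close>

lemma relopen_Union:
  assumes "subspace S" "\<And>V. V \<in> K \<Longrightarrow> relopen S V"
  shows "relopen S (\<Union>K)"
  using assms openin_Union[of K "top_of_set S"] unfolding relopen_def by blast

lemma (in smooth_mfd) param_continuous:
  assumes g: "param M T B g" and U: "openin (mtop M) U"
  shows "relopen T {w \<in> B. g w \<in> U}"
proof -
  have B: "relopen T B" by (rule param_relopen_dom[OF g])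
  let ?K = "(\<lambda>c. {w \<in> pdom B g c. snd c (g w) \<in> snd c ` (fst c \<inter> U)}) ` atlas M"
  have "relopen T (\<Union>?K)"
  proof (rule relopen_Union)
    show "subspace T" using B by (simp add: relopen_def)
    fix V assume "V \<in> ?K"
    then obtain c where c: "c \<in> atlas M" "V = {w \<in> pdom B g c. snd c (g w) \<in> snd c ` (fst c \<inter> U)}" by blast
    have "openin (top_of_set (model M)) (snd c ` (fst c \<inter> U))"
      using chart_image_open[OF c(1) U] by (simp add: relopen_def)
    then show "relopen T V" unfolding c(2)
      by (rule relopen_preimage[OF param_relopen[OF g c(1)] smooth_on_continuous[OF param_smooth[OF g c(1)]]])
        (use pdom_image[of c g B] relopen_subset[OF relopen_cdom[OF c(1)]] in blast)
  qed
  moreover have "\<Union>?K = {w \<in> B. g w \<in> U}"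
  proof (intro equalityI subsetI)
    fix w assume "w \<in> \<Union>?K"
    then obtain c where c: "c \<in> atlas M" "w \<in> pdom B g c" "snd c (g w) \<in> snd c ` (fst c \<inter> U)" by blast
    then have "g w \<in> U" using chart_inj[OF c(1)] by (auto simp: pdom_def inj_on_def)
    then show "w \<in> {w \<in> B. g w \<in> U}" using c by (simp add: pdom_def)
  next
    fix w assume w: "w \<in> {w \<in> B. g w \<in> U}"
    then obtain c where "c \<in> charts_at M (g w)" using ex_chart[OF param_points[OF g]] by blast
    then have "c \<in> atlas M" "w \<in> {w \<in> pdom B g c. snd c (g w) \<in> snd c ` (fst c \<inter> U)}"
      using w by (auto simp: charts_at_def pdom_def)
    then show "w \<in> \<Union>?K" by blast
  qed
  ultimately show ?thesis by simp
qed

lemma ptan_cong: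
  assumes "\<And>w. w \<in> B \<Longrightarrow> g w = h w" "w \<in> B"
  shows "ptan M B g w t = ptan M B h w t"
proof -
  have pd: "pdom B g c = pdom B h c" for c using assms(1) by (auto simp: pdom_def)
  have "pd B g c w t = pd B h c w t" if "c \<in> charts_at M (g w)" for c
  proof -
    have "w \<in> pdom B h c" using that assms by (simp add: pdom_def charts_at_def)
    then have "fderiv (pdom B h c) (\<lambda>w. snd c (g w)) w = fderiv (pdom B h c) (\<lambda>w. snd c (h w)) w"
      by (intro frechet_derivative_cong_within) (use assms(1) in \<open>auto simp: pdom_def\<close>)
    then show ?thesis by (simp add: pd_def pd)
  qed
  then show ?thesis using assms by (auto simp: ptan_def fun_eq_iff)
qed

text \<open>The plaques may overlap arbitrarily. Countability of \<open>J\<close> will make their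
  union second countable.\<close>

locale plaque_family = distribution_on M D m L
  for M :: "('a, 'e::euclidean_space) mfd" and D m L +
  fixes J :: "'i set" and c :: "'i \<Rightarrow> ('a, 'e) chart" and B :: "'i \<Rightarrow> 'e set"
    and G \<rho> :: "'i \<Rightarrow> 'e \<Rightarrow> 'e"
  assumes countable: "countable J" and plaque: "\<And>j. j \<in> J \<Longrightarrow> plaque (c j) (B j) (G j) (\<rho> j)"
begin

definition g :: "'i \<Rightarrow> 'e \<Rightarrow> 'a" where "g j w = chart_inv (c j) (G j w)"
definition leaf :: "'i \<Rightarrow> 'a set" where "leaf j = g j ` B j"
text \<open>The inverse of \<open>g j\<close> on its leaf, written so that it extends smoothly to
  the whole domain of the chart \<open>c j\<close> of \<open>M\<close>.\<close>

definition \<psi> :: "'i \<Rightarrow> 'a \<Rightarrow> 'e" where "\<psi> j x = \<rho> j (snd (c j) x)"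
text \<open>The final topology for the maps \<open>g j\<close>, in general finer than the one
  induced from \<open>M\<close>.\<close>

definition plaque_open_set :: "'a set \<Rightarrow> bool" where
  "plaque_open_set U \<longleftrightarrow> U \<subseteq> (\<Union>j\<in>J. leaf j) \<and> (\<forall>j\<in>J. relopen L {w \<in> B j. g j w \<in> U})"

definition union_mfd :: "('a, 'e) mfd" where
  "union_mfd = \<lparr>mtop = topology plaque_open_set, model = L, atlas = (\<lambda>j. (leaf j, \<psi> j)) ` J\<rparr>"

lemma plaque_parts:
  assumes "j \<in> J"
  shows "c j \<in> atlas M" "w \<in> B j \<Longrightarrow> G j w \<in> cdom (c j)" "w \<in> B j \<Longrightarrow> \<rho> j (G j w) = w"
    "relopen S V \<Longrightarrow> smooth_on S V (\<rho> j)" "Dparam L (B j) (g j)" "param M L (B j) (g j)"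
    "Dparam T A h \<Longrightarrow> relopen T {w \<in> A. h w \<in> leaf j}" "relopen L (B j)"
proof -
  note p = plaque[OF assms, unfolded plaque_def]
  have gl: "g j = (\<lambda>w. chart_inv (c j) (G j w))" by (simp add: fun_eq_iff g_def)
  show "c j \<in> atlas M" "w \<in> B j \<Longrightarrow> G j w \<in> cdom (c j)" "w \<in> B j \<Longrightarrow> \<rho> j (G j w) = w"
    "relopen S V \<Longrightarrow> smooth_on S V (\<rho> j)" "Dparam T A h \<Longrightarrow> relopen T {w \<in> A. h w \<in> leaf j}"
    using p unfolding leaf_def gl by blast+
  show D: "Dparam L (B j) (g j)" using p unfolding gl by blast
  then show "param M L (B j) (g j)" by (simp add: Dparam_def)
  then show "relopen L (B j)" by (rule param_relopen_dom)
qed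

lemma g_in_chart: "j \<in> J \<Longrightarrow> w \<in> B j \<Longrightarrow> g j w \<in> fst (c j)"
  and G_eq: "j \<in> J \<Longrightarrow> w \<in> B j \<Longrightarrow> snd (c j) (g j w) = G j w"
  unfolding g_def by (rule chart_inv_in[OF plaque_parts(2)] chart_inv_right[OF plaque_parts(2)]; assumption)+

lemma \<psi>_g: "j \<in> J \<Longrightarrow> w \<in> B j \<Longrightarrow> \<psi> j (g j w) = w"
  by (simp add: \<psi>_def G_eq plaque_parts)

lemma g_\<psi>: "j \<in> J \<Longrightarrow> x \<in> leaf j \<Longrightarrow> g j (\<psi> j x) = x"
  and \<psi>_in: "j \<in> J \<Longrightarrow> x \<in> leaf j \<Longrightarrow> \<psi> j x \<in> B j"
  by (auto simp: leaf_def \<psi>_g)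

lemma \<psi>_image:
  assumes j: "j \<in> J" and U: "U \<subseteq> leaf j"
  shows "\<psi> j ` U = {w \<in> B j. g j w \<in> U}"
proof (intro equalityI subsetI)
  fix w assume "w \<in> \<psi> j ` U"
  then show "w \<in> {w \<in> B j. g j w \<in> U}" using U g_\<psi>[OF j] \<psi>_in[OF j] by auto
next
  fix w assume "w \<in> {w \<in> B j. g j w \<in> U}"
  then show "w \<in> \<psi> j ` U" using \<psi>_g[OF j] by (metis (mono_tags, lifting) imageI mem_Collect_eq)
qed

text \<open>Openness is the last clause of \<open>plaque\<close>. As \<open>\<psi> i\<close> is
  \<open>\<rho> i\<close> after a chart of \<open>M\<close>, the transition is a composition of
  smooth maps.\<close>

lemma transition:
  assumes i: "i \<in> J" and j: "j \<in> J"
  shows "relopen L {w \<in> B j. g j w \<in> leaf i}" "smooth_on L {w \<in> B j. g j w \<in> leaf i} (\<lambda>w. \<psi> i (g j w))"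
proof -
  let ?A = "{w \<in> B j. g j w \<in> leaf i}"
  show A: "relopen L ?A" by (rule plaque_parts(7)[OF i plaque_parts(5)[OF j]])
  note ci = plaque_parts(1)[OF i] and gj = plaque_parts(6)[OF j]
  have sub: "?A \<subseteq> pdom (B j) (g j) (c i)" using g_in_chart[OF i] by (auto simp: pdom_def leaf_def)
  have sm: "smooth_on L ?A (\<lambda>w. snd (c i) (g j w))"
    by (rule smooth_on_open_subset[OF param_relopen[OF gj ci] A sub param_smooth[OF gj ci]])
  show "smooth_on L ?A (\<lambda>w. \<psi> i (g j w))"
    unfolding \<psi>_def
    by (rule smooth_on_comp[OF A relopen_cdom[OF ci] _ sm plaque_parts(4)[OF i relopen_cdom[OF ci]]])
      (use sub in \<open>auto simp: pdom_def\<close>)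
qed

text \<open>Each \<open>g i\<close> is an open map for the final topology, because its images pull
  back along \<open>g j\<close> to preimages under transitions. Hence the leaves are open and the
  \<open>\<psi> i\<close> can serve as charts.\<close>

lemma plaque_open_image:
  assumes i: "i \<in> J" and V: "relopen L V" "V \<subseteq> B i"
  shows "plaque_open_set (g i ` V)"
  unfolding plaque_open_set_def
proof (intro conjI ballI)
  show "g i ` V \<subseteq> (\<Union>j\<in>J. leaf j)" using V i by (auto simp: leaf_def)
  fix j assume j: "j \<in> J"
  let ?A = "{w \<in> B j. g j w \<in> leaf i}"
  have "{w \<in> B j. g j w \<in> g i ` V} = {w \<in> ?A. \<psi> i (g j w) \<in> V}"
  proof (intro equalityI subsetI)
    fix w assume "w \<in> {w \<in> B j. g j w \<in> g i ` V}"
    then obtain v where v: "w \<in> B j" "v \<in> V" "g j w = g i v" by blast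
    moreover have "v \<in> B i" using v V by blast
    ultimately show "w \<in> {w \<in> ?A. \<psi> i (g j w) \<in> V}" using \<psi>_g[OF i] by (simp add: leaf_def)
  next
    fix w assume "w \<in> {w \<in> ?A. \<psi> i (g j w) \<in> V}"
    then have w: "w \<in> B j" "g j w \<in> leaf i" "\<psi> i (g j w) \<in> V" by blast+
    have "g i (\<psi> i (g j w)) \<in> g i ` V" by (rule imageI[OF w(3)])
    then show "w \<in> {w \<in> B j. g j w \<in> g i ` V}" using w(1) g_\<psi>[OF i w(2)] by simp
  qed
  moreover have "relopen L {w \<in> ?A. \<psi> i (g j w) \<in> V}"
  proof (rule relopen_preimage[OF transition(1)[OF i j] smooth_on_continuous[OF transition(2)[OF i j]]])
    show "openin (top_of_set L) V" using V by (simp add: relopen_def)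
    show "(\<lambda>w. \<psi> i (g j w)) ` ?A \<subseteq> L"
      using \<psi>_in[OF i] relopen_subset[OF plaque_parts(8)[OF i]] by blast
  qed
  ultimately show "relopen L {w \<in> B j. g j w \<in> g i ` V}" by simp
qed

lemma istopology_plaque: "istopology plaque_open_set"
  unfolding istopology_def
proof (intro conjI allI impI)
  fix U V assume U: "plaque_open_set U" and V: "plaque_open_set V"
  have "{w \<in> B j. g j w \<in> U \<inter> V} = {w \<in> B j. g j w \<in> U} \<inter> {w \<in> B j. g j w \<in> V}" for j by blast
  then have "relopen L {w \<in> B j. g j w \<in> U \<inter> V}" if "j \<in> J" for j
    using U V that unfolding plaque_open_set_def by (simp only: relopen_Int)
  then show "plaque_open_set (U \<inter> V)" using U V unfolding plaque_open_set_def by blast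
next
  fix K assume K: "\<forall>U\<in>K. plaque_open_set U"
  have eq: "{w \<in> B j. g j w \<in> \<Union>K} = \<Union>((\<lambda>U. {w \<in> B j. g j w \<in> U}) ` K)" for j by blast
  have "relopen L {w \<in> B j. g j w \<in> \<Union>K}" if "j \<in> J" for j
    unfolding eq by (rule relopen_Union[OF L(1)]) (use K that in \<open>auto simp: plaque_open_set_def\<close>)
  then show "plaque_open_set (\<Union>K)" using K unfolding plaque_open_set_def by blast
qed

lemma openin_union_mfd: "openin (mtop union_mfd) U \<longleftrightarrow> plaque_open_set U"
  by (simp add: union_mfd_def topology_inverse'[OF istopology_plaque])

lemma leaf_open: "j \<in> J \<Longrightarrow> openin (mtop union_mfd) (leaf j)"
  unfolding openin_union_mfd leaf_def by (rule plaque_open_image) (use plaque_parts(8) in auto)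

lemma points_union_mfd: "points union_mfd = (\<Union>j\<in>J. leaf j)"
proof
  show "points union_mfd \<subseteq> (\<Union>j\<in>J. leaf j)"
    using openin_topspace[of "mtop union_mfd"] unfolding openin_union_mfd plaque_open_set_def by blast
  show "(\<Union>j\<in>J. leaf j) \<subseteq> points union_mfd" using leaf_open openin_subset by blast
qed

lemma model_union_mfd: "model union_mfd = L" and atlas_union_mfd: "atlas union_mfd = (\<lambda>j. (leaf j, \<psi> j)) ` J"
  by (simp_all add: union_mfd_def)

lemma leaf_points: "j \<in> J \<Longrightarrow> leaf j \<subseteq> points M"
  using param_points[OF plaque_parts(6)] by (auto simp: leaf_def)

lemma openin_restrict:
  assumes "openin (mtop M) U"
  shows "openin (mtop union_mfd) (U \<inter> points union_mfd)"
  unfolding openin_union_mfd plaque_open_set_def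
proof (intro conjI ballI)
  show "U \<inter> points union_mfd \<subseteq> (\<Union>j\<in>J. leaf j)" unfolding points_union_mfd by blast
  fix j assume j: "j \<in> J"
  have "{w \<in> B j. g j w \<in> U \<inter> points union_mfd} = {w \<in> B j. g j w \<in> U}"
    unfolding points_union_mfd using j by (auto simp: leaf_def)
  then show "relopen L {w \<in> B j. g j w \<in> U \<inter> points union_mfd}"
    using param_continuous[OF plaque_parts(6)[OF j] assms] by simp
qed

lemma inclusion_continuous: "continuous_map (mtop union_mfd) (mtop M) (\<lambda>x. x)"
  unfolding continuous_map_def
proof (intro conjI allI impI)
  show "(\<lambda>x. x) \<in> points union_mfd \<rightarrow> points M" unfolding points_union_mfd using leaf_points by blast
  fix U assume "openin (mtop M) U"
  from openin_restrict[OF this] show "openin (mtop union_mfd) {x \<in> points union_mfd. x \<in> U}"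
    by (simp add: Int_def conj_commute)
qed

lemma cdom_leaf: "j \<in> J \<Longrightarrow> \<psi> j ` leaf j = B j"
  using \<psi>_image[of j "leaf j"] by (auto simp: leaf_def)

lemma chart_inv_leaf:
  assumes j: "j \<in> J" and w: "w \<in> B j"
  shows "inv_into (leaf j) (\<psi> j) w = g j w"
proof (rule inv_into_f_eq)
  show "inj_on (\<psi> j) (leaf j)" using g_\<psi>[OF j] by (metis inj_onI)
  show "g j w \<in> leaf j" using w by (simp add: leaf_def)
qed (rule \<psi>_g[OF j w])

lemma leaf_chart:
  assumes j: "j \<in> J"
  shows "is_chart (mtop union_mfd) L (leaf j, \<psi> j)"
proof -
  have top: "topspace (subtopology (mtop union_mfd) (leaf j)) = leaf j"
    using openin_subset[OF leaf_open[OF j]] by (simp add: Int_absorb1)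
  have "homeomorphic_map (subtopology (mtop union_mfd) (leaf j)) (top_of_set (B j)) (\<psi> j)"
  proof (rule bijective_open_imp_homeomorphic_map)
    show "continuous_map (subtopology (mtop union_mfd) (leaf j)) (top_of_set (B j)) (\<psi> j)"
      unfolding continuous_map_def top
    proof (intro conjI allI impI)
      show "\<psi> j \<in> leaf j \<rightarrow> topspace (top_of_set (B j))" using \<psi>_in[OF j] by simp
      fix U assume U: "openin (top_of_set (B j)) U"
      then have UB: "U \<subseteq> B j" using openin_subset by fastforce
      have "relopen L U" using U plaque_parts(8)[OF j] unfolding relopen_def by (meson openin_trans)
      then have "openin (mtop union_mfd) (g j ` U)" unfolding openin_union_mfd by (rule plaque_open_image[OF j _ UB])
      moreover have "{x \<in> leaf j. \<psi> j x \<in> U} = g j ` U"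
      proof (intro equalityI subsetI)
        fix x assume "x \<in> {x \<in> leaf j. \<psi> j x \<in> U}"
        then show "x \<in> g j ` U" using g_\<psi>[OF j] by (metis (mono_tags, lifting) imageI mem_Collect_eq)
      next
        fix x assume "x \<in> g j ` U"
        then show "x \<in> {x \<in> leaf j. \<psi> j x \<in> U}" using UB \<psi>_g[OF j] by (auto simp: leaf_def)
      qed
      ultimately show "openin (subtopology (mtop union_mfd) (leaf j)) {x \<in> leaf j. \<psi> j x \<in> U}"
        using leaf_open[OF j] by (simp add: openin_open_subtopology) blast
    qed
    show "open_map (subtopology (mtop union_mfd) (leaf j)) (top_of_set (B j)) (\<psi> j)"
      unfolding open_map_def
    proof (intro allI impI)
      fix U assume "openin (subtopology (mtop union_mfd) (leaf j)) U"
      then have U: "plaque_open_set U" "U \<subseteq> leaf j"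
        using leaf_open[OF j] by (auto simp: openin_open_subtopology openin_union_mfd)
      then have "relopen L (\<psi> j ` U)" using j by (simp add: \<psi>_image plaque_open_set_def)
      moreover have "\<psi> j ` U \<subseteq> B j" using \<psi>_in[OF j] U by blast
      ultimately show "openin (top_of_set (B j)) (\<psi> j ` U)"
        using relopen_subset[OF plaque_parts(8)[OF j]] unfolding relopen_def by (meson openin_subset_trans)
    qed
    show "\<psi> j ` topspace (subtopology (mtop union_mfd) (leaf j)) = topspace (top_of_set (B j))"
      unfolding top using cdom_leaf[OF j] by simp
    show "inj_on (\<psi> j) (topspace (subtopology (mtop union_mfd) (leaf j)))"
      unfolding top using g_\<psi>[OF j] by (metis inj_onI)
  qed
  then show ?thesis
    unfolding is_chart_def using leaf_open[OF j] cdom_leaf[OF j] plaque_parts(8)[OF j] by (simp add: relopen_def)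
qed

lemma second_countable_union_mfd: "second_countable (mtop union_mfd)"
proof -
  obtain \<C> :: "'e set set" where \<C>: "Countable_Set.countable \<C>" "topological_basis \<C>"
    using ex_countable_basis by blast
  let ?\<B> = "\<Union>j\<in>J. (\<lambda>b. g j ` (B j \<inter> b)) ` \<C>"
  have "Countable_Set.countable ?\<B>" using countable \<C>(1) by (intro countable_UN countable_image)
  moreover have "\<forall>V\<in>?\<B>. openin (mtop union_mfd) V"
  proof
    fix V assume "V \<in> ?\<B>"
    then obtain j b where jb: "j \<in> J" "b \<in> \<C>" "V = g j ` (B j \<inter> b)" by blast
    have "open b" using jb(2) \<C>(2) topological_basis_open by blast
    then show "openin (mtop union_mfd) V" unfolding openin_union_mfd jb(3)
      by (intro plaque_open_image[OF jb(1)] relopen_Int_open plaque_parts(8)[OF jb(1)]) auto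
  qed
  moreover have "\<forall>U x. openin (mtop union_mfd) U \<and> x \<in> U \<longrightarrow> (\<exists>V\<in>?\<B>. x \<in> V \<and> V \<subseteq> U)"
  proof (intro allI impI)
    fix U x assume "openin (mtop union_mfd) U \<and> x \<in> U"
    then have U: "openin (mtop union_mfd) U" and x: "x \<in> U" by blast+
    have "x \<in> points union_mfd" using U x openin_subset by blast
    then obtain j w where j: "j \<in> J" and w: "w \<in> B j" "x = g j w" unfolding points_union_mfd leaf_def by blast
    have "relopen L {w \<in> B j. g j w \<in> U}" using U j unfolding openin_union_mfd plaque_open_set_def by blast
    then obtain A where A: "open A" "{w \<in> B j. g j w \<in> U} = L \<inter> A" by (auto simp: relopen_def openin_open)
    have "w \<in> {w \<in> B j. g j w \<in> U}" using w x by simp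
    then have "w \<in> A" using A by simp
    then obtain b where b: "b \<in> \<C>" "w \<in> b" "b \<subseteq> A" using topological_basisE[OF \<C>(2) A(1)] by metis
    have "B j \<inter> b \<subseteq> {w \<in> B j. g j w \<in> U}"
      unfolding A(2) using b(3) relopen_subset[OF plaque_parts(8)[OF j]] by blast
    then have "g j ` (B j \<inter> b) \<subseteq> U" by blast
    moreover have "x \<in> g j ` (B j \<inter> b)" using w b by blast
    ultimately show "\<exists>V\<in>?\<B>. x \<in> V \<and> V \<subseteq> U" using j b(1) by blast
  qed
  ultimately show ?thesis unfolding second_countable_def by (intro exI[of _ ?\<B>] conjI)
qed

text \<open>The inclusion into \<open>M\<close> is continuous and injective, so separation is
  inherited.\<close>

lemma Hausdorff_union_mfd: "Hausdorff_space (mtop union_mfd)"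
  unfolding Hausdorff_space_def
proof (intro allI impI)
  fix x y assume xy: "x \<in> points union_mfd \<and> y \<in> points union_mfd \<and> x \<noteq> y"
  then have "x \<in> points M" "y \<in> points M" unfolding points_union_mfd using leaf_points by blast+
  moreover have "Hausdorff_space (mtop M)" using smooth_manifold by (simp add: smooth_manifold_def)
  ultimately have "\<exists>U V. openin (mtop M) U \<and> openin (mtop M) V \<and> x \<in> U \<and> y \<in> V \<and> disjnt U V"
    using xy unfolding Hausdorff_space_def by simp
  then obtain U V where "openin (mtop M) U" "openin (mtop M) V" "x \<in> U" "y \<in> V" "disjnt U V"
    by (elim exE conjE)
  then show "\<exists>U V. openin (mtop union_mfd) U \<and> openin (mtop union_mfd) V \<and> x \<in> U \<and> y \<in> V \<and> disjnt U V"
    using xy openin_restrict[of U] openin_restrict[of V]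
    by (intro exI[of _ "U \<inter> points union_mfd"] exI[of _ "V \<inter> points union_mfd"]) (auto simp: disjnt_def)
qed

lemma smooth_manifold_union_mfd: "smooth_manifold union_mfd"
  unfolding smooth_manifold_def model_union_mfd atlas_union_mfd
proof (intro conjI ballI)
  show "Hausdorff_space (mtop union_mfd)" by (rule Hausdorff_union_mfd)
  show "second_countable (mtop union_mfd)" by (rule second_countable_union_mfd)
  show "subspace L" by (rule L(1))
  show "is_chart (mtop union_mfd) L k" if "k \<in> (\<lambda>j. (leaf j, \<psi> j)) ` J" for k using that leaf_chart by auto
  show "(\<Union>k\<in>(\<lambda>j. (leaf j, \<psi> j)) ` J. fst k) = points union_mfd" unfolding points_union_mfd by simp
  fix k l assume "k \<in> (\<lambda>j. (leaf j, \<psi> j)) ` J" "l \<in> (\<lambda>j. (leaf j, \<psi> j)) ` J"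
  then obtain i j where ij: "i \<in> J" "j \<in> J" "k = (leaf i, \<psi> i)" "l = (leaf j, \<psi> j)" by blast
  have "\<psi> i ` (leaf i \<inter> leaf j) = {w \<in> B i. g i w \<in> leaf j}"
    using \<psi>_image[OF ij(1), of "leaf i \<inter> leaf j"] by (auto simp: leaf_def)
  moreover have "smooth_on L {w \<in> B i. g i w \<in> leaf j} (\<psi> j \<circ> inv_into (leaf i) (\<psi> i))"
    by (rule smooth_on_cong[THEN iffD1, OF _ transition(2)[OF ij(2,1)]]) (simp add: chart_inv_leaf[OF ij(1)])
  ultimately show "smooth_on L (snd k ` (fst k \<inter> fst l)) (snd l \<circ> chart_inv k)" by (simp add: ij)
qed

lemma smooth_inclusion: "smooth_map union_mfd M (\<lambda>x. x)"
  unfolding smooth_map_def model_union_mfd atlas_union_mfd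
proof (intro conjI ballI)
  show "continuous_map (mtop union_mfd) (mtop M) (\<lambda>x. x)" by (rule inclusion_continuous)
  fix k d assume "k \<in> (\<lambda>j. (leaf j, \<psi> j)) ` J" and d: "d \<in> atlas M"
  then obtain j where j: "j \<in> J" "k = (leaf j, \<psi> j)" by blast
  have "rep_dom k d (\<lambda>x. x) = pdom (B j) (g j) d"
    using \<psi>_image[OF j(1), of "leaf j \<inter> fst d"] by (auto simp: rep_dom_def j(2) pdom_def leaf_def Int_def)
  moreover have "smooth_on L (pdom (B j) (g j) d) (rep k d (\<lambda>x. x))"
    by (rule smooth_on_cong[THEN iffD1, OF _ param_smooth[OF plaque_parts(6)[OF j(1)] d]])
      (simp add: rep_def j(2) pdom_def chart_inv_leaf[OF j(1)])
  ultimately show "smooth_on L (rep_dom k d (\<lambda>x. x)) (rep k d (\<lambda>x. x))" by simp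
qed

text \<open>In the chart \<open>c j\<close>, \<open>\<rho> j\<close> is a smooth left inverse of
  \<open>g j\<close>, so its derivative is a left inverse of \<open>pd\<close> on \<open>L\<close>.
  This is the immersion property of the union.\<close>

lemma pd_injective:
  assumes j: "j \<in> J" and w: "w \<in> B j"
  shows "inj_on (pd (B j) (g j) (c j) w) L"
proof (rule inj_onI)
  fix s t assume s: "s \<in> L" and t: "t \<in> L" and eq: "pd (B j) (g j) (c j) w s = pd (B j) (g j) (c j) w t"
  note cj = plaque_parts(1)[OF j]
  have pB: "pdom (B j) (g j) (c j) = B j" using g_in_chart[OF j] by (auto simp: pdom_def)
  have "smooth_on (model M) (cdom (c j)) (\<rho> j)" by (rule plaque_parts(4)[OF j relopen_cdom[OF cj]])
  from smooth_on_has_derivative[OF this, of "G j w"] plaque_parts(2)[OF j w]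
  have \<rho>: "(\<rho> j has_derivative fderiv (cdom (c j)) (\<rho> j) (G j w)) (at (G j w) within cdom (c j))" by blast
  have d: "((\<lambda>w. snd (c j) (g j w)) has_derivative pd (B j) (g j) (c j) w) (at w within B j)"
    using pd_has_derivative[OF plaque_parts(6)[OF j] cj, of w] w unfolding pB by blast
  have "((\<rho> j \<circ> (\<lambda>w. snd (c j) (g j w))) has_derivative (fderiv (cdom (c j)) (\<rho> j) (G j w) \<circ> pd (B j) (g j) (c j) w)) (at w within B j)"
    by (rule diff_chain_within[OF d has_derivative_subset[where s = "cdom (c j)"]])
      (use \<rho> G_eq[OF j w] g_in_chart[OF j] in auto)
  then have 1: "((\<lambda>w. w) has_derivative (fderiv (cdom (c j)) (\<rho> j) (G j w) \<circ> pd (B j) (g j) (c j) w)) (at w within B j)"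
    by (rule has_derivative_transform[OF w, rotated]) (simp add: G_eq[OF j] plaque_parts(3)[OF j])
  have "(fderiv (cdom (c j)) (\<rho> j) (G j w) \<circ> pd (B j) (g j) (c j) w) v = v" if "v \<in> L" for v
    by (rule has_derivative_unique_on[OF plaque_parts(8)[OF j] w 1 has_derivative_ident that])
  from this[OF s] this[OF t] show "s = t" by (simp add: eq)
qed

lemma union_mfd_tangent_map:
  assumes j: "j \<in> J" and x: "x \<in> leaf j" and v: "v \<in> tangent_space union_mfd x"
  shows "tangent_map union_mfd M (\<lambda>x. x) x v = ptan M (B j) (g j) (\<psi> j x) (v (leaf j, \<psi> j))"
    "v (leaf j, \<psi> j) \<in> L"
proof -
  let ?k = "(leaf j, \<psi> j)"
  have k: "?k \<in> charts_at union_mfd x" using j x by (simp add: charts_at_def atlas_union_mfd)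
  show "v ?k \<in> L" using v k unfolding tangent_space_def model_union_mfd by blast
  have "tangent_map union_mfd M (\<lambda>x. x) x v = ptan M (cdom ?k) (chart_inv ?k) (snd ?k x) (v ?k)"
    by (rule tangent_map_eq_ptan[OF smooth_manifold smooth_manifold_union_mfd smooth_inclusion k v])
  also have "\<dots> = ptan M (B j) (inv_into (leaf j) (\<psi> j)) (\<psi> j x) (v ?k)" using cdom_leaf[OF j] by simp
  also have "\<dots> = ptan M (B j) (g j) (\<psi> j x) (v ?k)"
    by (rule ptan_cong[OF chart_inv_leaf[OF j] \<psi>_in[OF j x]])
  finally show "tangent_map union_mfd M (\<lambda>x. x) x v = ptan M (B j) (g j) (\<psi> j x) (v ?k)" .
qed

lemma integral_union_mfd:
  assumes "J \<noteq> {}" "\<And>j. j \<in> J \<Longrightarrow> leaf j \<noteq> {}"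
  shows "integral_manifold M D union_mfd"
  unfolding integral_manifold_def injectively_immersed_submanifold_def
proof (intro conjI ballI)
  interpret U: smooth_mfd union_mfd by unfold_locales (rule smooth_manifold_union_mfd)
  show "smooth_manifold union_mfd" by (rule smooth_manifold_union_mfd)
  show "points union_mfd \<noteq> {}" unfolding points_union_mfd using assms by blast
  show "points union_mfd \<subseteq> points M" unfolding points_union_mfd using leaf_points by blast
  show "smooth_map union_mfd M (\<lambda>x. x)" by (rule smooth_inclusion)
  fix x assume "x \<in> points union_mfd"
  then obtain j where j: "j \<in> J" and x: "x \<in> leaf j" unfolding points_union_mfd by blast
  let ?k = "(leaf j, \<psi> j)"
  have k: "?k \<in> charts_at union_mfd x" using j x by (simp add: charts_at_def atlas_union_mfd)
  have w: "\<psi> j x \<in> B j" by (rule \<psi>_in[OF j x])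
  have gx: "g j (\<psi> j x) = x" by (rule g_\<psi>[OF j x])
  show "inj_on (tangent_map union_mfd M (\<lambda>x. x) x) (tangent_space union_mfd x)"
  proof (rule inj_onI)
    fix v v' assume v: "v \<in> tangent_space union_mfd x" and v': "v' \<in> tangent_space union_mfd x"
      and eq: "tangent_map union_mfd M (\<lambda>x. x) x v = tangent_map union_mfd M (\<lambda>x. x) x v'"
    have "c j \<in> charts_at M (g j (\<psi> j x))"
      using plaque_parts(1)[OF j] g_in_chart[OF j w] by (simp add: charts_at_def)
    then have "pd (B j) (g j) (c j) (\<psi> j x) (v ?k) = pd (B j) (g j) (c j) (\<psi> j x) (v' ?k)"
      using fun_cong[OF eq, of "c j"]
      unfolding union_mfd_tangent_map(1)[OF j x v] union_mfd_tangent_map(1)[OF j x v'] ptan_def by simp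
    then have "v ?k = v' ?k"
      by (rule inj_onD[OF pd_injective[OF j w]]) (rule union_mfd_tangent_map(2)[OF j x] v v')+
    then show "v = v'" by (rule U.tangent_eqI[OF v v' k])
  qed
  show "tangent_map union_mfd M (\<lambda>x. x) x ` tangent_space union_mfd x \<subseteq> D x"
  proof (rule image_subsetI)
    fix v assume v: "v \<in> tangent_space union_mfd x"
    have "ptan M (B j) (g j) (\<psi> j x) (v ?k) \<in> D (g j (\<psi> j x))"
      using plaque_parts(5)[OF j] w union_mfd_tangent_map(2)[OF j x v] unfolding Dparam_def by blast
    then show "tangent_map union_mfd M (\<lambda>x. x) x v \<in> D x"
      unfolding union_mfd_tangent_map(1)[OF j x v] gx .
  qed
qed

end

context distribution_on
begin

lemma plaque_trace_open:
  assumes N: "integral_manifold M D N" and pl: "plaque c B G \<rho>"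
  shows "openin (mtop N) (points N \<inter> (\<lambda>w. chart_inv c (G w)) ` B)"
proof -
  interpret N: smooth_mfd N by unfold_locales (rule integral_manifold_parts(1)[OF N])
  let ?P = "(\<lambda>w. chart_inv c (G w)) ` B"
  show ?thesis
  proof (rule N.openin_charts)
    fix d assume d: "d \<in> atlas N"
    have "relopen (model N) {w \<in> cdom d. chart_inv d w \<in> ?P}"
      using pl integral_manifold_Dparam[OF N d] unfolding plaque_def by blast
    moreover have "snd d ` (fst d \<inter> (points N \<inter> ?P)) = {w \<in> cdom d. chart_inv d w \<in> ?P}"
      unfolding N.chart_inv_image[OF d] using N.chart_subset[OF d] by blast
    ultimately show "relopen (model N) (snd d ` (fst d \<inter> (points N \<inter> ?P)))" by simp
  qed simp
qed

lemma integral_manifold_extends: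
  assumes closed: "closed_under_bracket M D" and N: "integral_manifold M D N"
  obtains N' where "integral_manifold M D N'" "mfd_dim N' = m" "points N \<subseteq> points N'"
proof -
  note N' = integral_manifold_parts[OF N]
  have "\<forall>x\<in>points N. \<exists>q. (case q of (c, B, G, \<rho>) \<Rightarrow> plaque c B G \<rho> \<and> x \<in> (\<lambda>w. chart_inv c (G w)) ` B)"
  proof
    fix x assume "x \<in> points N"
    then have "x \<in> points M" using N'(3) by blast
    from plaque_exists[OF closed this] obtain c B G \<rho> where "plaque c B G \<rho>" "x \<in> (\<lambda>w. chart_inv c (G w)) ` B" by blast
    then show "\<exists>q. (case q of (c, B, G, \<rho>) \<Rightarrow> plaque c B G \<rho> \<and> x \<in> (\<lambda>w. chart_inv c (G w)) ` B)"
      by (intro exI[of _ "(c, B, G, \<rho>)"]) simp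
  qed
  from bchoice[OF this] obtain q where q: "\<forall>x\<in>points N.
      (case q x of (c, B, G, \<rho>) \<Rightarrow> plaque c B G \<rho> \<and> x \<in> (\<lambda>w. chart_inv c (G w)) ` B)"
    by (rule exE)
  define c where "c = (\<lambda>x. fst (q x))"
  define B where "B = (\<lambda>x. fst (snd (q x)))"
  define G where "G = (\<lambda>x. fst (snd (snd (q x))))"
  define \<rho> where "\<rho> = (\<lambda>x. snd (snd (snd (q x))))"
  define P where "P = (\<lambda>x. (\<lambda>w. chart_inv (c x) (G x w)) ` B x)"
  have pl: "plaque (c x) (B x) (G x) (\<rho> x)" and xP: "x \<in> P x" if "x \<in> points N" for x
    using bspec[OF q that] by (simp_all add: c_def B_def G_def \<rho>_def P_def case_prod_beta)
  \<comment> \<open>One plaque was chosen per point of \<open>N\<close>. Their traces are open in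
    the own topology of \<open>N\<close>, and second countability of \<open>N\<close> leaves
    countably many of them.\<close>
  have "Lindelof_space (mtop N)"
    using N'(1) second_countable_imp_Lindelof_space unfolding smooth_manifold_def by blast
  moreover have "\<forall>U\<in>(\<lambda>x. points N \<inter> P x) ` points N. openin (mtop N) U"
    using plaque_trace_open[OF N pl] by (auto simp: P_def)
  moreover have "\<Union>((\<lambda>x. points N \<inter> P x) ` points N) = points N" using xP by blast
  ultimately obtain \<V> where \<V>: "countable \<V>" "\<V> \<subseteq> (\<lambda>x. points N \<inter> P x) ` points N" "\<Union>\<V> = points N"
    unfolding Lindelof_space_def by meson
  then obtain J where J: "countable J" "J \<subseteq> points N" "\<V> = (\<lambda>x. points N \<inter> P x) ` J"
    using countable_subset_image by metis
  interpret F: plaque_family M D m L J c B G \<rho>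
    by unfold_locales (use J pl in auto)
  have leaf: "F.leaf j = P j" for j by (auto simp: F.leaf_def P_def F.g_def)
  show thesis
  proof (rule that[of F.union_mfd])
    show "integral_manifold M D F.union_mfd"
    proof (rule F.integral_union_mfd)
      show "J \<noteq> {}" using \<V>(3) unfolding J(3) using N'(2) by blast
      show "F.leaf j \<noteq> {}" if "j \<in> J" for j using xP J(2) that leaf by blast
    qed
    show "mfd_dim F.union_mfd = m" by (simp add: mfd_dim_def F.model_union_mfd L(2))
    show "points N \<subseteq> points F.union_mfd" unfolding F.points_union_mfd leaf using \<V>(3) J(3) by blast
  qed
qed

end

subsection \<open>Frobenius' theorem\<close>

text \<open>On a singleton every bounded linear map is a derivative, so the one chosen by
  \<open>frechet_derivative\<close> is unspecified. The induction over all \<open>f\<close> copes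
  with whatever it is.\<close>

lemma Ck_on_zero_space: "V \<subseteq> {0} \<Longrightarrow> Ck_on k {0::'e::euclidean_space} V f"
proof (induction k arbitrary: f)
  case 0
  then show ?case by (simp add: finite_subset continuous_on_finite)
next
  case (Suc k f)
  have "(f has_derivative (\<lambda>_. 0)) (at x within V)" if "x \<in> V" for x
  proof -
    have "V = {x}" using Suc.prems that by blast
    then show ?thesis by (simp add: has_derivative_within_singleton_iff)
  qed
  then have "f differentiable_on V" unfolding differentiable_on_def differentiable_def by blast
  then show ?case using Suc by simp
qed

context distribution_on
begin

text \<open>Starts the search for an integral manifold of largest dimension through
  \<open>x\<close>. All tangent vectors of a point are zero, so immersion and tangency are
  automatic.\<close>

lemma point_integral_manifold:
  assumes x: "x \<in> points M"
  obtains N where "integral_manifold M D N" "x \<in> points N"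
proof -
  define k :: "('a, 'e) chart" where "k = ({x}, \<lambda>_. 0)"
  define N :: "('a, 'e) mfd" where "N = \<lparr>mtop = subtopology (mtop M) {x}, model = {0}, atlas = {k}\<rparr>"
  have pN: "points N = {x}" using x by (simp add: N_def)
  have smooth: "smooth_on {0} V f" if "V \<subseteq> {0}" for V :: "'e set" and f :: "'e \<Rightarrow> 'e"
    unfolding smooth_on_def using Ck_on_zero_space[OF that] by blast
  have "homeomorphic_map (subtopology (mtop N) {x}) (top_of_set {0 :: 'e}) (\<lambda>_. 0)"
    by (rule bijective_open_imp_homeomorphic_map)
      (use pN in \<open>auto simp: open_map_def subset_singleton_iff dest!: openin_subset\<close>)
  then have "is_chart (mtop N) {0} k"
    unfolding is_chart_def k_def using openin_topspace[of "mtop N"] pN by simp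
  then have N: "smooth_manifold N"
    unfolding smooth_manifold_def using smooth_manifold x pN
    by (auto simp: N_def smooth_manifold_def Hausdorff_space_subtopology second_countable_subtopology k_def smooth
        intro!: smooth)
  have sm: "smooth_map N M (\<lambda>x. x)"
    unfolding smooth_map_def
  proof (intro conjI ballI)
    show "continuous_map (mtop N) (mtop M) (\<lambda>x. x)"
      by (simp add: N_def continuous_map_from_subtopology)
    show "smooth_on (model N) (rep_dom c d (\<lambda>x. x)) (rep c d (\<lambda>x. x))" if "c \<in> atlas N" "d \<in> atlas M" for c d
      using that(1) by (auto simp: N_def k_def rep_dom_def intro!: smooth)
  qed
  interpret N: smooth_mfd N by unfold_locales (rule N)
  have k: "k \<in> charts_at N x" by (simp add: N_def charts_at_def k_def)
  have vk: "v k = 0" if "v \<in> tangent_space N x" for v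
    using N.tangent_in_model[OF that k] by (simp add: N_def)
  have "inj_on (tangent_map N M (\<lambda>x. x) x) (tangent_space N x)"
  proof (rule inj_onI)
    fix v w assume "v \<in> tangent_space N x" "w \<in> tangent_space N x"
    then show "v = w" using N.tangent_eqI[OF _ _ k] vk by metis
  qed
  moreover have "tangent_map N M (\<lambda>x. x) x v \<in> D x" if v: "v \<in> tangent_space N x" for v
  proof -
    have gp: "param M (model N) (cdom k) (chart_inv k)"
      by (rule submanifold_param[OF smooth_manifold N sm]) (simp add: N_def)
    have w: "snd k x \<in> cdom k" by (simp add: k_def)
    have inv: "chart_inv k (snd k x) = x" by (rule N.chart_inv_left) (simp_all add: N_def k_def)
    have "pd (cdom k) (chart_inv k) d (snd k x) 0 = 0" if "d \<in> charts_at M x" for d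
    proof -
      have "bounded_linear (pd (cdom k) (chart_inv k) d (snd k x))"
        by (rule has_derivative_bounded_linear[OF pd_has_derivative[OF gp]])
          (use that w inv in \<open>auto simp: pdom_def charts_at_def\<close>)
      then show ?thesis by (rule linear_simps(3))
    qed
    then have "ptan M (cdom k) (chart_inv k) (snd k x) (v k) = 0"
      by (auto simp: ptan_def inv vk[OF v] fun_eq_iff)
    then have "tangent_map N M (\<lambda>x. x) x v = 0"
      using tangent_map_eq_ptan[OF smooth_manifold N sm k v] by simp
    then show ?thesis using tv.subspace_0[OF D_subspace[OF x]] by simp
  qed
  ultimately have "integral_manifold M D N"
    unfolding integral_manifold_def injectively_immersed_submanifold_def using N pN x sm by auto
  then show thesis using that pN by blast
qed

lemma completely_integrable_imp_closed:
  assumes ci: "completely_integrable M m D"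
  shows "closed_under_bracket M D"
proof (rule integrable_imp_closed)
  fix x assume x: "x \<in> points M"
  obtain N0 where N0: "integral_manifold M D N0" "x \<in> points N0" using point_integral_manifold[OF x] by blast
  define Q where "Q = (\<lambda>k. \<exists>N. integral_manifold M D N \<and> x \<in> points N \<and> mfd_dim N = k)"
  have "Q (mfd_dim N0)" unfolding Q_def using N0 by blast
  \<comment> \<open>The bound by \<open>m\<close> guarantees that a largest dimension
    exists.\<close>
  moreover have bd: "k \<le> m" if "Q k" for k using that integral_manifold_dim_le unfolding Q_def by blast
  ultimately have "Q (GREATEST k. Q k)" by (rule GreatestI_nat)
  then obtain N where N: "integral_manifold M D N" "x \<in> points N" "mfd_dim N = (GREATEST k. Q k)"
    unfolding Q_def by blast
  have "maximal_integral_manifold M D N"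
    unfolding maximal_integral_manifold_def
  proof (intro conjI ballI)
    show "integral_manifold M D N" by (rule N(1))
    fix y assume y: "y \<in> points N"
    \<comment> \<open>\<open>U\<close> is all of \<open>points M\<close>: a competitor contains
      \<open>N\<close>, hence \<open>x\<close>, so its dimension is counted by \<open>Q\<close>. The
      same argument serves every point \<open>y\<close> of \<open>N\<close>.\<close>
    have "\<not> (\<exists>N'. integral_manifold M D N' \<and> mfd_dim N' > mfd_dim N \<and> points N \<inter> points M \<subseteq> points N')"
    proof
      assume "\<exists>N'. integral_manifold M D N' \<and> mfd_dim N' > mfd_dim N \<and> points N \<inter> points M \<subseteq> points N'"
      then obtain N' where N': "integral_manifold M D N'" "mfd_dim N' > mfd_dim N" "points N \<inter> points M \<subseteq> points N'" by blast
      then have "Q (mfd_dim N')" unfolding Q_def using N(2) x by blast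
      then have "mfd_dim N' \<le> mfd_dim N" unfolding N(3) by (rule Greatest_le_nat) (rule bd)
      then show False using N'(2) by simp
    qed
    then show "\<exists>U. openin (mtop M) U \<and> y \<in> U \<and>
        \<not> (\<exists>N'. integral_manifold M D N' \<and> mfd_dim N' > mfd_dim N \<and> points N \<inter> U \<subseteq> points N')"
      using y integral_manifold_parts(3)[OF N(1)] by (intro exI[of _ "points M"]) auto
  qed
  then have dimN: "mfd_dim N = m" using ci unfolding completely_integrable_def by blast
  obtain d where d: "d \<in> charts_at M x" using ex_chart[OF x] by blast
  obtain V P a where ad: "adapted d V P a" "snd d x \<in> V" using adapted_exists[OF x d] by blast
  have "integrable_at V a (snd d x)" by (rule integral_manifold_integrable[OF N(1) dimN N(2) ad(1) d ad(2)])
  then show "\<exists>c V P a. adapted c V P a \<and> c \<in> charts_at M x \<and> snd c x \<in> V \<and> integrable_at V a (snd c x)"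
    using ad d by blast
qed

lemma closed_imp_completely_integrable:
  assumes closed: "closed_under_bracket M D"
  shows "completely_integrable M m D"
  unfolding completely_integrable_def
proof (intro allI impI)
  fix N assume max: "maximal_integral_manifold M D N"
  then have N: "integral_manifold M D N" by (simp add: maximal_integral_manifold_def)
  obtain x where x: "x \<in> points N" using integral_manifold_parts(2)[OF N] by blast
  obtain U where U: "\<not> (\<exists>N'. integral_manifold M D N' \<and> mfd_dim N' > mfd_dim N \<and> points N \<inter> U \<subseteq> points N')"
    using max x unfolding maximal_integral_manifold_def by blast
  obtain N' where N': "integral_manifold M D N'" "mfd_dim N' = m" "points N \<subseteq> points N'"
    using integral_manifold_extends[OF closed N] by blast
  \<comment> \<open>\<open>N'\<close> contains all of \<open>N\<close>, so for
    \<open>m > mfd_dim N\<close> it would violate maximality whichever \<open>U\<close> was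
    provided.\<close>
  have "\<not> m > mfd_dim N" using U N' by blast
  then show "mfd_dim N = m" using integral_manifold_dim_le[OF N] by simp
qed

end

theorem theorem10:
  fixes M :: "('a, 'e::euclidean_space) mfd"
    and m n :: nat
    and D :: "('a, 'e) distribution"
  assumes "smooth_manifold M"
    and "mfd_dim M = m + n"
    and "tangent_distribution M m D"
  shows "completely_integrable M m D \<longleftrightarrow> closed_under_bracket M D"
proof -
  \<comment> \<open>The codimension is nonnegative, so the ambient type has room for an
    \<open>m\<close>-dimensional \<open>L\<close>.\<close>
  have "m \<le> dim (model M)" using assms(2) by (simp add: mfd_dim_def)
  then obtain L where L: "subspace L" "L \<subseteq> span (model M)" "dim L = m"
    by (rule choose_subspace_of_subspace)
  interpret distribution_on M D m L
    by unfold_locales (rule assms L(1,3))+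
  show ?thesis using completely_integrable_imp_closed closed_imp_completely_integrable by blast
qed

end
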